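(* Let $P_1(D_x),\dots,P_n(D_x)$ be pseudo-differential operators on $\mathbb{T}^N$ with toroidal symbols $p_j\in S^{m_j}(\mathbb{Z}^N)$, $m_j\in\mathbb{R}$, and for $p\in\{0,1,\dots,n-1\}$ let $$\mathbb{L}^p=d_t+c(D_x)\wedge:\ \mathcal{D}'(\mathbb{T}^{n+N};\wedge^{p,0})\to\mathcal{D}'(\mathbb{T}^{n+N};\wedge^{p+1,0}),\qquad c(D_x)\wedge u=\sum_{j=1}^n\sum_{|K|=p} iP_j(D_x)u_K\,dt_j\wedge dt_K,$$ be the operator associated with the constant coefficient system $L_j=D_{t_j}+P_j(D_x)$, $j=1,\dots,n$, on $\mathbb{T}^{n+N}$. Then, for each $p=0,1,\dots,n-1$, the operator $\mathbb{L}^p$ is globally solvable if and only if there exist positive constants $C$ and $\lambda$ such that $$\|\widehat{\mathbb{L}}(\eta,\xi)\|\ \geq\ C\,|(\eta,\xi)|^{-\lambda}$$ for all $(\eta,\xi)\in\mathbb{Z}^{n+N}\setminus\{(0,0)\}$ with $\widehat{\mathbb{L}}(\eta,\xi)\neq0$.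
   Context: Coordinates on $\mathbb{T}^{n+N}\simeq\mathbb{R}^{n+N}/2\pi\mathbb{Z}^{n+N}$ are $(t,x)=(t_1,\dots,t_n,x_1,\dots,x_N)$, $D_{t_j}=i^{-1}\partial_{t_j}$, and $d_t$ is the exterior derivative in $t$. Pseudo-differential operators: $P_j(D_x)u(x)=\sum_{\xi\in\mathbb{Z}^N}e^{ix\cdot\xi}p_j(\xi)\widehat u(\xi)$, with $\widehat u(\xi)=(2\pi)^{-N}\int_{\mathbb{T}^N}e^{-ix\cdot\xi}u(x)\,dx$. The symbol $p_j:\mathbb{Z}^N\to\mathbb{C}$ belongs to the toroidal symbol class $S^{m_j}(\mathbb{Z}^N)$: for every multi-index $\alpha$ there is $C_\alpha>0$ with $|\Delta_\xi^\alpha p_j(\xi)|\le C_\alpha\langle\xi\rangle^{m_j-|\alpha|}$ for all $\xi$, where $\Delta_\xi^\alpha$ are forward differences and $\langle\xi\rangle=(1+|\xi|^2)^{1/2}$. Forms: $C^\infty(\mathbb{T}^{n+N};\wedge^{p,0})$ (resp. $\mathcal{D}'(\mathbb{T}^{n+N};\wedge^{p,0})$) is the space of $u=\sum_{|K|=p}u_K(t,x)\,dt_K$, where $K=(k_1<\dots<k_p)$ with $1\le k_1$, $k_p\le n$, $dt_K=dt_{k_1}\wedge\dots\wedge dt_{k_p}$, and $u_K\in C^\infty(\mathbb{T}^{n+N})$ (resp. $u_K\in\mathcal{D}'(\mathbb{T}^{n+N})$). For $p=n$ the operator $\mathbb{L}^n$ is the zero map. Partial Fourier coefficients: $f=\sum_{\xi\in\mathbb{Z}^N}\widehat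 f(t,\xi)e^{i\xi\cdot x}$, taken coefficientwise. Integral forms: for $\xi\in\mathbb{Z}^N$ set $c_{\xi0}=\sum_{j=1}^np_j(\xi)\,dt_j$. It is called integral if it is real and $\frac1{2\pi}\int_\sigma c_{\xi0}\in\mathbb{Z}$ for every 1-cycle $\sigma$ in $\mathbb{T}^n$ (equivalently, $p_j(\xi)\in\mathbb{Z}$ for all $j$). In that case let $\psi_\xi\in C^\infty(\mathbb{R}^n;\mathbb{R})$ satisfy $d\psi_\xi=\Pi^*(c_{\xi0})$, where $\Pi:\mathbb{R}^n\to\mathbb{T}^n$ is the universal covering; then $e^{i\psi_\xi}$ is well defined on $\mathbb{T}^n$. Compatibility set: $\mathbb{E}^p$ is the set of $f\in C^\infty(\mathbb{T}^{n+N};\wedge^{p+1,0})$ such that $\mathbb{L}^{p+1}f=0$ and, for every $\xi$ with $c_{\xi0}$ integral, the $(p+1)$-form $\widehat f(t,\xi)e^{i\psi_\xi(t)}$ is exact on $\mathbb{T}^n$. Global solvability: $\mathbb{L}^p$ is globally solvable if for each $f\in\mathbb{E}^p$ there exists $u\in\mathcal{D}'(\mathbb{T}^{n+N};\wedge^{p,0})$ with $\mathbb{L}^pu=f$. Symbol of $\mathbb{L}^p$: $\widehat{\mathbb{L}}(\eta,\xi)=i\sum_{j=1}^n(\eta_j+p_j(\xi))\,dt_j$ for $(\eta,\xi)\in\mathbb{Z}^n\times\mathbb{Z}^N$, with norm $\|\widehat{\mathbb{L}}(\eta,\xi)\|=\max_{j=1,\dots,n}|\eta_j+p_j(\xi)|$.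 *)

theory Defs
  imports "HOL-Analysis.Analysis"
begin

section \<open>Smooth functions and distributions on tori\<close>

text \<open>For a Euclidean space \<open>'a\<close>, the torus is \<open>'a\<close> modulo the lattice spanned by
  \<open>2 * pi * b\<close>, \<open>b \<in> Basis\<close>. Thus \<open>real^'n\<close>, \<open>real^'m\<close> and \<open>(real^'n) \<times> (real^'m)\<close> carry the
  tori of dimension \<open>n\<close>, \<open>N\<close> and \<open>n + N\<close>, where \<open>n = CARD('n)\<close> and \<open>N = CARD('m)\<close>. Functions on the
  torus are periodic functions on the Euclidean space.\<close>

definition pdv :: "'a \<Rightarrow> ('a::real_normed_vector \<Rightarrow> 'b::real_normed_vector) \<Rightarrow> 'a \<Rightarrow> 'b" where
  "pdv v f x = frechet_derivative f (at x) v"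

definition smooth :: "('a::euclidean_space \<Rightarrow> 'b::real_normed_vector) \<Rightarrow> bool" where
  "smooth f \<longleftrightarrow> (\<forall>bs. set bs \<subseteq> Basis \<longrightarrow> (\<forall>x. foldr pdv bs f differentiable (at x)))"

definition torus_periodic :: "('a::euclidean_space \<Rightarrow> 'b) \<Rightarrow> bool" where
  "torus_periodic f \<longleftrightarrow> (\<forall>b\<in>Basis. \<forall>x. f (x + (2 * pi) *\<^sub>R b) = f x)"

definition torus_smooth :: "('a::euclidean_space \<Rightarrow> complex) set" where
  "torus_smooth = {f. smooth f \<and> torus_periodic f}"

definition torus_integral :: "('a::euclidean_space \<Rightarrow> complex) \<Rightarrow> complex" where
  "torus_integral f = integral (cbox 0 ((2 * pi) *\<^sub>R One)) f"

text \<open>Since HOL functionals are total, a distribution is by convention \<open>0\<close> off the test functions;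
  equality of functionals is then equality of distributions. Every operator on functionals
  below keeps to this convention.\<close>

type_synonym 'a functional = "('a \<Rightarrow> complex) \<Rightarrow> complex"

definition torus_distributions :: "'a::euclidean_space functional set" where
  "torus_distributions = {u.
     (\<forall>\<phi>\<in>torus_smooth. \<forall>\<psi>\<in>torus_smooth. u (\<lambda>x. \<phi> x + \<psi> x) = u \<phi> + u \<psi>) \<and>
     (\<forall>c. \<forall>\<phi>\<in>torus_smooth. u (\<lambda>x. c * \<phi> x) = c * u \<phi>) \<and>
     (\<exists>C k. \<forall>\<phi>\<in>torus_smooth.
        cmod (u \<phi>) \<le> C * (\<Sum>bs | set bs \<subseteq> Basis \<and> length bs \<le> k. SUP x. cmod (foldr pdv bs \<phi> x))) \<and>
     (\<forall>\<phi>. \<phi> \<notin> torus_smooth \<longrightarrow> u \<phi> = 0)}"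

definition dist_of_fun :: "('a::euclidean_space \<Rightarrow> complex) \<Rightarrow> 'a functional" where
  "dist_of_fun f \<phi> = (if \<phi> \<in> torus_smooth then torus_integral (\<lambda>x. f x * \<phi> x) else 0)"

definition dist_pdv :: "'a \<Rightarrow> 'a::euclidean_space functional \<Rightarrow> 'a functional" where
  "dist_pdv v u \<phi> = (if \<phi> \<in> torus_smooth then - u (pdv v \<phi>) else 0)"

section \<open>Toroidal symbols and pseudo-differential operators\<close>

definition lat :: "int^'m \<Rightarrow> real^'m" where
  "lat \<xi> = (\<chi> k. real_of_int (\<xi> $ k))"

definition japanese_bracket :: "int^'m::finite \<Rightarrow> real" where
  "japanese_bracket \<xi> = sqrt (1 + (norm (lat \<xi>))\<^sup>2)"

definition fwd_diff :: "'m \<Rightarrow> (int^'m::finite \<Rightarrow> complex) \<Rightarrow> int^'m \<Rightarrow> complex" where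
  "fwd_diff k p \<xi> = p (\<xi> + axis k 1) - p \<xi>"

definition fwd_diffs :: "nat^'m::{finite,linorder} \<Rightarrow> (int^'m::{finite,linorder} \<Rightarrow> complex) \<Rightarrow> int^'m::{finite,linorder} \<Rightarrow> complex" where
  "fwd_diffs \<alpha> p = foldr (\<lambda>k. fwd_diff k ^^ (\<alpha> $ k)) (sorted_list_of_set UNIV) p"

definition toroidal_symbol :: "real \<Rightarrow> (int^'m::{finite,linorder} \<Rightarrow> complex) \<Rightarrow> bool" where
  "toroidal_symbol m p \<longleftrightarrow>
     (\<forall>\<alpha>. \<exists>C>0. \<forall>\<xi>. cmod (fwd_diffs \<alpha> p \<xi>) \<le> C * japanese_bracket \<xi> powr (m - real (\<Sum>k\<in>UNIV. \<alpha> $ k)))"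

definition fourier_fun ::
  "((real^'n) \<times> (real^'m::finite) \<Rightarrow> complex) \<Rightarrow> int^'m \<Rightarrow> real^'n \<Rightarrow> complex" where
  "fourier_fun f \<xi> t = torus_integral (\<lambda>x. cis (- (x \<bullet> lat \<xi>)) * f (t, x)) / of_real ((2 * pi) ^ CARD('m))"

definition fourier_dist ::
  "((real^'n::finite) \<times> (real^'m::finite)) functional \<Rightarrow> int^'m \<Rightarrow> (real^'n) functional" where
  "fourier_dist u \<xi> \<psi> =
     (if \<psi> \<in> torus_smooth
      then u (\<lambda>(t, x). cis (- (x \<bullet> lat \<xi>)) * \<psi> t) / of_real ((2 * pi) ^ CARD('m)) else 0)"

text \<open>The operator \<open>P(D\<^sub>x)\<close> on distributions: the \<open>\<xi>\<close>-th summand is the product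
  \<open>exp (i x \<xi>) p(\<xi>) u^(t,\<xi>)\<close> paired with the test function. For toroidal symbols \<open>p\<close>,
  distributions \<open>u\<close> and test functions the sum converges absolutely.\<close>

definition pseudo_diff ::
  "(int^'m \<Rightarrow> complex) \<Rightarrow> ((real^'n::finite) \<times> (real^'m::finite)) functional
     \<Rightarrow> ((real^'n) \<times> (real^'m)) functional" where
  "pseudo_diff p u \<phi> =
     (if \<phi> \<in> torus_smooth
      then \<Sum>\<^sub>\<infinity>\<xi>\<in>UNIV. p \<xi> * fourier_dist u \<xi> (\<lambda>t. torus_integral (\<lambda>x. cis (x \<bullet> lat \<xi>) * \<phi> (t, x)))
      else 0)"

section \<open>Forms in the variables t\<close>

text \<open>A form \<open>\<Sum> u\<^sub>K dt\<^sub>K\<close> of degree \<open>r\<close> is the family of its coefficients, indexed by the sets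
  \<open>K\<close> of \<open>r\<close> indices (increasing tuples) and extended by zero to the sets of other cardinalities.\<close>

definition smooth_forms :: "nat \<Rightarrow> ('n::finite set \<Rightarrow> 'a::euclidean_space \<Rightarrow> complex) set" where
  "smooth_forms r =
     {f. \<forall>K. (card K = r \<longrightarrow> f K \<in> torus_smooth) \<and> (card K \<noteq> r \<longrightarrow> f K = (\<lambda>_. 0))}"

definition dist_forms :: "nat \<Rightarrow> ('n::finite set \<Rightarrow> 'a::euclidean_space functional) set" where
  "dist_forms r =
     {u. \<forall>K. (card K = r \<longrightarrow> u K \<in> torus_distributions) \<and> (card K \<noteq> r \<longrightarrow> u K = (\<lambda>_. 0))}"

text \<open>The coefficient of \<open>dt\<^sub>J\<close> in \<open>dt\<^sub>j \<and> dt\<^sub>K\<close>.\<close>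

definition wedge_coeff :: "'n::{finite,linorder} \<Rightarrow> 'n set \<Rightarrow> 'n set \<Rightarrow> complex" where
  "wedge_coeff j K J = (if j \<notin> K \<and> J = insert j K then (- 1) ^ card {k\<in>K. k < j} else 0)"

text \<open>The coefficients of \<open>\<Sum>\<^sub>j \<Sum>\<^sub>K a\<^sub>j\<^sub>K dt\<^sub>j \<and> dt\<^sub>K\<close>, with \<open>K\<close> ranging over the sets of \<open>r\<close> indices. The
  argument \<open>z\<close> is a point if the coefficients are functions, a test function if they are
  distributions.\<close>

definition wedge_sum ::
  "nat \<Rightarrow> ('n::{finite,linorder} \<Rightarrow> 'n set \<Rightarrow> 'z \<Rightarrow> complex) \<Rightarrow> 'n set \<Rightarrow> 'z \<Rightarrow> complex" where
  "wedge_sum r a J z = (\<Sum>j\<in>UNIV. \<Sum>K | card K = r. wedge_coeff j K J * a j K z)"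

definition ext_deriv ::
  "nat \<Rightarrow> ('n::{finite,linorder} set \<Rightarrow> real^'n::{finite,linorder} \<Rightarrow> complex) \<Rightarrow> 'n set \<Rightarrow> real^'n::{finite,linorder} \<Rightarrow> complex" where
  "ext_deriv r v = wedge_sum r (\<lambda>j K. pdv (axis j 1) (v K))"

definition exact_form :: "nat \<Rightarrow> ('n::{finite,linorder} set \<Rightarrow> real^'n::{finite,linorder} \<Rightarrow> complex) \<Rightarrow> bool" where
  "exact_form r g \<longleftrightarrow> (\<exists>s v. r = Suc s \<and> v \<in> smooth_forms s \<and> g = ext_deriv s v)"

section \<open>The operator L and its solvability\<close>

definition op_L ::
  "('n::{finite,linorder} \<Rightarrow> int^'m::finite \<Rightarrow> complex) \<Rightarrow> nat
     \<Rightarrow> ('n set \<Rightarrow> ((real^'n::{finite,linorder}) \<times> (real^'m)) functional)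
     \<Rightarrow> ('n set \<Rightarrow> ((real^'n::{finite,linorder}) \<times> (real^'m)) functional)" where
  "op_L p r u J \<phi> =
     wedge_sum r (\<lambda>j K. dist_pdv (axis j 1, 0) (u K)) J \<phi>
     + wedge_sum r (\<lambda>j K \<phi>. \<i> * pseudo_diff (p j) (u K) \<phi>) J \<phi>"

text \<open>Singular 1-chains in the torus are formal integer combinations of piecewise \<open>C\<^sup>1\<close> paths.
  Each path is given by a lift to \<open>real^'n\<close>; the boundary of a chain is taken in the torus.\<close>

type_synonym 'n chain1 = "(int \<times> (real \<Rightarrow> real^'n)) list"

definition torus_eq :: "real^'n \<Rightarrow> real^'n \<Rightarrow> bool" where
  "torus_eq x y \<longleftrightarrow> (\<exists>z. x = y + (2 * pi) *\<^sub>R lat z)"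

definition cycle1 :: "'n::finite chain1 \<Rightarrow> bool" where
  "cycle1 \<sigma> \<longleftrightarrow>
     (\<forall>(k, \<gamma>)\<in>set \<sigma>. valid_path \<gamma>) \<and>
     (\<forall>y. (\<Sum>(k, \<gamma>)\<leftarrow>\<sigma>. k * (of_bool (torus_eq (\<gamma> 1) y) - of_bool (torus_eq (\<gamma> 0) y))) = 0)"

text \<open>The integral over a chain of the 1-form \<open>\<Sum> c\<^sub>j dt\<^sub>j\<close> with constant coefficients.\<close>

definition chain_integral :: "'n::finite chain1 \<Rightarrow> ('n \<Rightarrow> complex) \<Rightarrow> complex" where
  "chain_integral \<sigma> c =
     (\<Sum>(k, \<gamma>)\<leftarrow>\<sigma>. of_int k *
        integral {0..1} (\<lambda>s. \<Sum>j\<in>UNIV. c j * of_real (vector_derivative \<gamma> (at s within {0..1}) $ j)))"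

definition integral_form :: "('n::finite \<Rightarrow> complex) \<Rightarrow> bool" where
  "integral_form c \<longleftrightarrow>
     (\<forall>j. c j \<in> \<real>) \<and> (\<forall>\<sigma>. cycle1 \<sigma> \<longrightarrow> chain_integral \<sigma> c / of_real (2 * pi) \<in> \<int>)"

definition real_primitive :: "('n::finite \<Rightarrow> complex) \<Rightarrow> (real^'n \<Rightarrow> real) \<Rightarrow> bool" where
  "real_primitive c \<psi> \<longleftrightarrow> smooth \<psi> \<and>
     (\<forall>t. ((\<lambda>t. complex_of_real (\<psi> t)) has_derivative (\<lambda>h. \<Sum>j\<in>UNIV. c j * of_real (h $ j))) (at t))"

text \<open>The set \<open>E\<^sup>r\<close>. A primitive \<open>\<psi>\<close> exists and is unique up to an additive constant, which does
  not affect exactness.\<close>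

definition compatible_forms ::
  "('n::{finite,linorder} \<Rightarrow> int^'m::finite \<Rightarrow> complex) \<Rightarrow> nat
     \<Rightarrow> ('n set \<Rightarrow> (real^'n::{finite,linorder}) \<times> (real^'m) \<Rightarrow> complex) set" where
  "compatible_forms p r = {f \<in> smooth_forms (Suc r).
     op_L p (Suc r) (\<lambda>K. dist_of_fun (f K)) = (\<lambda>_ _. 0) \<and>
     (\<forall>\<xi>. integral_form (\<lambda>j. p j \<xi>) \<longrightarrow>
        (\<forall>\<psi>. real_primitive (\<lambda>j. p j \<xi>) \<psi> \<longrightarrow>
           exact_form (Suc r) (\<lambda>K t. fourier_fun (f K) \<xi> t * cis (\<psi> t))))}"

definition globally_solvable ::
  "('n::{finite,linorder} \<Rightarrow> int^'m::finite \<Rightarrow> complex) \<Rightarrow> nat \<Rightarrow> bool" where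
  "globally_solvable p r \<longleftrightarrow>
     (\<forall>f\<in>compatible_forms p r. \<exists>u\<in>dist_forms r. op_L p r u = (\<lambda>K. dist_of_fun (f K)))"

text \<open>The symbol, as the vector of its coefficients with respect to \<open>dt\<^sub>1, \<dots>, dt\<^sub>n\<close>.\<close>

definition symbol_L ::
  "('n::finite \<Rightarrow> int^'m::finite \<Rightarrow> complex) \<Rightarrow> int^'n \<Rightarrow> int^'m \<Rightarrow> complex^'n" where
  "symbol_L p \<eta> \<xi> = (\<chi> j. \<i> * (of_int (\<eta> $ j) + p j \<xi>))"

definition symbol_norm ::
  "('n::finite \<Rightarrow> int^'m::finite \<Rightarrow> complex) \<Rightarrow> int^'n \<Rightarrow> int^'m \<Rightarrow> real" where
  "symbol_norm p \<eta> \<xi> = (MAX j. cmod (of_int (\<eta> $ j) + p j \<xi>))"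

end

theory Submission
  imports Defs
begin

text \<open>On Fourier coefficients \<open>L\<^sup>r\<close> is exterior multiplication by the covector
  \<open>\<sigma> = i (\<eta> + p(\<xi>))\<close>. If \<open>\<sigma> \<noteq> 0\<close> and \<open>\<sigma> \<and> f = 0\<close>, contraction with the
  largest component \<open>\<sigma>\<^sub>i\<close> gives the solution \<open>u = \<sigma>\<^sub>i\<^sup>-\<^sup>1 \<iota>\<^sub>i f\<close>, and the Diophantine bound keeps its
  growth polynomial; where \<open>\<sigma> = 0\<close> the form \<open>c\<^sub>\<xi>\<^sub>0\<close> is integral and the compatibility condition makes the
  coefficient of \<open>f\<close> vanish. Conversely, if the bound fails, there are lattice points \<open>z\<^sub>l\<close> at which
  \<open>|\<sigma>|\<close> is positive but decays faster than any power. The coefficients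
  \<open>f = |\<sigma>|\<^sup>-\<^sup>1\<^sup>/\<^sup>2 \<sigma> \<and> dt\<^sub>K\<close>, placed at these points with \<open>K\<close> avoiding the index of the largest
  component of \<open>\<sigma>\<close>, are rapidly decreasing of size \<open>|\<sigma>|\<^sup>1\<^sup>/\<^sup>2\<close>, so every solution grows at least
  like \<open>|\<sigma>|\<^sup>-\<^sup>1\<^sup>/\<^sup>2\<close>, which no distribution does. No \<open>z\<^sub>l\<close> lies over an integral \<open>c\<^sub>\<xi>\<^sub>0\<close>, where
  \<open>|\<sigma>|\<close> is an integer, so \<open>f\<close> is compatible.\<close>

section \<open>Lattice points and coefficient growth\<close>

text \<open>For \<open>r > 0\<close> solutions are far from unique, because \<open>L^r\<close>
  annihilates every \<open>\<sigma> \<and> v\<close>; their coefficients cannot be computed from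
  \<open>f\<close>. Necessity therefore uses only the crude bound
  \<open>|\<sigma> \<and> u| \<le> n |\<sigma>| max |u|\<close>: data of size
  \<open>|\<sigma>|^(1/2)\<close> force some coefficient of size about
  \<open>|\<sigma>|^(-1/2)\<close>. The exponent 1/2 is one choice strictly between 0 and 1: the
  data must still decay while the solution already blows up. The hypothesis \<open>r < n\<close>
  leaves room for a set \<open>K\<close> of \<open>r\<close> indices that avoids the largest
  component. Smooth functions are replaced by their coefficients, which rests on uniqueness of
  Fourier coefficients for continuous periodic functions. An arbitrary distribution is never
  expanded in a series; it is only tested on characters, and polynomial growth of those values is
  all that the contradiction requires. The lattice is posed in any Euclidean space, so that one
  Fourier theory serves \<open>t\<close>, \<open>x\<close> and the pair
  \<open>(t, x)\<close>.\<close>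

definition intlat :: "'a::euclidean_space set" where
  "intlat = {z. \<forall>b\<in>Basis. z \<bullet> b \<in> \<int>}"

definition chr :: "'a::euclidean_space \<Rightarrow> 'a \<Rightarrow> complex" where
  "chr z x = cis (z \<bullet> x)"

definition polybdd :: "('a::euclidean_space \<Rightarrow> complex) \<Rightarrow> bool" where
  "polybdd a \<longleftrightarrow> (\<exists>C k. \<forall>z\<in>intlat. cmod (a z) \<le> C * (1 + norm z) ^ k)"

definition rapid :: "('a::euclidean_space \<Rightarrow> complex) \<Rightarrow> bool" where
  "rapid c \<longleftrightarrow> (\<forall>k. \<exists>C. \<forall>z\<in>intlat. cmod (c z) * (1 + norm z) ^ k \<le> C)"

lemma intlat_0 [simp]: "0 \<in> intlat"
  by (simp add: intlat_def)

lemma intlat_minus [simp]: "- z \<in> intlat \<longleftrightarrow> z \<in> intlat"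
  by (auto simp: intlat_def minus_in_Ints_iff)

lemma intlat_add: "z \<in> intlat \<Longrightarrow> w \<in> intlat \<Longrightarrow> z + w \<in> intlat"
  by (auto simp: intlat_def inner_add_left)

lemma intlat_norm_ge_1:
  assumes "z \<in> intlat" "z \<noteq> 0"
  shows "norm z \<ge> 1"
proof -
  obtain b where b: "b \<in> Basis" "z \<bullet> b \<noteq> 0"
    using assms(2) euclidean_all_zero_iff by blast
  have "z \<bullet> b \<in> \<int>"
    using assms b by (simp add: intlat_def)
  then have "\<bar>z \<bullet> b\<bar> \<ge> 1"
    using b Ints_nonzero_abs_ge1 by blast
  with Basis_le_norm[OF b(1), of z] show ?thesis by linarith
qed

lemma summable_on_Ints_inverse_sq: "(\<lambda>t::real. 1 / (1 + t\<^sup>2)) summable_on \<int>"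
proof -
  have "summable (\<lambda>n::nat. inverse (real n ^ 2))"
    by (rule inverse_power_summable) simp
  then have "summable (\<lambda>n::nat. norm (1 / (1 + (real n)\<^sup>2)))"
    by (rule summable_comparison_test'[where N=1]) (auto intro!: le_imp_inverse_le simp: divide_inverse)
  then have nat: "(\<lambda>n::nat. 1 / (1 + (real n)\<^sup>2)) summable_on UNIV"
    by (rule norm_summable_imp_summable_on)
  have "(\<lambda>t::real. 1 / (1 + t\<^sup>2)) summable_on range real"
    by (subst summable_on_reindex) (auto simp: o_def nat inj_on_def)
  moreover have "(\<lambda>t::real. 1 / (1 + t\<^sup>2)) summable_on range (\<lambda>n. - real n)"
    by (subst summable_on_reindex) (auto simp: o_def nat inj_on_def)
  moreover have "\<int> = range real \<union> range (\<lambda>n. - real n)"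
  proof (intro equalityI subsetI)
    fix x :: real assume "x \<in> \<int>"
    then obtain k where "x = of_int k" by (auto elim: Ints_cases)
    then show "x \<in> range real \<union> range (\<lambda>n. - real n)"
      by (cases k rule: int_cases2) auto
  qed auto
  ultimately show ?thesis
    by (metis summable_on_union)
qed

text \<open>The weight is dominated by the product over the coordinates of
  \<open>1 / (1 + (z \<bullet> b)\<^sup>2)\<close>, whose sum factors into one-dimensional sums.
  Each factor costs two powers of \<open>1 + norm z\<close>, hence the exponent
  \<open>2 * DIM('a)\<close>.\<close>

lemma lattice_summable:
  "(\<lambda>z::'a::euclidean_space. 1 / (1 + norm z) ^ (2 * DIM('a))) summable_on intlat"
proof -
  let ?g = "\<lambda>t::real. 1 / (1 + t\<^sup>2)"
  let ?r = "\<lambda>z::'a. restrict (\<lambda>b. z \<bullet> b) Basis"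
  have "(\<lambda>t. norm (?g t)) summable_on \<int>"
    using summable_on_Ints_inverse_sq by simp
  then have "Infinite_Set_Sum.abs_summable_on ?g \<int>"
    by (rule abs_summable_equivalent[THEN iffD1])
  then have "Infinite_Set_Sum.abs_summable_on (\<lambda>g. \<Prod>b\<in>(Basis::'a set). ?g (g b)) (PiE Basis (\<lambda>_. \<int>))"
    by (intro abs_summable_on_prod_PiE) (auto simp: Ints_def)
  then have "(\<lambda>g. norm (\<Prod>b\<in>(Basis::'a set). ?g (g b))) summable_on PiE Basis (\<lambda>_. \<int>)"
    by (rule abs_summable_equivalent[THEN iffD2])
  moreover have "?r ` intlat \<subseteq> PiE Basis (\<lambda>_. \<int>)"
    by (auto simp: intlat_def)
  ultimately have "(\<lambda>g. norm (\<Prod>b\<in>(Basis::'a set). ?g (g b))) summable_on ?r ` intlat"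
    by (rule summable_on_subset)
  moreover have "inj_on ?r intlat"
  proof (rule inj_onI)
    fix z w :: 'a assume eq: "?r z = ?r w"
    have "z \<bullet> b = w \<bullet> b" if "b \<in> Basis" for b
      using fun_cong[OF eq, of b] that by simp
    then show "z = w" by (rule euclidean_eqI)
  qed
  ultimately have s: "(\<lambda>z::'a. norm (\<Prod>b\<in>(Basis::'a set). ?g (z \<bullet> b))) summable_on intlat"
    by (subst (asm) summable_on_reindex) (auto simp: o_def)
  show ?thesis
  proof (rule summable_on_comparison_test[OF s])
    fix z :: 'a
    have "(\<Prod>b\<in>(Basis::'a set). 1 + (z \<bullet> b)\<^sup>2) \<le> (\<Prod>b\<in>(Basis::'a set). (1 + norm z)\<^sup>2)"
    proof (rule prod_mono)
      fix b :: 'a assume "b \<in> Basis"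
      then have "\<bar>z \<bullet> b\<bar> \<le> norm z" by (rule Basis_le_norm)
      then have "(z \<bullet> b)\<^sup>2 \<le> (norm z)\<^sup>2" by (metis abs_norm_cancel abs_le_square_iff)
      then have "1 + (z \<bullet> b)\<^sup>2 \<le> (1 + norm z)\<^sup>2" using norm_ge_zero[of z] unfolding power2_sum one_power2 mult_1_right by linarith
      then show "0 \<le> 1 + (z \<bullet> b)\<^sup>2 \<and> 1 + (z \<bullet> b)\<^sup>2 \<le> (1 + norm z)\<^sup>2" by simp
    qed
    also have "\<dots> = (1 + norm z) ^ (2 * DIM('a))"
      by (simp add: power_mult)
    finally have "(\<Prod>b\<in>(Basis::'a set). 1 + (z \<bullet> b)\<^sup>2) \<le> (1 + norm z) ^ (2 * DIM('a))" .
    moreover have "(\<Prod>b\<in>(Basis::'a set). 1 + (z \<bullet> b)\<^sup>2) > 0"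
      by (intro prod_pos) (auto simp: add_pos_nonneg)
    ultimately have "1 / (1 + norm z) ^ (2 * DIM('a)) \<le> 1 / (\<Prod>b\<in>(Basis::'a set). 1 + (z \<bullet> b)\<^sup>2)"
      by (intro frac_le) auto
    also have "\<dots> = (\<Prod>b\<in>(Basis::'a set). ?g (z \<bullet> b))"
      by (simp only: prod_dividef prod.neutral_const)
    finally show "1 / (1 + norm z) ^ (2 * DIM('a)) \<le> norm (\<Prod>b\<in>(Basis::'a set). ?g (z \<bullet> b))"
      by (simp only: real_norm_def)
  qed auto
qed

section \<open>Calculus of polynomially bounded and rapidly decreasing families\<close>

lemma rapid_bound:
  assumes "rapid c"
  obtains C where "C \<ge> 0" "\<And>z. z \<in> intlat \<Longrightarrow> cmod (c z) * (1 + norm z) ^ k \<le> C"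
proof -
  obtain C where "\<forall>z\<in>intlat. cmod (c z) * (1 + norm z) ^ k \<le> C"
    using assms unfolding rapid_def by blast
  then have "0 \<le> max 0 C" "\<And>z. z \<in> intlat \<Longrightarrow> cmod (c z) * (1 + norm z) ^ k \<le> max 0 C"
    by (auto intro: order_trans)
  with that show thesis by blast
qed

lemma rapid_summable:
  fixes c :: "'a::euclidean_space \<Rightarrow> complex"
  assumes "rapid c"
  shows "(\<lambda>z. cmod (c z)) summable_on intlat"
proof -
  obtain C where C: "C \<ge> 0" "\<And>z. z \<in> intlat \<Longrightarrow> cmod (c z) * (1 + norm z) ^ (2 * DIM('a)) \<le> C"
    using rapid_bound[OF assms] by metis
  have "(\<lambda>z::'a. C * (1 / (1 + norm z) ^ (2 * DIM('a)))) summable_on intlat"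
    by (intro summable_on_cmult_right lattice_summable)
  then show ?thesis
  proof (rule summable_on_comparison_test)
    fix z :: 'a assume "z \<in> intlat"
    then have "cmod (c z) * (1 + norm z) ^ (2 * DIM('a)) \<le> C" by (rule C)
    moreover have "(1 + norm z) ^ (2 * DIM('a)) > 0" by (simp add: add_pos_nonneg)
    ultimately show "cmod (c z) \<le> C * (1 / (1 + norm z) ^ (2 * DIM('a)))"
      by (simp add: field_simps)
  qed auto
qed

lemma polybdd_bound:
  assumes "polybdd a"
  obtains C k where "C \<ge> 0" "\<And>z. z \<in> intlat \<Longrightarrow> cmod (a z) \<le> C * (1 + norm z) ^ k"
proof -
  obtain C k where C: "\<forall>z\<in>intlat. cmod (a z) \<le> C * (1 + norm z) ^ k"
    using assms unfolding polybdd_def by blast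
  have "cmod (a z) \<le> max 0 C * (1 + norm z) ^ k" if "z \<in> intlat" for z
  proof -
    have "cmod (a z) \<le> C * (1 + norm z) ^ k" using C that by blast
    also have "\<dots> \<le> max 0 C * (1 + norm z) ^ k" by (intro mult_right_mono) auto
    finally show ?thesis .
  qed
  with that[of "max 0 C" k] show thesis by auto
qed

lemma polybdd_mult_rapid:
  assumes "polybdd a" "rapid c"
  shows "rapid (\<lambda>z. a z * c z)"
  unfolding rapid_def
proof
  fix k
  obtain A l where A: "A \<ge> 0" "\<And>z. z \<in> intlat \<Longrightarrow> cmod (a z) \<le> A * (1 + norm z) ^ l"
    using polybdd_bound[OF assms(1)] by blast
  obtain C where C: "C \<ge> 0" "\<And>z. z \<in> intlat \<Longrightarrow> cmod (c z) * (1 + norm z) ^ (l + k) \<le> C"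
    using rapid_bound[OF assms(2)] by metis
  have "cmod (a z * c z) * (1 + norm z) ^ k \<le> A * C" if z: "z \<in> intlat" for z
  proof -
    have "cmod (a z * c z) * (1 + norm z) ^ k \<le> (A * (1 + norm z) ^ l) * cmod (c z) * (1 + norm z) ^ k"
      unfolding norm_mult by (intro mult_right_mono A z) auto
    also have "\<dots> = A * (cmod (c z) * (1 + norm z) ^ (l + k))"
      by (simp add: power_add)
    also have "\<dots> \<le> A * C" by (intro mult_left_mono C z A)
    finally show ?thesis .
  qed
  then show "\<exists>C. \<forall>z\<in>intlat. cmod (a z * c z) * (1 + norm z) ^ k \<le> C" by blast
qed

lemma polybdd_mult:
  assumes "polybdd a" "polybdd b"
  shows "polybdd (\<lambda>z. a z * b z)"
proof -
  obtain A k where A: "A \<ge> 0" "\<And>z. z \<in> intlat \<Longrightarrow> cmod (a z) \<le> A * (1 + norm z) ^ k"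
    using polybdd_bound[OF assms(1)] by blast
  obtain B l where B: "B \<ge> 0" "\<And>z. z \<in> intlat \<Longrightarrow> cmod (b z) \<le> B * (1 + norm z) ^ l"
    using polybdd_bound[OF assms(2)] by blast
  have "cmod (a z * b z) \<le> (A * B) * (1 + norm z) ^ (k + l)" if z: "z \<in> intlat" for z
  proof -
    have "cmod (a z * b z) \<le> (A * (1 + norm z) ^ k) * (B * (1 + norm z) ^ l)"
      unfolding norm_mult using A B z by (intro mult_mono) auto
    then show ?thesis by (simp add: power_add mult_ac)
  qed
  then show ?thesis unfolding polybdd_def by blast
qed

lemma polybdd_add:
  assumes "polybdd a" "polybdd b"
  shows "polybdd (\<lambda>z. a z + b z)"
proof -
  obtain A k where A: "A \<ge> 0" "\<And>z. z \<in> intlat \<Longrightarrow> cmod (a z) \<le> A * (1 + norm z) ^ k"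
    using polybdd_bound[OF assms(1)] by blast
  obtain B l where B: "B \<ge> 0" "\<And>z. z \<in> intlat \<Longrightarrow> cmod (b z) \<le> B * (1 + norm z) ^ l"
    using polybdd_bound[OF assms(2)] by blast
  have "cmod (a z + b z) \<le> (A + B) * (1 + norm z) ^ (k + l)" if z: "z \<in> intlat" for z
  proof -
    have "cmod (a z + b z) \<le> A * (1 + norm z) ^ k + B * (1 + norm z) ^ l"
      using A(2)[OF z] B(2)[OF z] norm_triangle_ineq[of "a z" "b z"] by linarith
    also have "\<dots> \<le> A * (1 + norm z) ^ (k + l) + B * (1 + norm z) ^ (k + l)"
      using A B by (intro add_mono mult_left_mono power_increasing) auto
    finally show ?thesis by (simp add: distrib_right)
  qed
  then show ?thesis unfolding polybdd_def by blast
qed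

lemma polybdd_const [simp]: "polybdd (\<lambda>_. c)"
  unfolding polybdd_def by (intro exI[of _ "cmod c"] exI[of _ 0]) auto

lemma polybdd_sum:
  "(\<And>i. i \<in> I \<Longrightarrow> polybdd (a i)) \<Longrightarrow> polybdd (\<lambda>z. \<Sum>i\<in>I. a i z)"
  by (induction I rule: infinite_finite_induct) (auto intro: polybdd_add)

lemma polybdd_inner: "polybdd (\<lambda>z. of_real (z \<bullet> v))"
  unfolding polybdd_def
proof (intro exI ballI)
  fix z :: 'a assume "z \<in> intlat"
  have "\<bar>z \<bullet> v\<bar> \<le> norm z * norm v" by (rule Cauchy_Schwarz_ineq2)
  also have "\<dots> \<le> norm v * (1 + norm z)" by (simp add: algebra_simps)
  finally show "cmod (of_real (z \<bullet> v)) \<le> norm v * (1 + norm z) ^ 1" by simp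
qed

lemma polybdd_mono:
  assumes "polybdd a" "\<And>z. z \<in> intlat \<Longrightarrow> cmod (b z) \<le> cmod (a z)"
  shows "polybdd b"
  using assms unfolding polybdd_def by (meson order_trans)

lemma rapid_mono:
  assumes "rapid a" "\<And>z. z \<in> intlat \<Longrightarrow> cmod (b z) \<le> cmod (a z)"
  shows "rapid b"
  unfolding rapid_def
proof
  fix k
  obtain C where "C \<ge> 0" "\<And>z. z \<in> intlat \<Longrightarrow> cmod (a z) * (1 + norm z) ^ k \<le> C"
    using rapid_bound[OF assms(1)] by metis
  then show "\<exists>C. \<forall>z\<in>intlat. cmod (b z) * (1 + norm z) ^ k \<le> C"
    by (intro exI[of _ C]) (meson assms(2) mult_right_mono norm_ge_zero order_trans zero_le_power
        add_nonneg_nonneg zero_le_one)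
qed

lemma rapid_polybdd: "rapid c \<Longrightarrow> polybdd c"
  unfolding rapid_def polybdd_def by (metis mult.right_neutral power_0)

lemma rapid_0 [simp]: "rapid (\<lambda>_. 0)"
  by (auto simp: rapid_def)

lemma rapid_cmult: "rapid c \<Longrightarrow> rapid (\<lambda>z. k * c z)"
  using polybdd_mult_rapid[of "\<lambda>_. k" c] by simp

lemma rapid_minus:
  assumes "rapid c"
  shows "rapid (\<lambda>z. c (- z))"
  using assms unfolding rapid_def by (metis intlat_minus norm_minus_cancel)

section \<open>Periodic functions and characters\<close>

lemma pdv_eqI: "(f has_derivative f') (at x) \<Longrightarrow> pdv v f x = f' v"
  by (simp add: pdv_def frechet_derivative_at[symmetric])

lemma smooth_differentiable: "smooth f \<Longrightarrow> f differentiable (at x)"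
  unfolding smooth_def by (drule spec[of _ "[]"]) simp

lemma smooth_has_derivative: "smooth f \<Longrightarrow> (f has_derivative (\<lambda>h. pdv h f x)) (at x)"
  unfolding pdv_def by (metis smooth_differentiable frechet_derivative_works)

lemma smooth_pdv:
  assumes "smooth f" "b \<in> Basis"
  shows "smooth (pdv b f)"
  unfolding smooth_def
proof (intro allI impI)
  fix bs :: "'a list" and x assume "set bs \<subseteq> Basis"
  then have "set (bs @ [b]) \<subseteq> Basis" using assms(2) by simp
  then have "foldr pdv (bs @ [b]) f differentiable (at x)"
    using assms(1) unfolding smooth_def by blast
  then show "foldr pdv bs (pdv b f) differentiable (at x)" by simp
qed

lemma smooth_continuous: "smooth f \<Longrightarrow> continuous_on S f"
  by (meson continuous_at_imp_continuous_on differentiable_imp_continuous_within smooth_differentiable)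

lemma torus_periodic_int:
  assumes "torus_periodic f" "b \<in> Basis"
  shows "f (x + (2 * pi * of_int k) *\<^sub>R b) = f x"
proof -
  have nat: "f (x + (2 * pi * real n) *\<^sub>R b) = f x" for n x
  proof (induction n arbitrary: x)
    case (Suc n)
    have "f (x + (2 * pi * real (Suc n)) *\<^sub>R b) = f ((x + (2 * pi * real n) *\<^sub>R b) + (2 * pi) *\<^sub>R b)"
      by (simp add: algebra_simps)
    also have "\<dots> = f x"
      using assms Suc.IH[of x] unfolding torus_periodic_def by simp
    finally show ?case .
  qed simp
  show ?thesis
  proof (cases k rule: int_cases2)
    case (nonneg n) then show ?thesis using nat[of x n] by simp
  next
    case (nonpos n)
    then show ?thesis using nat[of "x - (2 * pi * real n) *\<^sub>R b" n] by simp
  qed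
qed

lemma torus_periodic_intlat:
  fixes f :: "'a::euclidean_space \<Rightarrow> 'b"
  assumes "torus_periodic f" "z \<in> intlat"
  shows "f (x + (2 * pi) *\<^sub>R z) = f x"
proof -
  have "f (x + (2 * pi) *\<^sub>R (\<Sum>b\<in>B. (z \<bullet> b) *\<^sub>R b)) = f x" if "finite B" "B \<subseteq> Basis" for B
    using that
  proof (induction B)
    case (insert b B)
    then have "z \<bullet> b \<in> \<int>" using assms(2) by (simp add: intlat_def)
    then obtain k where k: "z \<bullet> b = of_int k" by (auto elim: Ints_cases)
    have "f (x + (2 * pi) *\<^sub>R (\<Sum>b\<in>insert b B. (z \<bullet> b) *\<^sub>R b))
        = f ((x + (2 * pi) *\<^sub>R (\<Sum>b\<in>B. (z \<bullet> b) *\<^sub>R b)) + (2 * pi * of_int k) *\<^sub>R b)"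
      using insert k by (simp add: algebra_simps)
    also have "\<dots> = f x"
      using insert torus_periodic_int[OF assms(1)] by simp
    finally show ?case .
  qed simp
  from this[of Basis] show ?thesis by (simp add: euclidean_representation)
qed

lemma torus_cell:
  fixes x :: "'a::euclidean_space"
  obtains y z where "y \<in> cbox 0 ((2 * pi) *\<^sub>R One)" "z \<in> intlat" "x = y + (2 * pi) *\<^sub>R z"
proof -
  define z :: 'a where "z = (\<Sum>b\<in>Basis. of_int \<lfloor>(x \<bullet> b) / (2 * pi)\<rfloor> *\<^sub>R b)"
  have zb: "z \<bullet> b = of_int \<lfloor>(x \<bullet> b) / (2 * pi)\<rfloor>" if "b \<in> Basis" for b
    using that by (simp add: z_def)
  have "x - (2 * pi) *\<^sub>R z \<in> cbox 0 ((2 * pi) *\<^sub>R One)"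
    unfolding mem_box
  proof
    fix b :: 'a assume b: "b \<in> Basis"
    let ?t = "(x \<bullet> b) / (2 * pi)"
    have "of_int \<lfloor>?t\<rfloor> \<le> ?t" "?t \<le> of_int \<lfloor>?t\<rfloor> + 1" by linarith+
    then have "2 * pi * of_int \<lfloor>?t\<rfloor> \<le> 2 * pi * ?t" "2 * pi * ?t \<le> 2 * pi * (of_int \<lfloor>?t\<rfloor> + 1)"
      by (intro mult_left_mono; simp)+
    moreover have "2 * pi * ?t = x \<bullet> b" by simp
    ultimately show "0 \<bullet> b \<le> (x - (2 * pi) *\<^sub>R z) \<bullet> b \<and> (x - (2 * pi) *\<^sub>R z) \<bullet> b \<le> ((2 * pi) *\<^sub>R One) \<bullet> b"
      using b by (simp add: inner_diff_left zb algebra_simps)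
  qed
  moreover have "z \<in> intlat" by (simp add: intlat_def zb)
  ultimately show thesis using that[of "x - (2 * pi) *\<^sub>R z" z] by simp
qed

lemma torus_bounded:
  fixes f :: "'a::euclidean_space \<Rightarrow> 'b::real_normed_vector"
  assumes "torus_periodic f" "continuous_on UNIV f"
  obtains B where "B \<ge> 0" "\<And>x. norm (f x) \<le> B"
proof -
  let ?Q = "cbox 0 ((2 * pi) *\<^sub>R One) :: 'a set"
  have "compact (f ` ?Q)"
    by (intro compact_continuous_image continuous_on_subset[OF assms(2)]) auto
  then have "bounded (f ` ?Q)" by (rule compact_imp_bounded)
  then obtain B where B: "\<And>y. y \<in> ?Q \<Longrightarrow> norm (f y) \<le> B"
    unfolding bounded_iff by (metis imageI)
  have "norm (f x) \<le> B" for x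
  proof -
    obtain y z where "y \<in> ?Q" "z \<in> intlat" "x = y + (2 * pi) *\<^sub>R z" by (rule torus_cell)
    then show ?thesis using B[of y] torus_periodic_intlat[OF assms(1), of z y] by simp
  qed
  moreover from this[of 0] have "B \<ge> 0" by (rule order_trans[OF norm_ge_zero])
  ultimately show thesis using that by blast
qed

lemma torus_periodic_pdv:
  assumes "torus_periodic f" "\<And>x. f differentiable (at x)"
  shows "torus_periodic (pdv v f)"
  unfolding torus_periodic_def
proof (intro ballI allI)
  fix b x :: 'a assume b: "b \<in> Basis"
  let ?c = "(2 * pi) *\<^sub>R b"
  have "(f has_derivative (\<lambda>h. pdv h f (x + ?c))) (at (x + ?c))"
    unfolding pdv_def using assms(2) frechet_derivative_works by blast
  then have "((\<lambda>y. f (y + ?c)) has_derivative (\<lambda>h. pdv h f (x + ?c))) (at x)"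
    by (rule has_derivative_compose[rotated]) (auto intro!: derivative_eq_intros)
  moreover have "(\<lambda>y. f (y + ?c)) = f"
    using assms(1) b by (auto simp: torus_periodic_def)
  ultimately show "pdv v f (x + ?c) = pdv v f x"
    by (simp add: pdv_eqI)
qed

lemma torus_smoothD:
  assumes "f \<in> torus_smooth"
  shows "smooth f" "torus_periodic f" "continuous_on S f"
  using assms smooth_continuous by (auto simp: torus_smooth_def)

lemma torus_smooth_pdv:
  "f \<in> torus_smooth \<Longrightarrow> b \<in> Basis \<Longrightarrow> pdv b f \<in> torus_smooth"
  using smooth_pdv torus_periodic_pdv smooth_differentiable unfolding torus_smooth_def by blast

lemma torus_smooth_foldr_pdv:
  "f \<in> torus_smooth \<Longrightarrow> set bs \<subseteq> Basis \<Longrightarrow> foldr pdv bs f \<in> torus_smooth"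
  by (induction bs) (auto intro: torus_smooth_pdv)

section \<open>Integration over the torus\<close>

lemma content_torus: "measure lborel (cbox 0 ((2 * pi) *\<^sub>R One) :: 'a::euclidean_space set) = (2 * pi) ^ DIM('a)"
  by (subst content_cbox) auto

lemma torus_integral_const: "torus_integral (\<lambda>_::'a::euclidean_space. c) = of_real ((2 * pi) ^ DIM('a)) * c"
  unfolding torus_integral_def integral_const content_torus by (simp add: scaleR_conv_of_real)

lemma torus_integral_bound:
  fixes f :: "'a::euclidean_space \<Rightarrow> complex"
  assumes "continuous_on UNIV f" "B \<ge> 0" "\<And>x. cmod (f x) \<le> B"
  shows "cmod (torus_integral f) \<le> B * (2 * pi) ^ DIM('a)"
proof -
  have "(f has_integral torus_integral f) (cbox 0 ((2 * pi) *\<^sub>R One))"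
    unfolding torus_integral_def
    by (intro integrable_integral integrable_continuous continuous_on_subset[OF assms(1)]) auto
  from has_integral_bound[OF assms(2) this] assms(3) show ?thesis
    by (simp add: content_torus)
qed

lemma torus_integral_cmult: "torus_integral (\<lambda>x. c * f x) = c * torus_integral f"
  by (simp add: torus_integral_def)

lemma torus_integrable:
  fixes f :: "'a::euclidean_space \<Rightarrow> complex"
  shows "continuous_on UNIV f \<Longrightarrow> f integrable_on (cbox 0 ((2 * pi) *\<^sub>R One))"
  by (rule integrable_continuous[OF continuous_on_subset[OF _ subset_UNIV]])

lemma torus_integral_add:
  assumes "continuous_on UNIV f" "continuous_on UNIV g"
  shows "torus_integral (\<lambda>x. f x + g x) = torus_integral f + torus_integral g"
  unfolding torus_integral_def
  by (intro Henstock_Kurzweil_Integration.integral_add torus_integrable assms)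

text \<open>The translated box is cut at \<open>2 * pi\<close> in direction \<open>b\<close>; the
  slab that sticks out is moved back by one period and fills the gap left at the other end.\<close>

lemma torus_integral_shift:
  fixes f :: "'a::euclidean_space \<Rightarrow> complex"
  assumes cont: "continuous_on UNIV f" and per: "torus_periodic f"
    and b: "b \<in> Basis" and s: "0 \<le> s" "s \<le> 2 * pi"
  shows "torus_integral (\<lambda>x. f (x + s *\<^sub>R b)) = torus_integral f"
proof -
  \<comment> \<open>The box whose \<open>b\<close>-coordinate runs over
    \<open>[\<alpha>, \<beta>]\<close> and whose other coordinates run over
    \<open>[0, 2 * pi]\<close>.\<close>
  define R :: "real \<Rightarrow> real \<Rightarrow> 'a set" where
    "R = (\<lambda>\<alpha> \<beta>. cbox (\<alpha> *\<^sub>R b) ((2 * pi) *\<^sub>R One + (\<beta> - 2 * pi) *\<^sub>R b))"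
  have R: "x \<in> R \<alpha> \<beta> \<longleftrightarrow> \<alpha> \<le> x \<bullet> b \<and> x \<bullet> b \<le> \<beta> \<and> (\<forall>i\<in>Basis - {b}. 0 \<le> x \<bullet> i \<and> x \<bullet> i \<le> 2 * pi)"
    for x \<alpha> \<beta>
  proof -
    have "x \<in> R \<alpha> \<beta> \<longleftrightarrow> (\<forall>i\<in>insert b (Basis - {b}). (\<alpha> *\<^sub>R b) \<bullet> i \<le> x \<bullet> i \<and>
        x \<bullet> i \<le> ((2 * pi) *\<^sub>R One + (\<beta> - 2 * pi) *\<^sub>R b) \<bullet> i)"
      using b unfolding R_def mem_box by (simp add: insert_absorb)
    also have "\<dots> \<longleftrightarrow> \<alpha> \<le> x \<bullet> b \<and> x \<bullet> b \<le> \<beta> \<and> (\<forall>i\<in>Basis - {b}. 0 \<le> x \<bullet> i \<and> x \<bullet> i \<le> 2 * pi)"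
      using b by (auto simp: inner_add_left inner_Basis)
    finally show ?thesis .
  qed
  have int: "f integrable_on R \<alpha> \<beta>" for \<alpha> \<beta>
    unfolding R_def by (intro integrable_continuous continuous_on_subset[OF cont]) auto
  have split: "integral (R \<alpha> \<gamma>) f = integral (R \<alpha> \<beta>) f + integral (R \<beta> \<gamma>) f"
    if "\<alpha> \<le> \<beta>" "\<beta> \<le> \<gamma>" for \<alpha> \<beta> \<gamma>
  proof -
    have "R \<alpha> \<gamma> \<inter> {x. x \<bullet> b \<le> \<beta>} = R \<alpha> \<beta>" "R \<alpha> \<gamma> \<inter> {x. x \<bullet> b \<ge> \<beta>} = R \<beta> \<gamma>"
      using that by (auto simp: R)
    then show ?thesis
      using integral_split[OF int[of \<alpha> \<gamma>, unfolded R_def] b, of \<beta>] by (simp add: R_def)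
  qed
  have shift: "integral (R \<alpha> \<beta>) (f \<circ> (+) (c *\<^sub>R b)) = integral (R (\<alpha> + c) (\<beta> + c)) f" for \<alpha> \<beta> c
    unfolding R_def integral_shift_cbox_plus by (simp add: algebra_simps)
  have Q: "cbox 0 ((2 * pi) *\<^sub>R One) = R 0 (2 * pi)" by (simp add: R_def)
  have "torus_integral (\<lambda>x. f (x + s *\<^sub>R b)) = integral (R 0 (2 * pi)) (f \<circ> (+) (s *\<^sub>R b))"
    unfolding torus_integral_def Q by (simp add: o_def add.commute)
  also have "\<dots> = integral (R s (2 * pi + s)) f"
    unfolding shift by simp
  also have "\<dots> = integral (R s (2 * pi)) f + integral (R (2 * pi) (2 * pi + s)) f"
    using s by (intro split) auto
  also have "integral (R (2 * pi) (2 * pi + s)) f = integral (R 0 s) (f \<circ> (+) ((2 * pi) *\<^sub>R b))"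
    unfolding shift by (simp add: add.commute)
  also have "f \<circ> (+) ((2 * pi) *\<^sub>R b) = f"
    using per b by (auto simp: torus_periodic_def add.commute)
  also have "integral (R s (2 * pi)) f + integral (R 0 s) f = integral (R 0 (2 * pi)) f"
    using split[of 0 s "2 * pi"] s by simp
  finally show ?thesis unfolding torus_integral_def Q .
qed

text \<open>The integral of the translate by \<open>s *\<^sub>R b\<close> does not depend on
  \<open>s\<close>. Differentiating it under the integral sign at \<open>s = 0\<close> gives the
  integral of the partial derivative, so no boundary terms have to be computed.\<close>

lemma torus_integral_pdv:
  fixes g :: "'a::euclidean_space \<Rightarrow> complex"
  assumes diff: "\<And>x. g differentiable (at x)" and per: "torus_periodic g"
    and b: "b \<in> Basis" and cont: "continuous_on UNIV (pdv b g)"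
  shows "torus_integral (pdv b g) = 0"
proof -
  let ?Q = "cbox 0 ((2 * pi) *\<^sub>R One) :: 'a set"
  let ?F = "\<lambda>s. integral ?Q (\<lambda>x. g (x + s *\<^sub>R b))"
  have contg: "continuous_on UNIV g"
    by (meson continuous_at_imp_continuous_on differentiable_imp_continuous_within diff)
  have "(?F has_vector_derivative integral ?Q (\<lambda>x. pdv b g (x + 0 *\<^sub>R b))) (at 0 within {0..2 * pi})"
  proof (rule leibniz_rule_vector_derivative)
    fix s and x :: 'a
    have "(g has_derivative (\<lambda>h. pdv h g (x + s *\<^sub>R b))) (at (x + s *\<^sub>R b))"
      unfolding pdv_def using diff frechet_derivative_works by blast
    then have "((\<lambda>s. g (x + s *\<^sub>R b)) has_derivative (\<lambda>h. pdv (h *\<^sub>R b) g (x + s *\<^sub>R b))) (at s)"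
      by (rule has_derivative_compose[rotated]) (auto intro!: derivative_eq_intros)
    moreover have "linear (\<lambda>h. pdv h g (x + s *\<^sub>R b))"
      unfolding pdv_def using diff linear_frechet_derivative by blast
    then have "pdv (h *\<^sub>R b) g (x + s *\<^sub>R b) = h *\<^sub>R pdv b g (x + s *\<^sub>R b)" for h
      by (rule linear_scale)
    ultimately have "((\<lambda>s. g (x + s *\<^sub>R b)) has_vector_derivative pdv b g (x + s *\<^sub>R b)) (at s)"
      by (simp add: has_vector_derivative_def)
    then show "((\<lambda>s. g (x + s *\<^sub>R b)) has_vector_derivative pdv b g (x + s *\<^sub>R b)) (at s within {0..2 * pi})"
      by (rule has_vector_derivative_at_within)
  next
    show "(\<lambda>x. g (x + s *\<^sub>R b)) integrable_on ?Q" for s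
      by (intro integrable_continuous continuous_on_compose2[OF contg] continuous_intros) auto
    show "continuous_on ({0..2 * pi} \<times> ?Q) (\<lambda>(s, x). pdv b g (x + s *\<^sub>R b))"
      unfolding split_beta by (intro continuous_on_compose2[OF cont] continuous_intros) auto
  qed auto
  moreover have "(?F has_vector_derivative 0) (at 0 within {0..2 * pi})"
  proof (rule has_vector_derivative_transform[OF _ _ has_vector_derivative_const])
    show "?F s = torus_integral g" if "s \<in> {0..2 * pi}" for s
      using torus_integral_shift[OF contg per b] that by (simp add: torus_integral_def)
  qed simp
  ultimately have "integral ?Q (\<lambda>x. pdv b g (x + 0 *\<^sub>R b)) = 0"
    using vector_derivative_unique_within_closed_interval[of 0 "2 * pi" 0 ?F] by simp
  then show ?thesis by (simp add: torus_integral_def)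
qed

section \<open>Characters and their orthogonality\<close>

lemma norm_chr [simp]: "cmod (chr z x) = 1"
  by (simp add: chr_def)

lemma chr_0 [simp]: "chr 0 x = 1"
  by (simp add: chr_def)

lemma chr_add: "chr (z + w) x = chr z x * chr w x"
  by (simp add: chr_def cis_mult inner_add_left)

lemma chr_add_arg: "chr z (x + y) = chr z x * chr z y"
  by (simp add: chr_def cis_mult inner_add_right)

lemma chr_has_derivative:
  "(chr z has_derivative (\<lambda>h. \<i> * of_real (z \<bullet> h) * chr z x)) (at x)"
proof -
  have "((\<lambda>x. exp (\<i> * of_real (z \<bullet> x))) has_derivative
      (\<lambda>h. exp (\<i> * of_real (z \<bullet> x)) * (\<i> * of_real (z \<bullet> h)))) (at x)"
    by (rule has_derivative_compose[OF _ DERIV_exp[unfolded has_field_derivative_def]])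
      (intro has_derivative_mult_right bounded_linear_of_real[THEN bounded_linear.has_derivative]
        has_derivative_inner_right has_derivative_ident)
  moreover have "chr z = (\<lambda>x. exp (\<i> * of_real (z \<bullet> x)))"
    by (simp add: chr_def cis_conv_exp fun_eq_iff)
  ultimately show ?thesis by (simp add: mult_ac)
qed

lemma chr_differentiable: "chr z differentiable (at x)"
  using chr_has_derivative differentiable_def by blast

lemma chr_continuous [continuous_intros]: "continuous_on S (chr z)"
  by (meson continuous_at_imp_continuous_on differentiable_imp_continuous_within chr_differentiable)

lemma pdv_chr: "pdv v (chr z) = (\<lambda>x. \<i> * of_real (z \<bullet> v) * chr z x)"
  using pdv_eqI[OF chr_has_derivative] by blast

lemma chr_periodic:
  assumes "z \<in> intlat"
  shows "torus_periodic (chr z)"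
  unfolding torus_periodic_def
proof (intro ballI allI)
  fix b x :: 'a assume "b \<in> Basis"
  then have "z \<bullet> b \<in> \<int>" using assms by (simp add: intlat_def)
  then have "cis (2 * pi * (z \<bullet> b)) = 1" by (rule cis_multiple_2pi)
  then have "chr z ((2 * pi) *\<^sub>R b) = 1" by (simp add: chr_def)
  then show "chr z (x + (2 * pi) *\<^sub>R b) = chr z x" by (simp add: chr_add_arg)
qed

text \<open>The pairing is bilinear, without conjugation, to match the action of distributions on
  test functions. This is the source of the reflections \<open>- z\<close> in the formulas that
  follow.\<close>

definition tcoef :: "('a::euclidean_space \<Rightarrow> complex) \<Rightarrow> 'a \<Rightarrow> complex" where
  "tcoef f z = torus_integral (\<lambda>x. chr z x * f x)"

text \<open>Integration by parts: the derivative of the periodic product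
  \<open>chr z x * f x\<close> has integral zero.\<close>

lemma tcoef_pdv:
  assumes f: "f \<in> torus_smooth" and z: "z \<in> intlat" and b: "b \<in> Basis"
  shows "tcoef (pdv b f) z = - \<i> * of_real (z \<bullet> b) * tcoef f z"
proof -
  let ?g = "\<lambda>x. chr z x * f x"
  have der: "(?g has_derivative (\<lambda>h. chr z x * pdv h f x + \<i> * of_real (z \<bullet> h) * chr z x * f x)) (at x)" for x
    using has_derivative_mult[OF chr_has_derivative smooth_has_derivative[OF torus_smoothD(1)[OF f]]]
    by simp
  have pdvg: "pdv b ?g = (\<lambda>x. chr z x * pdv b f x + \<i> * of_real (z \<bullet> b) * ?g x)"
    using pdv_eqI[OF der] by (auto simp: mult_ac)
  note c = torus_smoothD(3)[OF torus_smooth_pdv[OF f b]] torus_smoothD(3)[OF f]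
  have "torus_integral (pdv b ?g) = 0"
  proof (rule torus_integral_pdv)
    show "?g differentiable (at x)" for x using der differentiable_def by blast
    show "torus_periodic ?g"
      using chr_periodic[OF z] torus_smoothD(2)[OF f] by (simp add: torus_periodic_def)
    show "continuous_on UNIV (pdv b ?g)"
      unfolding pdvg by (intro continuous_intros c)
  qed (rule b)
  moreover have "torus_integral (pdv b ?g) = tcoef (pdv b f) z + \<i> * of_real (z \<bullet> b) * tcoef f z"
    unfolding pdvg tcoef_def
    by (subst torus_integral_add) (auto intro!: continuous_intros c simp: torus_integral_cmult)
  ultimately show ?thesis by (simp add: add_eq_0_iff)
qed

text \<open>For \<open>z \<noteq> 0\<close> some \<open>z \<bullet> b\<close> is nonzero, so
  \<open>chr z\<close> is a multiple of its own derivative along \<open>b\<close>, and integrals of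
  derivatives vanish.\<close>

lemma torus_integral_chr:
  assumes z: "(z::'a::euclidean_space) \<in> intlat"
  shows "torus_integral (chr z) = (if z = 0 then of_real ((2 * pi) ^ DIM('a)) else 0)"
proof (cases "z = 0")
  case True
  have "chr (0::'a) = (\<lambda>_. 1)" by auto
  with True show ?thesis using torus_integral_const[of 1] by simp
next
  case False
  then obtain b where b: "b \<in> Basis" "z \<bullet> b \<noteq> 0"
    using euclidean_all_zero_iff by blast
  have "torus_integral (pdv b (chr z)) = 0"
    by (rule torus_integral_pdv[OF chr_differentiable chr_periodic[OF z] b(1)])
      (simp add: pdv_chr, intro continuous_intros)
  then show ?thesis using b False by (simp add: pdv_chr torus_integral_cmult)
qed

section \<open>Uniqueness of Fourier coefficients\<close>

text \<open>To be shown trivial. The closure properties make this set a module over the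
  trigonometric polynomials, which is what the approximation argument uses.\<close>

definition fourier_null :: "('a::euclidean_space \<Rightarrow> complex) set" where
  "fourier_null = {h. continuous_on UNIV h \<and> torus_periodic h \<and> (\<forall>z\<in>intlat. tcoef h z = 0)}"

lemma fourier_null_add:
  assumes "f \<in> fourier_null" "g \<in> fourier_null"
  shows "(\<lambda>x. f x + g x) \<in> fourier_null"
proof -
  have "tcoef (\<lambda>x. f x + g x) z = tcoef f z + tcoef g z" for z
    using assms unfolding tcoef_def fourier_null_def distrib_left
    by (intro torus_integral_add continuous_intros) auto
  then show ?thesis using assms
    by (auto simp: fourier_null_def torus_periodic_def intro!: continuous_intros)
qed

lemma fourier_null_cmult:
  assumes "f \<in> fourier_null"
  shows "(\<lambda>x. c * f x) \<in> fourier_null"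
proof -
  have "tcoef (\<lambda>x. c * f x) z = c * tcoef f z" for z
    unfolding tcoef_def by (simp add: mult.left_commute torus_integral_cmult)
  then show ?thesis using assms
    by (auto simp: fourier_null_def torus_periodic_def intro!: continuous_intros)
qed

lemma fourier_null_0 [simp]: "(\<lambda>_. 0) \<in> fourier_null"
  by (simp add: fourier_null_def torus_periodic_def tcoef_def torus_integral_def)

lemma fourier_null_sum:
  "(\<And>i. i \<in> I \<Longrightarrow> f i \<in> fourier_null) \<Longrightarrow> (\<lambda>x. \<Sum>i\<in>I. f i x) \<in> fourier_null"
  by (induction I rule: infinite_finite_induct) (auto intro: fourier_null_add)

lemma fourier_null_chr:
  assumes "f \<in> fourier_null" "w \<in> intlat"
  shows "(\<lambda>x. chr w x * f x) \<in> fourier_null"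
proof -
  have "tcoef (\<lambda>x. chr w x * f x) z = tcoef f (z + w)" for z
    unfolding tcoef_def by (simp add: chr_add mult.assoc)
  then show ?thesis using assms chr_periodic[OF assms(2)]
    by (auto simp: fourier_null_def torus_periodic_def intro!: continuous_intros intlat_add)
qed

text \<open>The embedding as a product of circles turns trigonometric polynomials into polynomials, so that
  the Stone--Weierstrass theorem applies to periodic functions.\<close>

definition circles :: "'a::euclidean_space \<Rightarrow> 'a \<times> 'a" where
  "circles x = ((\<Sum>b\<in>Basis. cos (x \<bullet> b) *\<^sub>R b), (\<Sum>b\<in>Basis. sin (x \<bullet> b) *\<^sub>R b))"

lemma circles_continuous: "continuous_on S circles"
  unfolding circles_def by (intro continuous_intros)

lemma circles_eqD:
  fixes x y :: "'a::euclidean_space"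
  assumes "circles x = circles y"
  obtains z where "z \<in> intlat" "x = y + (2 * pi) *\<^sub>R z"
proof -
  have "\<exists>n::int. x \<bullet> b = y \<bullet> b + 2 * pi * of_int n" if b: "b \<in> Basis" for b
  proof -
    have "fst (circles x) \<bullet> b = fst (circles y) \<bullet> b" "snd (circles x) \<bullet> b = snd (circles y) \<bullet> b"
      using assms by simp_all
    then have "cos (x \<bullet> b) = cos (y \<bullet> b)" "sin (x \<bullet> b) = sin (y \<bullet> b)"
      using b by (simp_all add: circles_def)
    then show ?thesis using sin_cos_eq_iff by metis
  qed
  then obtain n :: "'a \<Rightarrow> int" where n: "\<And>b. b \<in> Basis \<Longrightarrow> x \<bullet> b = y \<bullet> b + 2 * pi * of_int (n b)"
    by metis
  define z where "z = (\<Sum>b\<in>Basis. of_int (n b) *\<^sub>R b :: 'a)"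
  have zb: "z \<bullet> b = of_int (n b)" if "b \<in> Basis" for b using that by (simp add: z_def)
  have "x = y + (2 * pi) *\<^sub>R z"
    by (rule euclidean_eqI) (simp add: inner_add_left n zb)
  moreover have "z \<in> intlat" by (simp add: intlat_def zb)
  ultimately show thesis using that by blast
qed

lemma Basis_intlat: "b \<in> Basis \<Longrightarrow> b \<in> intlat"
  by (auto simp: intlat_def inner_Basis)

text \<open>A linear functional of \<open>circles x\<close> is a combination of cosines and sines of
  the coordinates, hence of the characters \<open>chr b\<close> and \<open>chr (- b)\<close>, and
  multiplication by a character only shifts coefficients.\<close>

lemma fourier_null_polynomial:
  assumes "real_polynomial_function q" "h \<in> fourier_null"
  shows "(\<lambda>x. of_real (q (circles x)) * h x) \<in> fourier_null"
  using assms
proof (induction q arbitrary: h rule: real_polynomial_function.induct)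
  case (linear f)
  then interpret f: bounded_linear f by simp
  have f_Pair: "f (u, v) = f (u, 0) + f (0, v)" for u v
    using f.add[of "(u, 0)" "(0, v)"] by simp
  have "f ((\<Sum>b\<in>Basis. a b *\<^sub>R b), 0) = (\<Sum>b\<in>Basis. a b * f (b, 0))" for a :: "'a \<Rightarrow> real"
  proof -
    have "((\<Sum>b\<in>Basis. a b *\<^sub>R b), 0::'a) = (\<Sum>b\<in>Basis. a b *\<^sub>R (b, 0))"
      by (simp add: sum_prod)
    then show ?thesis by (simp only: f.sum f.scaleR real_scaleR_def)
  qed
  moreover have "f (0, (\<Sum>b\<in>Basis. a b *\<^sub>R b)) = (\<Sum>b\<in>Basis. a b * f (0, b))" for a :: "'a \<Rightarrow> real"
  proof -
    have "(0::'a, (\<Sum>b\<in>Basis. a b *\<^sub>R b)) = (\<Sum>b\<in>Basis. a b *\<^sub>R (0, b))"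
      by (simp add: sum_prod)
    then show ?thesis by (simp only: f.sum f.scaleR real_scaleR_def)
  qed
  ultimately have fc: "f (circles x) = (\<Sum>b\<in>Basis. cos (x \<bullet> b) * f (b, 0) + sin (x \<bullet> b) * f (0, b))" for x
    unfolding circles_def by (subst f_Pair) (simp add: sum.distrib)
  have cs: "complex_of_real (cos (x \<bullet> b)) = (chr b x + chr (- b) x) / 2"
    "complex_of_real (sin (x \<bullet> b)) = (chr b x - chr (- b) x) / (2 * \<i>)" for x b :: 'a
    by (simp_all add: chr_def complex_eq_iff inner_commute)
  \<comment> \<open>Collects \<open>F cos + G sin\<close>, times \<open>k\<close>, by the two
    exponentials \<open>e\<close> and \<open>e'\<close>.\<close>
  have alg: "((e + e') / 2 * F + (e - e') / (2 * \<i>) * G) * k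
      = (F / 2 + G / (2 * \<i>)) * (e * k) + (F / 2 - G / (2 * \<i>)) * (e' * k)" for e e' F G k :: complex
    by (simp add: field_simps)
  have "of_real (f (circles x)) * h x = (\<Sum>b\<in>Basis. (of_real (cos (x \<bullet> b)) * of_real (f (b, 0))
      + of_real (sin (x \<bullet> b)) * of_real (f (0, b))) * h x)" for x
    by (simp add: fc sum_distrib_right)
  then have "of_real (f (circles x)) * h x = (\<Sum>b\<in>Basis.
     (of_real (f (b, 0)) / 2 + of_real (f (0, b)) / (2 * \<i>)) * (chr b x * h x)
     + (of_real (f (b, 0)) / 2 - of_real (f (0, b)) / (2 * \<i>)) * (chr (- b) x * h x))" for x
    unfolding cs alg .
  moreover have "(\<lambda>x. \<Sum>b\<in>Basis.
     (of_real (f (b, 0)) / 2 + of_real (f (0, b)) / (2 * \<i>)) * (chr b x * h x)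
     + (of_real (f (b, 0)) / 2 - of_real (f (0, b)) / (2 * \<i>)) * (chr (- b) x * h x)) \<in> fourier_null"
    by (intro fourier_null_sum fourier_null_add fourier_null_cmult fourier_null_chr linear)
      (simp_all add: Basis_intlat)
  ultimately show ?case by simp
next
  case (const c)
  then show ?case by (intro fourier_null_cmult)
next
  case (add f g)
  from fourier_null_add[OF add.IH(1)[OF add.prems] add.IH(2)[OF add.prems]]
  show ?case by (simp add: distrib_right)
next
  case (mult f g)
  \<comment> \<open>The hypothesis for \<open>f\<close> is applied to the already null function
    \<open>g\<close> times \<open>h\<close>; for this the induction keeps \<open>h\<close>
    arbitrary.\<close>
  from mult.IH(1)[OF mult.IH(2)[OF mult.prems]] show ?case by (simp add: mult.assoc)
qed

text \<open>A periodic \<open>r\<close> factors as \<open>g\<close> after \<open>circles\<close>,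
  the chosen preimage being immaterial. The factor \<open>g\<close> is continuous since its graph
  over the compact image of a cell is itself a continuous image of that cell, hence closed.
  Stone--Weierstrass then applies to \<open>g\<close>.\<close>

lemma torus_approx:
  fixes r :: "'a::euclidean_space \<Rightarrow> real"
  assumes cont: "continuous_on UNIV r" and per: "torus_periodic r" and e: "e > 0"
  obtains q where "real_polynomial_function q" "\<And>x. \<bar>r x - q (circles x)\<bar> < e"
proof -
  let ?Q = "cbox 0 ((2 * pi) *\<^sub>R One) :: 'a set"
  define g where "g = (\<lambda>y. r (SOME x. circles x = y))"
  have g: "g (circles x) = r x" for x
  proof -
    have "circles (SOME x'. circles x' = circles x) = circles x" by (rule someI) simp
    then show ?thesis unfolding g_def
      by (metis circles_eqD torus_periodic_intlat[OF per])
  qed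
  have "continuous_on (circles ` ?Q) g"
  proof (rule continuous_from_closed_graph)
    show "compact (r ` ?Q)"
      by (intro compact_continuous_image continuous_on_subset[OF cont]) auto
    show "g \<in> circles ` ?Q \<rightarrow> r ` ?Q" by (auto simp: g)
    have "(\<lambda>y. (y, g y)) ` circles ` ?Q = (\<lambda>x. (circles x, r x)) ` ?Q"
      by (simp add: image_image g)
    also have "compact \<dots>"
      by (intro compact_continuous_image continuous_intros circles_continuous continuous_on_subset[OF cont]) auto
    finally show "closed ((\<lambda>y. (y, g y)) ` circles ` ?Q)" by (rule compact_imp_closed)
  qed
  moreover have "compact (circles ` ?Q)"
    by (intro compact_continuous_image circles_continuous) auto
  ultimately obtain q where q: "real_polynomial_function q" "\<And>y. y \<in> circles ` ?Q \<Longrightarrow> \<bar>g y - q y\<bar> < e"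
    using e Stone_Weierstrass_real_polynomial_function by metis
  have "\<bar>r x - q (circles x)\<bar> < e" for x
  proof -
    obtain y z where y: "y \<in> ?Q" and z: "z \<in> intlat" and x: "x = y + (2 * pi) *\<^sub>R z" by (rule torus_cell)
    have "torus_periodic (circles :: 'a \<Rightarrow> _)"
      unfolding torus_periodic_def
      by (auto simp: circles_def inner_add_left inner_Basis intro!: sum.cong)
    then have "circles x = circles y" "r x = r y"
      unfolding x by (simp_all add: torus_periodic_intlat[OF _ z] per)
    then show ?thesis using q(2)[of "circles y"] y by (simp add: g)
  qed
  with q(1) that show thesis by blast
qed

text \<open>By approximation \<open>h\<close> integrates to zero against every continuous periodic
  real function, in particular against its own real and imaginary parts. The integrals of their
  squares vanish, and so do the parts.\<close>

lemma fourier_null_eq_0: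
  assumes h: "h \<in> fourier_null"
  shows "h x = 0"
proof -
  have cont: "continuous_on UNIV h" and per: "torus_periodic h"
    using h by (auto simp: fourier_null_def)
  obtain B where B: "B \<ge> 0" "\<And>x. cmod (h x) \<le> B" using torus_bounded[OF per cont] by blast
  let ?Q = "cbox 0 ((2 * pi) *\<^sub>R One) :: 'a set"
  have *: "torus_integral (\<lambda>x. of_real (r x) * h x) = 0"
    if r: "continuous_on UNIV r" "torus_periodic r" for r :: "'a \<Rightarrow> real"
  proof -
    have "cmod (torus_integral (\<lambda>x. of_real (r x) * h x)) \<le> e" if e: "e > 0" for e
    proof -
      \<comment> \<open>The summand 1 keeps the denominator positive when
        \<open>B = 0\<close>.\<close>
      define d where "d = e / (B * (2 * pi) ^ DIM('a) + 1)"
      have V: "B * (2 * pi) ^ DIM('a) \<ge> 0" using B by simp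
      then have d: "d > 0" using e by (simp add: d_def)
      obtain q where q: "real_polynomial_function q" "\<And>x. \<bar>r x - q (circles x)\<bar> < d"
        using torus_approx[OF r d] by blast
      have n: "(\<lambda>x. of_real (q (circles x)) * h x) \<in> fourier_null"
        by (rule fourier_null_polynomial[OF q(1) h])
      then have c: "continuous_on UNIV (\<lambda>x. of_real (q (circles x)) * h x)"
        by (simp add: fourier_null_def)
      have "tcoef (\<lambda>x. of_real (q (circles x)) * h x) 0 = 0"
        using n by (simp add: fourier_null_def)
      then have q0: "torus_integral (\<lambda>x. of_real (q (circles x)) * h x) = 0"
        by (simp add: tcoef_def)
      have cd: "continuous_on UNIV (\<lambda>x. of_real (r x - q (circles x)) * h x)"
        using continuous_on_diff[OF continuous_on_mult[OF continuous_on_of_real[OF r(1)] cont] c]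
        by (simp add: left_diff_distrib)
      have "torus_integral (\<lambda>x. of_real (r x) * h x)
          = torus_integral (\<lambda>x. of_real (r x - q (circles x)) * h x + of_real (q (circles x)) * h x)"
        by (simp add: left_diff_distrib)
      also have "\<dots> = torus_integral (\<lambda>x. of_real (r x - q (circles x)) * h x)"
        using torus_integral_add[OF cd c] q0 by simp
      also have "cmod \<dots> \<le> (d * B) * (2 * pi) ^ DIM('a)"
      proof (rule torus_integral_bound[OF cd])
        show "0 \<le> d * B" using d B by simp
        show "cmod (of_real (r x - q (circles x)) * h x) \<le> d * B" for x
          unfolding norm_mult norm_of_real
          by (intro mult_mono B less_imp_le[OF q(2)]) (use d in auto)
      qed
      also have "\<dots> \<le> e"
        using e V unfolding d_def by (simp add: field_simps)
      finally show ?thesis .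
    qed
    then have "cmod (torus_integral (\<lambda>x. of_real (r x) * h x)) \<le> 0"
      by (rule field_le_epsilon[where y=0, simplified])
    then show ?thesis by simp
  qed
  have **: "r y = 0" if r: "continuous_on UNIV r" "torus_periodic r"
    and i: "integral ?Q (\<lambda>x. (r x)\<^sup>2) = 0" for r :: "'a \<Rightarrow> real" and y
  proof -
    have "box 0 ((2 * pi) *\<^sub>R One) \<noteq> ({} :: 'a set)" by (simp add: box_ne_empty)
    moreover have "continuous_on ?Q (\<lambda>x. (r x)\<^sup>2)"
      by (intro continuous_intros continuous_on_subset[OF r(1)]) auto
    ultimately have z: "\<forall>x\<in>?Q. (r x)\<^sup>2 = 0"
      using i by (subst (asm) integral_cbox_eq_0_iff) auto
    obtain y' z where "y' \<in> ?Q" "z \<in> intlat" "y = y' + (2 * pi) *\<^sub>R z" by (rule torus_cell)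
    with z show ?thesis by (simp add: torus_periodic_intlat[OF r(2)])
  qed
  have R: "continuous_on UNIV (\<lambda>x. Re (h x))" "torus_periodic (\<lambda>x. Re (h x))"
    "continuous_on UNIV (\<lambda>x. Im (h x))" "torus_periodic (\<lambda>x. Im (h x))"
    using per by (auto simp: torus_periodic_def intro!: continuous_intros cont)
  have i: "(\<lambda>x. of_real (r x) * h x) integrable_on ?Q" if "continuous_on UNIV r" for r :: "'a \<Rightarrow> real"
    by (intro torus_integrable continuous_intros that cont)
  \<comment> \<open>The real part of \<open>Re h * h\<close> and the imaginary part of
    \<open>Im h * h\<close> are the two squares.\<close>
  have "Re (torus_integral (\<lambda>x. of_real (Re (h x)) * h x)) = integral ?Q (\<lambda>x. (Re (h x))\<^sup>2)"
    unfolding torus_integral_def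
    using has_integral_Re[OF integrable_integral[OF i[OF R(1)]]]
    by (simp add: power2_eq_square integral_unique)
  moreover have "Im (torus_integral (\<lambda>x. of_real (Im (h x)) * h x)) = integral ?Q (\<lambda>x. (Im (h x))\<^sup>2)"
    unfolding torus_integral_def
    using has_integral_Im[OF integrable_integral[OF i[OF R(3)]]]
    by (simp add: power2_eq_square integral_unique)
  ultimately have "Re (h x) = 0" "Im (h x) = 0"
    using *[OF R(1,2)] *[OF R(3,4)] **[OF R(1,2)] **[OF R(3,4)] by simp_all
  then show ?thesis by (simp add: complex_eq_iff)
qed

section \<open>Fourier series of smooth functions and distributions\<close>

definition fser :: "('a::euclidean_space \<Rightarrow> complex) \<Rightarrow> 'a \<Rightarrow> complex" where
  "fser c x = (\<Sum>\<^sub>\<infinity>z\<in>intlat. c z * chr z x)"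

lemma fser_summable:
  assumes "rapid c"
  shows "(\<lambda>z. c z * chr z x) summable_on intlat"
  by (rule abs_summable_summable) (simp add: norm_mult rapid_summable[OF assms])

lemma fser_0 [simp]: "fser (\<lambda>_. 0) = (\<lambda>_. 0)"
  by (simp add: fser_def fun_eq_iff)

lemma fser_add:
  "rapid a \<Longrightarrow> rapid b \<Longrightarrow> fser (\<lambda>z. a z + b z) x = fser a x + fser b x"
  unfolding fser_def distrib_right by (intro infsum_add fser_summable)

lemma fser_cmult: "fser (\<lambda>z. k * c z) x = k * fser c x"
  unfolding fser_def mult.assoc by (rule infsum_cmult_right')

lemma norm_fser_le:
  assumes "\<And>z. z \<in> intlat \<Longrightarrow> cmod (c z) \<le> g z" "g summable_on intlat"
  shows "cmod (fser c x) \<le> infsum g intlat"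
proof -
  have "(\<lambda>z. norm (c z * chr z x)) summable_on intlat"
    by (rule summable_on_comparison_test[OF assms(2)]) (auto simp: norm_mult assms(1))
  then have "(\<lambda>z. c z * chr z x) summable_on intlat" by (rule abs_summable_summable)
  then have "((\<lambda>z. c z * chr z x) has_sum fser c x) intlat"
    unfolding fser_def by (rule has_sum_infsum)
  then show ?thesis
    by (rule norm_infsum_le[OF _ has_sum_infsum[OF assms(2)]]) (simp add: norm_mult assms(1))
qed

lemma fser_continuous:
  assumes "rapid c"
  shows "continuous_on S (fser c)"
proof -
  have "uniform_limit S (\<lambda>X y. \<Sum>z\<in>X. c z * chr z y) (\<lambda>y. \<Sum>\<^sub>\<infinity>z\<in>intlat. c z * chr z y)
      (finite_subsets_at_top intlat)"
    by (rule Weierstrass_m_test_general[OF _ rapid_summable[OF assms]]) (simp add: norm_mult)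
  then show ?thesis unfolding fser_def
    by (rule uniform_limit_theorem[rotated]) (auto intro!: always_eventually continuous_intros)
qed

lemma fser_periodic: "torus_periodic (fser c)"
  unfolding torus_periodic_def fser_def
  by (intro ballI allI infsum_cong arg_cong2[where f="(*)"] refl)
    (use chr_periodic in \<open>auto simp: torus_periodic_def\<close>)

text \<open>A bilinear Parseval identity. Since \<open>g\<close> is bounded, the Weierstrass test
  makes the series converge uniformly on the cell, and integration passes to the limit of the finite
  partial sums.\<close>

lemma has_sum_torus_integral_fser:
  fixes g :: "'a::euclidean_space \<Rightarrow> complex"
  assumes c: "rapid c" and g: "continuous_on UNIV g" "torus_periodic g"
  shows "((\<lambda>z. c z * tcoef g z) has_sum torus_integral (\<lambda>x. g x * fser c x)) intlat"
proof -
  let ?Q = "cbox 0 ((2 * pi) *\<^sub>R One) :: 'a set"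
  let ?F = "finite_subsets_at_top (intlat :: 'a set)"
  obtain B where B: "B \<ge> 0" "\<And>x. cmod (g x) \<le> B" using torus_bounded[OF g(2,1)] by blast
  have "uniform_limit ?Q (\<lambda>X x. \<Sum>z\<in>X. c z * (chr z x * g x)) (\<lambda>x. \<Sum>\<^sub>\<infinity>z\<in>intlat. c z * (chr z x * g x)) ?F"
  proof (rule Weierstrass_m_test_general)
    show "norm (c z * (chr z x * g x)) \<le> cmod (c z) * B" for z x
      using B by (simp add: norm_mult mult_left_mono)
    show "(\<lambda>z. cmod (c z) * B) summable_on intlat"
      by (intro summable_on_cmult_left rapid_summable c)
  qed
  moreover have "(\<Sum>\<^sub>\<infinity>z\<in>intlat. c z * (chr z x * g x)) = g x * fser c x" for x
    unfolding fser_def infsum_cmult_right'[symmetric] by (simp add: mult_ac)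
  ultimately have u: "uniform_limit ?Q (\<lambda>X x. \<Sum>z\<in>X. c z * (chr z x * g x)) (\<lambda>x. g x * fser c x) ?F"
    by simp
  have cont: "continuous_on ?Q (\<lambda>x. \<Sum>z\<in>X. c z * (chr z x * g x))" for X
    by (intro continuous_intros continuous_on_subset[OF g(1)]) auto
  have "\<exists>I J. (\<forall>X. ((\<lambda>x. \<Sum>z\<in>X. c z * (chr z x * g x)) has_integral I X) ?Q)
      \<and> ((\<lambda>x. g x * fser c x) has_integral J) ?Q \<and> (I \<longlongrightarrow> J) ?F"
    by (rule uniform_limit_integral_cbox[OF u cont finite_subsets_at_top_neq_bot]) blast
  then obtain I J where I: "\<And>X. ((\<lambda>x. \<Sum>z\<in>X. c z * (chr z x * g x)) has_integral I X) ?Q"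
    and J: "((\<lambda>x. g x * fser c x) has_integral J) ?Q" and lim: "(I \<longlongrightarrow> J) ?F"
    by blast
  have "I X = (\<Sum>z\<in>X. c z * tcoef g z)" if "finite X" for X
  proof -
    have int: "(\<lambda>x. chr z x * g x) integrable_on ?Q" for z
      by (intro torus_integrable continuous_intros g)
    have "I X = integral ?Q (\<lambda>x. \<Sum>z\<in>X. c z * (chr z x * g x))"
      using integral_unique[OF I] by simp
    also have "\<dots> = (\<Sum>z\<in>X. integral ?Q (\<lambda>x. c z * (chr z x * g x)))"
      by (intro integral_sum that integrable_on_mult_right int)
    finally show ?thesis by (simp add: tcoef_def torus_integral_def)
  qed
  then have "\<forall>\<^sub>F X in ?F. I X = (\<Sum>z\<in>X. c z * tcoef g z)"
    by (auto intro: eventually_finite_subsets_at_top_weakI)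
  then have "((\<lambda>X. \<Sum>z\<in>X. c z * tcoef g z) \<longlongrightarrow> J) ?F"
    using lim by (rule tendsto_cong[THEN iffD1])
  moreover have "J = torus_integral (\<lambda>x. g x * fser c x)"
    using J by (simp add: torus_integral_def integral_unique)
  ultimately show ?thesis by (simp add: has_sum_def)
qed

lemma tcoef_chr:
  assumes "z \<in> intlat" "w \<in> intlat"
  shows "tcoef (chr w :: 'a::euclidean_space \<Rightarrow> complex) z = (if w = - z then of_real ((2 * pi) ^ DIM('a)) else 0)"
proof -
  have "tcoef (chr w) z = torus_integral (chr (z + w))"
    unfolding tcoef_def by (intro arg_cong[where f=torus_integral]) (simp add: chr_add fun_eq_iff)
  moreover have "z + w = 0 \<longleftrightarrow> w = - z" by (simp add: add_eq_0_iff)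
  ultimately show ?thesis using torus_integral_chr[OF intlat_add[OF assms]] by simp
qed

text \<open>In the Parseval identity with \<open>g = chr w\<close>, orthogonality leaves only the
  index \<open>- w\<close>.\<close>

lemma tcoef_fser:
  assumes c: "rapid c" and w: "(w::'a::euclidean_space) \<in> intlat"
  shows "tcoef (fser c) w = of_real ((2 * pi) ^ DIM('a)) * c (- w)"
proof -
  have "((\<lambda>z. c z * tcoef (chr w) z) has_sum tcoef (fser c) w) intlat"
    unfolding tcoef_def[of "fser c"]
    by (rule has_sum_torus_integral_fser[OF c chr_continuous chr_periodic[OF w]])
  moreover have "((\<lambda>z. c z * tcoef (chr w) z) has_sum c (- w) * tcoef (chr w) (- w)) intlat"
    by (rule has_sum_finite_neutralI[where B="{- w}"]) (use w in \<open>auto simp: tcoef_chr\<close>)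
  ultimately have "tcoef (fser c) w = c (- w) * tcoef (chr w) (- w)"
    by (rule has_sum_unique)
  then show ?thesis using w by (simp add: tcoef_chr)
qed

lemma rapid_inner:
  assumes "rapid c"
  shows "rapid (\<lambda>z. \<i> * of_real (z \<bullet> v) * c z)"
  by (intro polybdd_mult_rapid polybdd_mult polybdd_const polybdd_inner assms)

lemma rapid_summable_weight:
  fixes c :: "'a::euclidean_space \<Rightarrow> complex"
  assumes "rapid c"
  shows "(\<lambda>z. cmod (c z) * (1 + norm z) ^ k) summable_on intlat"
proof -
  have "polybdd (\<lambda>z::'a. of_real ((1 + norm z) ^ k) :: complex)"
    unfolding polybdd_def by (intro exI[of _ 1] exI[of _ k]) (auto simp del: of_real_power of_real_add)
  from rapid_summable[OF polybdd_mult_rapid[OF this assms]] show ?thesis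
    by (simp add: norm_mult mult.commute del: of_real_power of_real_add)
qed

lemma cis_taylor: "cmod (cis t - 1 - \<i> * of_real t) \<le> t\<^sup>2"
  using Taylor_exp[of "\<i> * of_real t" 1] by (simp add: cis_conv_exp norm_mult power2_eq_square diff_diff_eq)

text \<open>Termwise, \<open>|exp (i s) - 1 - i s| \<le> s\<^sup>2\<close> with
  \<open>s = z \<bullet> h\<close>. Summation bounds the linearisation error by
  \<open>(norm h)\<^sup>2\<close> times \<open>S 2\<close>, the coefficient sum with weight
  \<open>(1 + norm z)\<^sup>2\<close>; \<open>S 1\<close> bounds the candidate derivative.\<close>

lemma fser_has_derivative:
  assumes c: "rapid c"
  shows "(fser c has_derivative (\<lambda>h. fser (\<lambda>z. \<i> * of_real (z \<bullet> h) * c z) x)) (at x)"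
proof -
  let ?L = "\<lambda>h. fser (\<lambda>z. \<i> * of_real (z \<bullet> h) * c z) x"
  define S where "S = (\<lambda>k. infsum (\<lambda>z. cmod (c z) * (1 + norm z) ^ k) intlat)"
  have S: "S k \<ge> 0" for k unfolding S_def by (intro infsum_nonneg) simp
  have inner_le: "\<bar>z \<bullet> h\<bar> \<le> (1 + norm z) * norm h" for z h :: 'a
    using Cauchy_Schwarz_ineq2[of z h] by (rule order_trans) (intro mult_right_mono; simp)
  have "bounded_linear ?L"
  proof (rule bounded_linear_intro[where K="S 1"])
    fix h k r
    show "?L (h + k) = ?L h + ?L k"
      unfolding fser_add[OF rapid_inner[OF c] rapid_inner[OF c], symmetric]
      by (simp add: inner_add_right algebra_simps)
    have "?L (r *\<^sub>R h) = fser (\<lambda>z. of_real r * (\<i> * of_real (z \<bullet> h) * c z)) x"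
      by (simp add: mult_ac)
    then show "?L (r *\<^sub>R h) = r *\<^sub>R ?L h" by (simp only: fser_cmult scaleR_conv_of_real)
    have "norm (?L h) \<le> infsum (\<lambda>z. norm h * (cmod (c z) * (1 + norm z) ^ 1)) intlat"
    proof (rule norm_fser_le)
      show "(\<lambda>z. norm h * (cmod (c z) * (1 + norm z) ^ 1)) summable_on intlat"
        by (intro summable_on_cmult_right rapid_summable_weight c)
      show "cmod (\<i> * of_real (z \<bullet> h) * c z) \<le> norm h * (cmod (c z) * (1 + norm z) ^ 1)" for z
        using mult_right_mono[OF inner_le[of z h], of "cmod (c z)"] by (simp add: norm_mult mult_ac)
    qed
    then show "norm (?L h) \<le> norm h * S 1"
      unfolding S_def infsum_cmult_right' .
  qed
  moreover have est: "norm (fser c y - fser c x - ?L (y - x)) \<le> (norm (y - x))\<^sup>2 * S 2" for y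
  proof -
    let ?h = "y - x"
    define d where "d = (\<lambda>z. c z * (cis (z \<bullet> ?h) - 1 - \<i> * of_real (z \<bullet> ?h)))"
    have y: "fser c y = fser (\<lambda>z. c z * chr z ?h) x"
      unfolding fser_def
    proof (rule infsum_cong)
      fix z show "c z * chr z y = c z * chr z ?h * chr z x"
        using chr_add_arg[of z ?h x] by simp
    qed
    have r1: "rapid (\<lambda>z. c z * chr z ?h)"
      by (rule rapid_mono[OF c]) (simp add: norm_mult)
    have r2: "rapid (\<lambda>z. (-1) * c z)" "rapid (\<lambda>z. (-1) * (\<i> * of_real (z \<bullet> ?h) * c z))"
      by (intro rapid_cmult c rapid_inner)+
    have r3: "rapid (\<lambda>z. c z * chr z ?h + (-1) * c z)"
    proof -
      have "rapid (\<lambda>z. (chr z ?h + (-1)) * c z)"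
      proof (rule polybdd_mult_rapid[OF polybdd_add c])
        show "polybdd (\<lambda>z. chr z ?h)" by (rule polybdd_mono[OF polybdd_const[of 1]]) simp
      qed simp
      then show ?thesis by (simp add: algebra_simps)
    qed
    have "fser c y - fser c x - ?L ?h = fser (\<lambda>z. (c z * chr z ?h + (-1) * c z) + (-1) * (\<i> * of_real (z \<bullet> ?h) * c z)) x"
      unfolding fser_add[OF r3 r2(2)] fser_add[OF r1 r2(1)] fser_cmult y by simp
    also have "\<dots> = fser d x"
      unfolding d_def by (intro arg_cong2[where f=fser]) (auto simp: fun_eq_iff chr_def algebra_simps)
    also have "norm \<dots> \<le> infsum (\<lambda>z. (norm ?h)\<^sup>2 * (cmod (c z) * (1 + norm z) ^ 2)) intlat"
    proof (rule norm_fser_le)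
      show "(\<lambda>z. (norm ?h)\<^sup>2 * (cmod (c z) * (1 + norm z) ^ 2)) summable_on intlat"
        by (intro summable_on_cmult_right rapid_summable_weight c)
      fix z
      have "cmod (cis (z \<bullet> ?h) - 1 - \<i> * of_real (z \<bullet> ?h)) \<le> (z \<bullet> ?h)\<^sup>2" by (rule cis_taylor)
      also have "\<dots> \<le> ((1 + norm z) * norm ?h)\<^sup>2"
        using power_mono[OF inner_le[of z ?h], of 2] by simp
      finally have "cmod (c z) * cmod (cis (z \<bullet> ?h) - 1 - \<i> * of_real (z \<bullet> ?h))
          \<le> cmod (c z) * ((1 + norm z) * norm ?h)\<^sup>2"
        by (rule mult_left_mono) simp
      then show "cmod (d z) \<le> (norm ?h)\<^sup>2 * (cmod (c z) * (1 + norm z) ^ 2)"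
        unfolding d_def norm_mult by (simp add: power_mult_distrib mult_ac)
    qed
    finally show ?thesis unfolding S_def infsum_cmult_right' .
  qed
  \<comment> \<open>The radius is \<open>e / (S 2 + 1)\<close> because \<open>S 2\<close> may
    vanish.\<close>
  have "\<exists>d>0. \<forall>y. norm (y - x) < d \<longrightarrow> norm (fser c y - fser c x - ?L (y - x)) \<le> e * norm (y - x)"
    if e: "e > 0" for e
  proof (intro exI[of _ "e / (S 2 + 1)"] conjI allI impI)
    show "0 < e / (S 2 + 1)" using e S[of 2] by simp
    fix y assume y: "norm (y - x) < e / (S 2 + 1)"
    have "(norm (y - x))\<^sup>2 * S 2 = norm (y - x) * (norm (y - x) * S 2)"
      by (simp add: power2_eq_square)
    also have "\<dots> \<le> norm (y - x) * e"
    proof (rule mult_left_mono)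
      have "norm (y - x) * S 2 \<le> norm (y - x) * (S 2 + 1)" by (intro mult_left_mono) auto
      also have "\<dots> \<le> e" using y S[of 2] by (simp add: field_simps)
      finally show "norm (y - x) * S 2 \<le> e" .
    qed simp
    finally show "norm (fser c y - fser c x - ?L (y - x)) \<le> e * norm (y - x)"
      using est[of y] by (simp add: mult.commute)
  qed
  ultimately show ?thesis unfolding has_derivative_at_alt by blast
qed

lemma pdv_fser: "rapid c \<Longrightarrow> pdv v (fser c) = fser (\<lambda>z. \<i> * of_real (z \<bullet> v) * c z)"
  using pdv_eqI[OF fser_has_derivative] by blast

text \<open>Rapid decay survives multiplication by \<open>\<i> * (z \<bullet> b)\<close>, so every
  iterated derivative is again such a series and therefore differentiable.\<close>

lemma fser_torus_smooth:
  assumes "rapid c"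
  shows "fser c \<in> torus_smooth"
proof -
  have *: "\<exists>c'. rapid c' \<and> foldr pdv bs (fser c) = fser c'" for bs
  proof (induction bs)
    case (Cons b bs)
    then obtain c' where c': "rapid c'" "foldr pdv bs (fser c) = fser c'" by blast
    then have "foldr pdv (b # bs) (fser c) = fser (\<lambda>z. \<i> * of_real (z \<bullet> b) * c' z)"
      by (simp add: pdv_fser)
    then show ?case using rapid_inner[OF c'(1)] by blast
  qed (use assms in auto)
  have "foldr pdv bs (fser c) differentiable (at x)" for bs x
  proof -
    obtain c' where "rapid c'" "foldr pdv bs (fser c) = fser c'" using * by blast
    then show ?thesis unfolding differentiable_def using fser_has_derivative[of c' x] by auto
  qed
  then show ?thesis using fser_periodic by (auto simp: torus_smooth_def smooth_def)
qed

section \<open>Smooth functions from their coefficients; the seminorms in the continuity bound of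
  distributions\<close>

definition snorm :: "nat \<Rightarrow> ('a::euclidean_space \<Rightarrow> complex) \<Rightarrow> real" where
  "snorm k \<phi> = (\<Sum>bs | set bs \<subseteq> Basis \<and> length bs \<le> k. SUP x. cmod (foldr pdv bs \<phi> x))"

lemma SUP_torus:
  fixes f :: "'a::euclidean_space \<Rightarrow> complex"
  assumes "f \<in> torus_smooth"
  shows "cmod (f x) \<le> (SUP x. cmod (f x))" "0 \<le> (SUP x. cmod (f x))"
proof -
  obtain B where "\<And>x. cmod (f x) \<le> B"
    using torus_bounded[OF torus_smoothD(2)[OF assms] torus_smoothD(3)[OF assms]] by blast
  then have "bdd_above (range (\<lambda>x. cmod (f x)))" by (auto simp: bdd_above_def)
  then show *: "cmod (f x) \<le> (SUP x. cmod (f x))" for x by (rule cSUP_upper2) auto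
  show "0 \<le> (SUP x. cmod (f x))" using *[of 0] norm_ge_zero[of "f 0"] by linarith
qed

lemma finite_multi: "finite {bs. set bs \<subseteq> (Basis::'a::euclidean_space set) \<and> length bs \<le> k}"
  by (rule finite_lists_length_le) simp

lemma snorm_mono:
  assumes "\<phi> \<in> torus_smooth"
  shows "snorm k \<phi> \<le> snorm (Suc k) \<phi>"
  unfolding snorm_def
  by (rule sum_mono2[OF finite_multi]) (auto intro!: SUP_torus(2) torus_smooth_foldr_pdv assms)

text \<open>\<open>foldr\<close> applies the last entry of the list first, so the extra derivative
  is appended at the end; this embeds the lists of length at most \<open>k\<close> into those of
  length at most \<open>Suc k\<close>.\<close>

lemma snorm_pdv:
  assumes "\<phi> \<in> torus_smooth" "b \<in> Basis"
  shows "snorm k (pdv b \<phi>) \<le> snorm (Suc k) \<phi>"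
proof -
  let ?M = "\<lambda>k. {bs. set bs \<subseteq> (Basis::'a set) \<and> length bs \<le> k}"
  have "snorm k (pdv b \<phi>) = (\<Sum>bs\<in>(\<lambda>bs. bs @ [b]) ` ?M k. SUP x. cmod (foldr pdv bs \<phi> x))"
    unfolding snorm_def by (subst sum.reindex) (auto simp: inj_on_def)
  also have "\<dots> \<le> snorm (Suc k) \<phi>"
    unfolding snorm_def
    by (rule sum_mono2[OF finite_multi])
      (use assms(2) in \<open>auto intro!: SUP_torus(2) torus_smooth_foldr_pdv assms(1)\<close>)
  finally show ?thesis .
qed

text \<open>Each factor \<open>1 + norm z\<close> is paid for by derivatives: it is at most 1 plus
  the sum of the \<open>\<bar>z \<bullet> b\<bar>\<close>, and
  \<open>\<bar>z \<bullet> b\<bar>\<close> turns the coefficient of \<open>\<phi>\<close> into that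
  of \<open>pdv b \<phi>\<close> in modulus. These are \<open>1 + DIM('a)\<close> terms per step,
  which explains the constant.\<close>

lemma tcoef_bound:
  fixes \<phi> :: "'a::euclidean_space \<Rightarrow> complex"
  assumes "\<phi> \<in> torus_smooth" "z \<in> intlat"
  shows "cmod (tcoef \<phi> z) * (1 + norm z) ^ k \<le> (2 * pi) ^ DIM('a) * (1 + DIM('a)) ^ k * snorm k \<phi>"
  using assms(1)
proof (induction k arbitrary: \<phi>)
  case 0
  have "{bs. set bs \<subseteq> (Basis::'a set) \<and> length bs \<le> 0} = {[]}" by auto
  then have "snorm 0 \<phi> = (SUP x. cmod (\<phi> x))" by (simp add: snorm_def)
  moreover have "cmod (tcoef \<phi> z) \<le> (SUP x. cmod (\<phi> x)) * (2 * pi) ^ DIM('a)"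
    unfolding tcoef_def using SUP_torus[OF 0]
    by (intro torus_integral_bound continuous_intros torus_smoothD(3)[OF 0]) (simp_all add: norm_mult)
  ultimately show ?case by (simp add: mult.commute)
next
  case (Suc k)
  let ?V = "(2 * pi) ^ DIM('a) * (1 + DIM('a)) ^ k"
  have V: "?V \<ge> 0" by simp
  have "cmod (tcoef \<phi> z) * (1 + norm z) ^ Suc k = (cmod (tcoef \<phi> z) * (1 + norm z) ^ k) * (1 + norm z)"
    by simp
  also have "\<dots> \<le> (cmod (tcoef \<phi> z) * (1 + norm z) ^ k) * (1 + (\<Sum>b\<in>Basis. \<bar>z \<bullet> b\<bar>))"
    using norm_le_l1[of z] by (intro mult_left_mono) auto
  also have "\<dots> = cmod (tcoef \<phi> z) * (1 + norm z) ^ k + (\<Sum>b\<in>Basis. cmod (tcoef (pdv b \<phi>) z) * (1 + norm z) ^ k)"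
    by (simp add: distrib_left sum_distrib_left tcoef_pdv[OF Suc.prems assms(2)] norm_mult mult_ac)
  also have "\<dots> \<le> ?V * snorm k \<phi> + (\<Sum>b\<in>Basis. ?V * snorm k (pdv b \<phi>))"
    by (intro add_mono sum_mono Suc.IH Suc.prems torus_smooth_pdv)
  also have "\<dots> \<le> ?V * snorm (Suc k) \<phi> + (\<Sum>b\<in>(Basis::'a set). ?V * snorm (Suc k) \<phi>)"
    by (intro add_mono sum_mono mult_left_mono snorm_mono snorm_pdv Suc.prems V)
  also have "\<dots> = (2 * pi) ^ DIM('a) * (1 + DIM('a)) ^ Suc k * snorm (Suc k) \<phi>"
    by (simp add: algebra_simps)
  finally show ?case .
qed

lemma rapid_tcoef: "\<phi> \<in> torus_smooth \<Longrightarrow> rapid (tcoef \<phi>)"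
  unfolding rapid_def using tcoef_bound by blast

definition fcoef :: "('a::euclidean_space \<Rightarrow> complex) \<Rightarrow> 'a \<Rightarrow> complex" where
  "fcoef \<phi> z = tcoef \<phi> (- z) / of_real ((2 * pi) ^ DIM('a))"

lemma rapid_fcoef: "\<phi> \<in> torus_smooth \<Longrightarrow> rapid (fcoef \<phi>)"
  unfolding fcoef_def divide_inverse mult.commute[of _ "inverse _"]
  by (intro rapid_cmult rapid_minus rapid_tcoef)

text \<open>Both sides are continuous and periodic with the same coefficients, so their difference
  lies in \<open>fourier_null\<close>.\<close>

lemma fser_fcoef:
  fixes \<phi> :: "'a::euclidean_space \<Rightarrow> complex"
  assumes \<phi>: "\<phi> \<in> torus_smooth"
  shows "fser (fcoef \<phi>) = \<phi>"
proof
  fix x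
  let ?g = "fser (fcoef \<phi>)"
  note r = rapid_fcoef[OF \<phi>]
  have "(\<lambda>x. ?g x + (-1) * \<phi> x) \<in> fourier_null"
    unfolding fourier_null_def
  proof (intro CollectI conjI ballI)
    show "continuous_on UNIV (\<lambda>x. ?g x + (-1) * \<phi> x)"
      by (intro continuous_intros fser_continuous r torus_smoothD(3)[OF \<phi>])
    show "torus_periodic (\<lambda>x. ?g x + (-1) * \<phi> x)"
      using fser_periodic[of "fcoef \<phi>"] torus_smoothD(2)[OF \<phi>] by (simp add: torus_periodic_def)
    fix z :: 'a assume z: "z \<in> intlat"
    have "tcoef (\<lambda>x. ?g x + (-1) * \<phi> x) z = torus_integral (\<lambda>x. chr z x * ?g x + (-1) * (chr z x * \<phi> x))"
      unfolding tcoef_def by (simp add: algebra_simps)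
    also have "\<dots> = tcoef ?g z + (-1) * tcoef \<phi> z"
      unfolding tcoef_def torus_integral_cmult[symmetric]
      by (intro torus_integral_add continuous_intros fser_continuous r torus_smoothD(3)[OF \<phi>])
    also have "\<dots> = 0"
      unfolding tcoef_fser[OF r z] by (simp add: fcoef_def)
    finally show "tcoef (\<lambda>x. ?g x + (-1) * \<phi> x) z = 0" .
  qed
  from fourier_null_eq_0[OF this, of x] show "?g x = \<phi> x" by simp
qed

text \<open>Adding coefficients replaces the distribution of iterated derivatives over the
  sum.\<close>

lemma torus_smooth_add:
  assumes "f \<in> torus_smooth" "g \<in> torus_smooth"
  shows "(\<lambda>x. f x + g x) \<in> torus_smooth"
proof -
  have "(\<lambda>x. f x + g x) = fser (\<lambda>z. fcoef f z + fcoef g z)"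
    unfolding fun_eq_iff
    by (simp only: fser_add[OF rapid_fcoef[OF assms(1)] rapid_fcoef[OF assms(2)]] fser_fcoef[OF assms(1)] fser_fcoef[OF assms(2)]) simp
  moreover have "rapid (\<lambda>z. fcoef f z + fcoef g z)"
    unfolding rapid_def
  proof
    fix k
    obtain A B where "\<And>z. z \<in> intlat \<Longrightarrow> cmod (fcoef f z) * (1 + norm z) ^ k \<le> A"
      "\<And>z. z \<in> intlat \<Longrightarrow> cmod (fcoef g z) * (1 + norm z) ^ k \<le> B"
      using rapid_fcoef assms unfolding rapid_def by metis
    then have "cmod (fcoef f z + fcoef g z) * (1 + norm z) ^ k \<le> A + B" if "z \<in> intlat" for z
      using that mult_right_mono[OF norm_triangle_ineq[of "fcoef f z" "fcoef g z"], of "(1 + norm z) ^ k"]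
      by (fastforce simp: distrib_right)
    then show "\<exists>C. \<forall>z\<in>intlat. cmod (fcoef f z + fcoef g z) * (1 + norm z) ^ k \<le> C" by blast
  qed
  ultimately show ?thesis using fser_torus_smooth by simp
qed

lemma torus_smooth_cmult:
  assumes "f \<in> torus_smooth"
  shows "(\<lambda>x. c * f x) \<in> torus_smooth"
proof -
  have "(\<lambda>x. c * f x) = fser (\<lambda>z. c * fcoef f z)"
    using assms by (simp add: fun_eq_iff fser_cmult fser_fcoef)
  then show ?thesis using fser_torus_smooth[OF rapid_cmult[OF rapid_fcoef[OF assms]]] by simp
qed

lemma torus_smooth_0 [simp]: "(\<lambda>_. 0) \<in> torus_smooth"
  using fser_torus_smooth[OF rapid_0] by simp

lemma rapid_delta: "rapid (\<lambda>z. if z = w then c else 0)"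
  unfolding rapid_def by (auto intro!: exI[of _ "cmod c * (1 + norm w) ^ _"])

lemma fser_delta: "w \<in> intlat \<Longrightarrow> fser (\<lambda>z. if z = w then c else 0) = (\<lambda>x. c * chr w x)"
  unfolding fser_def
  by (rule ext, rule infsumI, rule has_sum_finite_neutralI[where B="{w}"]) auto

lemma chr_torus_smooth: "w \<in> intlat \<Longrightarrow> chr w \<in> torus_smooth"
  using fser_torus_smooth[OF rapid_delta[of w 1]] by (simp add: fser_delta)

text \<open>The distribution \<open>\<Sum> a\<^sub>z e\<^sup>i\<^sup>z\<^sup>x\<close>: \<open>tcoef \<phi> z\<close> is the pairing with \<open>e\<^sup>i\<^sup>z\<^sup>x\<close>, hence a multiple of the
  Fourier coefficient of \<open>\<phi>\<close> at \<open>-z\<close>.\<close>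

definition dser :: "('a::euclidean_space \<Rightarrow> complex) \<Rightarrow> 'a functional" where
  "dser a \<phi> = (if \<phi> \<in> torus_smooth then \<Sum>\<^sub>\<infinity>z\<in>intlat. a z * tcoef \<phi> z else 0)"

lemma dser_summable:
  assumes "polybdd a" "\<phi> \<in> torus_smooth"
  shows "(\<lambda>z. a z * tcoef \<phi> z) summable_on intlat"
  by (rule abs_summable_summable[OF rapid_summable[OF polybdd_mult_rapid[OF assms(1) rapid_tcoef[OF assms(2)]]]])

lemma dser_0 [simp]: "dser (\<lambda>_. 0) = (\<lambda>_. 0)"
  by (simp add: dser_def fun_eq_iff)

lemma dser_cong: "(\<And>z. z \<in> intlat \<Longrightarrow> a z = b z) \<Longrightarrow> dser a = dser b"
  by (auto simp: dser_def fun_eq_iff intro!: infsum_cong)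

lemma dser_add:
  "polybdd a \<Longrightarrow> polybdd b \<Longrightarrow> dser (\<lambda>z. a z + b z) \<phi> = dser a \<phi> + dser b \<phi>"
  unfolding dser_def by (auto simp: distrib_right intro!: infsum_add dser_summable)

lemma dser_cmult: "dser (\<lambda>z. k * a z) \<phi> = k * dser a \<phi>"
  unfolding dser_def by (simp add: mult.assoc infsum_cmult_right')

lemma dser_sum:
  "(\<And>i. i \<in> I \<Longrightarrow> polybdd (a i)) \<Longrightarrow> dser (\<lambda>z. \<Sum>i\<in>I. a i z) \<phi> = (\<Sum>i\<in>I. dser (a i) \<phi>)"
  by (induction I rule: infinite_finite_induct) (auto simp: dser_add polybdd_sum)

lemma tcoef_add:
  "f \<in> torus_smooth \<Longrightarrow> g \<in> torus_smooth \<Longrightarrow> tcoef (\<lambda>x. f x + g x) z = tcoef f z + tcoef g z"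
  unfolding tcoef_def distrib_left by (intro torus_integral_add continuous_intros torus_smoothD(3))

lemma tcoef_cmult: "tcoef (\<lambda>x. c * f x) z = c * tcoef f z"
  unfolding tcoef_def by (simp add: mult.left_commute torus_integral_cmult)

lemma dser_distribution:
  fixes a :: "'a::euclidean_space \<Rightarrow> complex"
  assumes a: "polybdd a"
  shows "dser a \<in> torus_distributions"
  unfolding torus_distributions_def
proof (intro CollectI conjI ballI allI impI)
  fix \<phi> \<psi> :: "'a \<Rightarrow> complex" assume "\<phi> \<in> torus_smooth" "\<psi> \<in> torus_smooth"
  then show "dser a (\<lambda>x. \<phi> x + \<psi> x) = dser a \<phi> + dser a \<psi>"
    by (simp add: dser_def torus_smooth_add tcoef_add distrib_left infsum_add dser_summable a)
next
  fix c and \<phi> :: "'a \<Rightarrow> complex" assume "\<phi> \<in> torus_smooth"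
  then show "dser a (\<lambda>x. c * \<phi> x) = c * dser a \<phi>"
    by (simp add: dser_def torus_smooth_cmult tcoef_cmult mult.left_commute infsum_cmult_right')
next
  obtain A l where A: "A \<ge> 0" "\<And>z. z \<in> intlat \<Longrightarrow> cmod (a z) \<le> A * (1 + norm z) ^ l"
    using polybdd_bound[OF a] by blast
  \<comment> \<open>Of these powers, \<open>l\<close> absorb the growth of \<open>a\<close> and
    \<open>2 * DIM('a)\<close> make the lattice sum converge.\<close>
  let ?k = "l + 2 * DIM('a)"
  let ?w = "\<lambda>z::'a. 1 / (1 + norm z) ^ (2 * DIM('a))"
  let ?V = "(2 * pi) ^ DIM('a) * (1 + DIM('a)) ^ ?k"
  have "cmod (dser a \<phi>) \<le> (A * ?V * infsum ?w intlat) * snorm ?k \<phi>" if \<phi>: "\<phi> \<in> torus_smooth" for \<phi>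
  proof -
    have "cmod (dser a \<phi>) \<le> (\<Sum>\<^sub>\<infinity>z\<in>intlat. (A * ?V * snorm ?k \<phi>) * ?w z)"
    proof (rule norm_infsum_le)
      show "((\<lambda>z. a z * tcoef \<phi> z) has_sum dser a \<phi>) intlat"
        unfolding dser_def using \<phi> by (simp add: dser_summable a)
      show "((\<lambda>z. (A * ?V * snorm ?k \<phi>) * ?w z) has_sum (\<Sum>\<^sub>\<infinity>z\<in>intlat. (A * ?V * snorm ?k \<phi>) * ?w z)) intlat"
        by (intro has_sum_infsum summable_on_cmult_right lattice_summable)
      fix z :: 'a assume z: "z \<in> intlat"
      have pos: "(1 + norm z) ^ (2 * DIM('a)) > 0" by (simp add: add_pos_nonneg)
      have nz: "1 + norm z \<noteq> 0" using norm_ge_zero[of z] by linarith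
      have "cmod (a z * tcoef \<phi> z) \<le> A * (1 + norm z) ^ l * cmod (tcoef \<phi> z)"
        unfolding norm_mult by (intro mult_right_mono A z) simp
      also have "\<dots> = A * (cmod (tcoef \<phi> z) * (1 + norm z) ^ ?k) * ?w z"
        using nz by (simp add: power_add field_simps)
      also have "\<dots> \<le> A * (?V * snorm ?k \<phi>) * ?w z"
        using pos by (intro mult_right_mono mult_left_mono tcoef_bound \<phi> z A) auto
      finally show "cmod (a z * tcoef \<phi> z) \<le> A * ?V * snorm ?k \<phi> * ?w z" by (simp add: mult.assoc)
    qed
    also have "\<dots> = (A * ?V * infsum ?w intlat) * snorm ?k \<phi>"
      unfolding infsum_cmult_right' by (simp only: mult_ac)
    finally show ?thesis .
  qed
  then show "\<exists>C k. \<forall>\<phi>\<in>torus_smooth. cmod (dser a \<phi>) \<le>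
      C * (\<Sum>bs | set bs \<subseteq> Basis \<and> length bs \<le> k. SUP x. cmod (foldr pdv bs \<phi> x))"
    unfolding snorm_def by blast
qed (simp add: dser_def)

lemma dist_of_fun_fser:
  assumes "rapid c"
  shows "dist_of_fun (fser c) = dser c"
proof
  fix \<phi> :: "'a \<Rightarrow> complex"
  show "dist_of_fun (fser c) \<phi> = dser c \<phi>"
  proof (cases "\<phi> \<in> torus_smooth")
    case True
    then have "((\<lambda>z. c z * tcoef \<phi> z) has_sum torus_integral (\<lambda>x. \<phi> x * fser c x)) intlat"
      by (intro has_sum_torus_integral_fser assms torus_smoothD)
    then show ?thesis using True by (simp add: dist_of_fun_def dser_def infsumI mult.commute)
  qed (simp add: dist_of_fun_def dser_def)
qed

lemma dser_fser:
  fixes a :: "'a::euclidean_space \<Rightarrow> complex"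
  assumes "rapid c"
  shows "dser a (fser c) = of_real ((2 * pi) ^ DIM('a)) * (\<Sum>\<^sub>\<infinity>z\<in>intlat. a z * c (- z))"
proof -
  have "dser a (fser c) = (\<Sum>\<^sub>\<infinity>z\<in>intlat. of_real ((2 * pi) ^ DIM('a)) * (a z * c (- z)))"
    unfolding dser_def using fser_torus_smooth[OF assms]
    by (simp add: tcoef_fser[OF assms] mult.left_commute cong: infsum_cong)
  then show ?thesis by (simp only: infsum_cmult_right')
qed

text \<open>Orthogonality again. With it, an equation between such distributions can be read off
  coefficient by coefficient.\<close>

lemma dser_chr:
  assumes "(w::'a::euclidean_space) \<in> intlat"
  shows "dser a (chr (- w)) = of_real ((2 * pi) ^ DIM('a)) * a w"
proof -
  have "(\<Sum>\<^sub>\<infinity>z\<in>intlat. a z * tcoef (chr (- w)) z) = a w * tcoef (chr (- w)) w"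
    by (rule infsumI, rule has_sum_finite_neutralI[where B="{w}"]) (use assms in \<open>auto simp: tcoef_chr\<close>)
  then show ?thesis using assms by (simp add: dser_def chr_torus_smooth tcoef_chr)
qed

lemma dist_pdv_dser:
  assumes "b \<in> Basis"
  shows "dist_pdv b (dser a) = dser (\<lambda>z. \<i> * of_real (z \<bullet> b) * a z)"
proof
  fix \<phi> :: "'a \<Rightarrow> complex"
  show "dist_pdv b (dser a) \<phi> = dser (\<lambda>z. \<i> * of_real (z \<bullet> b) * a z) \<phi>"
  proof (cases "\<phi> \<in> torus_smooth")
    case True
    have "dist_pdv b (dser a) \<phi> = (\<Sum>\<^sub>\<infinity>z\<in>intlat. - (a z * tcoef (pdv b \<phi>) z))"
      using True assms by (simp add: dist_pdv_def dser_def torus_smooth_pdv infsum_uminus)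
    also have "\<dots> = dser (\<lambda>z. \<i> * of_real (z \<bullet> b) * a z) \<phi>"
      unfolding dser_def using True assms by (auto simp: tcoef_pdv mult_ac intro!: infsum_cong)
    finally show ?thesis .
  qed (simp add: dist_pdv_def dser_def)
qed

section \<open>Partial Fourier series and pseudo-differential operators\<close>

definition unlat :: "real^'m \<Rightarrow> int^'m" where
  "unlat x = (\<chi> k. \<lfloor>x $ k\<rfloor>)"

lemma unlat_lat [simp]: "unlat (lat \<xi>) = \<xi>"
  by (simp add: unlat_def lat_def vec_eq_iff)

lemma intlat_vec_iff: "(z::real^'m::finite) \<in> intlat \<longleftrightarrow> (\<forall>i. z $ i \<in> \<int>)"
  by (auto simp: intlat_def Basis_vec_def inner_axis)

lemma lat_intlat [simp]: "lat \<xi> \<in> intlat"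
  by (simp add: intlat_vec_iff lat_def)

lemma lat_unlat [simp]: "z \<in> intlat \<Longrightarrow> lat (unlat z) = z"
  by (auto simp: intlat_vec_iff lat_def unlat_def vec_eq_iff elim!: Ints_cases)

lemma intlat_vec: "intlat = range (lat :: int^'m::finite \<Rightarrow> _)"
  by (auto intro: lat_unlat[symmetric])

lemma inj_lat: "inj lat"
  by (metis injI unlat_lat)

lemma lat_eq_0_iff [simp]: "lat \<xi> = 0 \<longleftrightarrow> \<xi> = 0"
  by (auto simp: lat_def vec_eq_iff)

lemma intlat_prod: "(intlat :: ('a::euclidean_space \<times> 'b::euclidean_space) set) = intlat \<times> intlat"
  by (auto simp: intlat_def Basis_prod_def ball_Un)

lemma One_prod: "(One :: 'a::euclidean_space \<times> 'b::euclidean_space) = (One, One)"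
proof -
  have "(\<Sum>b\<in>(\<lambda>u. (u, 0::'b)) ` (Basis::'a set). b) = (One, 0)"
    by (subst sum.reindex) (auto simp: inj_on_def sum_prod)
  moreover have "(\<Sum>b\<in>(\<lambda>v. (0::'a, v)) ` (Basis::'b set). b) = (0, One)"
    by (subst sum.reindex) (auto simp: inj_on_def sum_prod)
  ultimately show ?thesis
    unfolding Basis_prod_def by (subst sum.union_disjoint) auto
qed

lemma chr_Pair: "chr (\<eta>, w) (t, x) = chr \<eta> t * chr w x"
  by (simp add: chr_def cis_mult)

lemma cis_lat: "cis (x \<bullet> lat \<xi>) = chr (lat \<xi>) x" "cis (- (x \<bullet> lat \<xi>)) = chr (- lat \<xi>) x"
  by (simp_all add: chr_def inner_commute)

section \<open>Partial series in one group of variables\<close>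

lemma torus_integral_Pair:
  fixes f :: "'a::euclidean_space \<times> 'b::euclidean_space \<Rightarrow> complex"
  assumes "continuous_on UNIV f"
  shows "torus_integral f = torus_integral (\<lambda>t. torus_integral (\<lambda>x. f (t, x)))"
  unfolding torus_integral_def One_prod scaleR_Pair zero_prod_def
  by (rule integral_prod_continuous) (rule continuous_on_subset[OF assms subset_UNIV])

lemma norm_le_Pair: "norm \<eta> \<le> norm (\<eta>, w)" "norm w \<le> norm (\<eta>, w)"
  by (simp_all add: norm_Pair)

lemma rapid_slice:
  fixes c :: "'a::euclidean_space \<times> 'b::euclidean_space \<Rightarrow> complex"
  assumes c: "rapid c" and w: "w \<in> intlat"
  shows "rapid (\<lambda>\<eta>. c (\<eta>, w))"
  unfolding rapid_def
proof
  fix k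
  obtain C where C: "\<And>z. z \<in> intlat \<Longrightarrow> cmod (c z) * (1 + norm z) ^ k \<le> C"
    using rapid_bound[OF c] by metis
  have "cmod (c (\<eta>, w)) * (1 + norm \<eta>) ^ k \<le> C" if "\<eta> \<in> intlat" for \<eta>
  proof -
    have "cmod (c (\<eta>, w)) * (1 + norm \<eta>) ^ k \<le> cmod (c (\<eta>, w)) * (1 + norm (\<eta>, w)) ^ k"
      by (intro mult_left_mono power_mono add_mono norm_le_Pair) auto
    also have "\<dots> \<le> C" using that w by (intro C) (simp add: intlat_prod)
    finally show ?thesis .
  qed
  then show "\<exists>C. \<forall>\<eta>\<in>intlat. cmod (c (\<eta>, w)) * (1 + norm \<eta>) ^ k \<le> C" by blast
qed

text \<open>Decay of order \<open>k + 2 * DIM('a)\<close> in the pair is divided: the second part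
  sums over \<open>\<eta>\<close>, the first remains as decay in \<open>w\<close>.\<close>

lemma rapid_fser_slice:
  fixes c :: "'a::euclidean_space \<times> 'b::euclidean_space \<Rightarrow> complex"
  assumes c: "rapid c"
  shows "rapid (\<lambda>w. fser (\<lambda>\<eta>. c (\<eta>, w)) t)"
  unfolding rapid_def
proof
  fix k
  let ?d = "2 * DIM('a)"
  let ?g = "\<lambda>\<eta>::'a. 1 / (1 + norm \<eta>) ^ ?d"
  obtain C where C: "\<And>z. z \<in> intlat \<Longrightarrow> cmod (c z) * (1 + norm z) ^ (k + ?d) \<le> C"
    using rapid_bound[OF c] by metis
  have "cmod (fser (\<lambda>\<eta>. c (\<eta>, w)) t) * (1 + norm w) ^ k \<le> infsum (\<lambda>\<eta>. C * ?g \<eta>) intlat"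
    if w: "w \<in> intlat" for w
  proof -
    have "cmod (fser (\<lambda>\<eta>. of_real ((1 + norm w) ^ k) * c (\<eta>, w)) t) = (1 + norm w) ^ k * cmod (fser (\<lambda>\<eta>. c (\<eta>, w)) t)"
      unfolding fser_cmult norm_mult norm_of_real by simp
    moreover have "cmod (fser (\<lambda>\<eta>. of_real ((1 + norm w) ^ k) * c (\<eta>, w)) t) \<le> infsum (\<lambda>\<eta>. C * ?g \<eta>) intlat"
    proof (rule norm_fser_le)
      show "(\<lambda>\<eta>. C * ?g \<eta>) summable_on intlat"
        by (intro summable_on_cmult_right lattice_summable)
      fix \<eta> :: 'a assume \<eta>: "\<eta> \<in> intlat"
      have pos: "(1 + norm \<eta>) ^ ?d > 0" by (simp add: add_pos_nonneg)
      have "cmod (c (\<eta>, w)) * ((1 + norm w) ^ k * (1 + norm \<eta>) ^ ?d)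
          \<le> cmod (c (\<eta>, w)) * ((1 + norm (\<eta>, w)) ^ k * (1 + norm (\<eta>, w)) ^ ?d)"
        by (intro mult_left_mono mult_mono power_mono add_mono norm_le_Pair) auto
      also have "\<dots> \<le> C"
        using C[of "(\<eta>, w)"] \<eta> w by (simp add: intlat_prod power_add)
      finally have "cmod (c (\<eta>, w)) * (1 + norm w) ^ k * (1 + norm \<eta>) ^ ?d \<le> C"
        by (simp add: mult.assoc)
      then have "cmod (c (\<eta>, w)) * (1 + norm w) ^ k \<le> C / (1 + norm \<eta>) ^ ?d"
        using pos by (simp add: pos_le_divide_eq)
      then show "cmod (of_real ((1 + norm w) ^ k) * c (\<eta>, w)) \<le> C * ?g \<eta>"
        by (simp add: norm_mult mult.commute del: of_real_power of_real_add)
    qed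
    ultimately show ?thesis
      by (simp add: mult.commute)
  qed
  then show "\<exists>C. \<forall>w\<in>intlat. cmod (fser (\<lambda>\<eta>. c (\<eta>, w)) t) * (1 + norm w) ^ k \<le> C" by blast
qed

lemma infsum_intlat_prod:
  fixes f :: "'a::euclidean_space \<times> 'b::euclidean_space \<Rightarrow> complex"
  assumes "f summable_on intlat"
  shows "infsum f intlat = (\<Sum>\<^sub>\<infinity>w\<in>intlat. \<Sum>\<^sub>\<infinity>\<eta>\<in>intlat. f (\<eta>, w))"
proof -
  have "(\<lambda>(\<eta>, w). f (\<eta>, w)) summable_on (intlat \<times> intlat)"
    using assms by (simp add: intlat_prod)
  from infsum_swap_banach[OF this] infsum_Sigma'_banach[OF this]
  show ?thesis by (simp add: intlat_prod)
qed

lemma fser_Pair: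
  fixes c :: "'a::euclidean_space \<times> 'b::euclidean_space \<Rightarrow> complex"
  assumes "rapid c"
  shows "fser c (t, x) = fser (\<lambda>w. fser (\<lambda>\<eta>. c (\<eta>, w)) t) x"
  unfolding fser_def infsum_intlat_prod[OF fser_summable[OF assms]] infsum_cmult_left'[symmetric]
  by (simp add: chr_Pair mult.assoc)

lemma fser_section:
  fixes c :: "'a::euclidean_space \<times> 'b::euclidean_space \<Rightarrow> complex"
  assumes "rapid c" "w \<in> intlat"
  shows "torus_integral (\<lambda>x. chr w x * fser c (t, x))
    = of_real ((2 * pi) ^ DIM('b)) * fser (\<lambda>\<eta>. c (\<eta>, - w)) t"
  using tcoef_fser[OF rapid_fser_slice[OF assms(1)] assms(2), of t]
  by (simp add: fser_Pair[OF assms(1)] tcoef_def)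

text \<open>Taking a partial coefficient and multiplying the character back projects the series onto
  the frequencies with second component \<open>- w\<close>, up to the volume factor. With
  \<open>w = lat \<xi>\<close> this is the test function to which \<open>fourier_dist\<close>
  applies the distribution inside \<open>pseudo_diff\<close>.\<close>

lemma fser_section_lift:
  fixes c :: "'a::euclidean_space \<times> 'b::euclidean_space \<Rightarrow> complex"
  assumes "rapid c" "w \<in> intlat"
  shows "chr (- w) x * torus_integral (\<lambda>y. chr w y * fser c (t, y))
    = fser (\<lambda>z. of_real ((2 * pi) ^ DIM('b)) * (if snd z = - w then c z else 0)) (t, x)"
proof -
  have r: "rapid (\<lambda>z. if snd z = - w then c z else 0)"
    by (rule rapid_mono[OF assms(1)]) auto
  have "fser (\<lambda>z. if snd z = - w then c z else 0) (t, x)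
      = fser (\<lambda>w'. if w' = - w then fser (\<lambda>\<eta>. c (\<eta>, - w)) t else 0) x"
    unfolding fser_Pair[OF r] by (intro arg_cong2[where f=fser] ext) auto
  also have "\<dots> = fser (\<lambda>\<eta>. c (\<eta>, - w)) t * chr (- w) x"
    using assms(2) by (simp add: fser_delta)
  finally show ?thesis
    unfolding fser_section[OF assms] fser_cmult by simp
qed

text \<open>The projected test function retains only the frequencies that pair with
  \<open>(\<eta>, lat \<xi>)\<close>. The volume factors cancel: \<open>?N\<close> arises from the
  projection and is divided out by \<open>fourier_dist\<close>, while \<open>?M\<close> relates
  \<open>fcoef\<close> to \<open>tcoef\<close>.\<close>

lemma fourier_dist_dser:
  fixes a :: "(real^'n::finite) \<times> (real^'m::finite) \<Rightarrow> complex"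
  assumes \<phi>: "\<phi> \<in> torus_smooth"
  shows "fourier_dist (dser a) \<xi> (\<lambda>t. torus_integral (\<lambda>x. cis (x \<bullet> lat \<xi>) * \<phi> (t, x)))
    = (\<Sum>\<^sub>\<infinity>\<eta>\<in>intlat. a (\<eta>, lat \<xi>) * tcoef \<phi> (\<eta>, lat \<xi>))"
proof -
  let ?w = "lat \<xi>"
  let ?c = "fcoef \<phi>"
  let ?N = "of_real ((2 * pi) ^ CARD('m)) :: complex"
  let ?M = "of_real ((2 * pi) ^ DIM((real^'n) \<times> (real^'m))) :: complex"
  note c = rapid_fcoef[OF \<phi>]
  have \<phi>c: "\<phi> = fser ?c" by (simp add: fser_fcoef \<phi>)
  have "(\<lambda>t. torus_integral (\<lambda>x. cis (x \<bullet> ?w) * \<phi> (t, x))) = (\<lambda>t. ?N * fser (\<lambda>\<eta>. ?c (\<eta>, - ?w)) t)"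
    unfolding cis_lat using fser_section[OF c lat_intlat, of \<xi>] by (simp add: fser_fcoef \<phi>)
  then have smooth: "(\<lambda>t. torus_integral (\<lambda>x. cis (x \<bullet> ?w) * \<phi> (t, x))) \<in> torus_smooth"
    by (simp only:) (intro torus_smooth_cmult fser_torus_smooth rapid_slice c, simp)
  define c' where "c' = (\<lambda>z. ?N * (if snd z = - ?w then ?c z else 0))"
  have c': "rapid c'"
    unfolding c'_def by (intro rapid_cmult rapid_mono[OF c]) auto
  have lift: "(\<lambda>(t, x). cis (- (x \<bullet> ?w)) * torus_integral (\<lambda>x. cis (x \<bullet> ?w) * \<phi> (t, x))) = fser c'"
    unfolding cis_lat c'_def using fser_section_lift[OF c lat_intlat, of \<xi>] by (auto simp: fser_fcoef \<phi>)
  have "fourier_dist (dser a) \<xi> (\<lambda>t. torus_integral (\<lambda>x. cis (x \<bullet> ?w) * \<phi> (t, x)))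
      = dser a (fser c') / ?N"
    unfolding fourier_dist_def using smooth lift by simp
  also have "\<dots> = ?M * (\<Sum>\<^sub>\<infinity>z\<in>intlat. a z * c' (- z)) / ?N"
    unfolding dser_fser[OF c'] by simp
  also have "(\<Sum>\<^sub>\<infinity>z\<in>intlat. a z * c' (- z)) = (\<Sum>\<^sub>\<infinity>z\<in>intlat. (?N / ?M) * (if snd z = ?w then a z * tcoef \<phi> z else 0))"
    by (rule infsum_cong) (auto simp: c'_def fcoef_def)
  also have "\<dots> = (?N / ?M) * (\<Sum>\<^sub>\<infinity>z\<in>intlat. if snd z = ?w then a z * tcoef \<phi> z else 0)"
    by (rule infsum_cmult_right')
  also have "(\<Sum>\<^sub>\<infinity>z\<in>intlat. if snd z = ?w then a z * tcoef \<phi> z else 0)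
      = (\<Sum>\<^sub>\<infinity>z\<in>(\<lambda>\<eta>. (\<eta>, ?w)) ` intlat. a z * tcoef \<phi> z)"
    by (rule infsum_cong_neutral) (auto simp: intlat_prod)
  also have "\<dots> = (\<Sum>\<^sub>\<infinity>\<eta>\<in>intlat. a (\<eta>, ?w) * tcoef \<phi> (\<eta>, ?w))"
    by (subst infsum_reindex) (auto simp: inj_on_def o_def)
  finally show ?thesis by simp
qed

text \<open>The defining sum over \<open>\<xi>\<close> of sums over \<open>\<eta>\<close> is one
  summable series over the product lattice, with each term multiplied by the symbol.\<close>

lemma pseudo_diff_dser:
  fixes a :: "(real^'n::finite) \<times> (real^'m::finite) \<Rightarrow> complex"
  assumes a: "polybdd a" and p: "polybdd (\<lambda>z :: (real^'n) \<times> (real^'m). p (unlat (snd z)))"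
  shows "pseudo_diff p (dser a) = dser (\<lambda>z. p (unlat (snd z)) * a z)"
proof
  fix \<phi> :: "(real^'n) \<times> (real^'m) \<Rightarrow> complex"
  show "pseudo_diff p (dser a) \<phi> = dser (\<lambda>z. p (unlat (snd z)) * a z) \<phi>"
  proof (cases "\<phi> \<in> torus_smooth")
    case True
    let ?f = "\<lambda>z. p (unlat (snd z)) * a z * tcoef \<phi> z"
    have "pseudo_diff p (dser a) \<phi> = (\<Sum>\<^sub>\<infinity>\<xi>\<in>UNIV. p \<xi> * (\<Sum>\<^sub>\<infinity>\<eta>\<in>intlat. a (\<eta>, lat \<xi>) * tcoef \<phi> (\<eta>, lat \<xi>)))"
      unfolding pseudo_diff_def using True by (simp add: fourier_dist_dser)
    also have "\<dots> = infsum ((\<lambda>w. \<Sum>\<^sub>\<infinity>\<eta>\<in>intlat. ?f (\<eta>, w)) \<circ> lat) UNIV"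
      by (rule infsum_cong) (simp add: infsum_cmult_right'[symmetric] mult.assoc)
    also have "\<dots> = (\<Sum>\<^sub>\<infinity>w\<in>intlat. \<Sum>\<^sub>\<infinity>\<eta>\<in>intlat. ?f (\<eta>, w))"
      unfolding intlat_vec by (rule infsum_reindex[symmetric, OF inj_lat])
    also have "\<dots> = infsum ?f intlat"
      by (rule infsum_intlat_prod[symmetric]) (intro dser_summable polybdd_mult a p True)
    finally show ?thesis using True by (simp add: dser_def)
  qed (simp add: pseudo_diff_def dser_def)
qed

lemma polybdd_symbol:
  fixes p :: "int^'m::{finite,linorder} \<Rightarrow> complex"
  assumes "toroidal_symbol m p"
  shows "polybdd (\<lambda>z :: (real^'n::finite) \<times> (real^'m::{finite,linorder}). p (unlat (snd z)))"
proof -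
  have "fwd_diffs (\<chi> i. 0) p = p"
  proof -
    have "foldr (\<lambda>k. fwd_diff k ^^ ((\<chi> i. 0) $ k)) xs p = p" for xs
      by (induction xs) auto
    then show ?thesis by (simp add: fwd_diffs_def)
  qed
  then obtain C where C: "C > 0" "\<And>\<xi>. cmod (p \<xi>) \<le> C * japanese_bracket \<xi> powr m"
    using assms[unfolded toroidal_symbol_def, rule_format, of "\<chi> i. 0"] by auto
  \<comment> \<open>A natural exponent at least \<open>m\<close>, also for negative
    \<open>m\<close>; the bracket is at least 1, so raising the exponent only increases the
    bound.\<close>
  define k where "k = nat \<lceil>\<bar>m\<bar>\<rceil>"
  have mk: "m \<le> real k" unfolding k_def by linarith
  have "cmod (p (unlat (snd z))) \<le> C * (1 + norm z) ^ k" if z: "z \<in> intlat" for z :: "(real^'n) \<times> (real^'m::{finite,linorder})"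
  proof -
    let ?\<xi> = "unlat (snd z)"
    have s: "lat ?\<xi> = snd z" using z by (cases z) (simp add: intlat_prod)
    have b1: "japanese_bracket ?\<xi> \<ge> 1" by (simp add: japanese_bracket_def)
    have "japanese_bracket ?\<xi> \<le> 1 + norm (snd z)"
      unfolding japanese_bracket_def s by (rule real_le_lsqrt) (simp_all add: power2_sum)
    also have "\<dots> \<le> 1 + norm z" using norm_le_Pair(2)[of "snd z" "fst z"] by simp
    finally have b2: "japanese_bracket ?\<xi> \<le> 1 + norm z" .
    have "japanese_bracket ?\<xi> powr m \<le> japanese_bracket ?\<xi> powr real k"
      by (rule powr_mono[OF mk b1])
    also have "\<dots> = japanese_bracket ?\<xi> ^ k" using b1 by (simp add: powr_realpow)
    also have "\<dots> \<le> (1 + norm z) ^ k" using b1 b2 by (intro power_mono) auto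
    finally have "C * japanese_bracket ?\<xi> powr m \<le> C * (1 + norm z) ^ k"
      using C(1) by (intro mult_left_mono) auto
    then show ?thesis using C(2)[of ?\<xi>] by linarith
  qed
  then show ?thesis unfolding polybdd_def by blast
qed

text \<open>The components of \<open>symbol_L\<close>, carried over to points of the real lattice on
  which the Fourier series are indexed.\<close>

definition symb :: "('n::finite \<Rightarrow> int^'m::finite \<Rightarrow> complex) \<Rightarrow> 'n \<Rightarrow> (real^'n) \<times> (real^'m) \<Rightarrow> complex" where
  "symb p j z = \<i> * (of_real (fst z $ j) + p j (unlat (snd z)))"

lemma axis_Basis: "(axis j 1, 0) \<in> (Basis :: ((real^'n::finite) \<times> (real^'m::finite)) set)"
  by (auto simp: Basis_prod_def Basis_vec_def)

lemma inner_axis_Pair: "(z :: (real^'n::finite) \<times> (real^'m::finite)) \<bullet> (axis j 1, 0) = fst z $ j"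
  by (cases z) (simp add: inner_axis)

lemma polybdd_symb:
  assumes "\<And>j. polybdd (\<lambda>z :: (real^'n::finite) \<times> (real^'m::finite). p j (unlat (snd z)))"
  shows "polybdd (symb p j :: (real^'n) \<times> (real^'m) \<Rightarrow> _)"
proof -
  have "polybdd (\<lambda>z :: (real^'n) \<times> (real^'m). of_real (fst z $ j) :: complex)"
    using polybdd_inner[of "(axis j 1, 0) :: (real^'n) \<times> (real^'m)"] by (simp add: inner_axis_Pair)
  then show ?thesis unfolding symb_def
    by (intro polybdd_mult polybdd_add polybdd_const assms)
qed

lemma op_L_dser:
  fixes p :: "'n::{finite,linorder} \<Rightarrow> int^'m::finite \<Rightarrow> complex"
  assumes p: "\<And>j. polybdd (\<lambda>z :: (real^'n::{finite,linorder}) \<times> (real^'m). p j (unlat (snd z)))"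
    and a: "\<And>K. card K = r \<Longrightarrow> polybdd (a K)" and u: "\<And>K. card K = r \<Longrightarrow> u K = dser (a K)"
  shows "op_L p r u J = dser (wedge_sum r (\<lambda>j K z. symb p j z * a K z) J)"
proof
  fix \<phi> :: "(real^'n::{finite,linorder}) \<times> (real^'m) \<Rightarrow> complex"
  have trm: "dist_pdv (axis j 1, 0) (u K) \<phi> + \<i> * pseudo_diff (p j) (u K) \<phi> = dser (\<lambda>z. symb p j z * a K z) \<phi>"
    if K: "card K = r" for j K
  proof -
    have "polybdd (\<lambda>z. \<i> * of_real (z \<bullet> (axis j 1, 0)) * a K z)"
      by (intro polybdd_mult polybdd_const polybdd_inner a K)
    moreover have "polybdd (\<lambda>z. \<i> * (p j (unlat (snd z)) * a K z))"
      by (intro polybdd_mult polybdd_const p a K)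
    ultimately have "dser (\<lambda>z. \<i> * of_real (z \<bullet> (axis j 1, 0)) * a K z + \<i> * (p j (unlat (snd z)) * a K z)) \<phi>
        = dser (\<lambda>z. \<i> * of_real (z \<bullet> (axis j 1, 0)) * a K z) \<phi> + \<i> * dser (\<lambda>z. p j (unlat (snd z)) * a K z) \<phi>"
      by (simp only: dser_add dser_cmult)
    then show ?thesis
      unfolding u[OF K] dist_pdv_dser[OF axis_Basis] pseudo_diff_dser[OF a[OF K] p]
      by (simp add: inner_axis_Pair symb_def algebra_simps)
  qed
  have pb: "polybdd (\<lambda>z. wedge_coeff j K J * (symb p j z * a K z))" if "card K = r" for j K
    by (intro polybdd_mult polybdd_const polybdd_symb p a that)
  have "op_L p r u J \<phi> = (\<Sum>j\<in>UNIV. \<Sum>K | card K = r. wedge_coeff j K J *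
      (dist_pdv (axis j 1, 0) (u K) \<phi> + \<i> * pseudo_diff (p j) (u K) \<phi>))"
    unfolding op_L_def wedge_sum_def by (simp only: sum.distrib distrib_left)
  also have "\<dots> = (\<Sum>j\<in>UNIV. \<Sum>K | card K = r. dser (\<lambda>z. wedge_coeff j K J * (symb p j z * a K z)) \<phi>)"
    by (intro sum.cong refl) (simp add: trm dser_cmult)
  also have "\<dots> = (\<Sum>j\<in>UNIV. dser (\<lambda>z. \<Sum>K | card K = r. wedge_coeff j K J * (symb p j z * a K z)) \<phi>)"
    by (intro sum.cong refl dser_sum[symmetric] pb) simp
  also have "\<dots> = dser (\<lambda>z. \<Sum>j\<in>UNIV. \<Sum>K | card K = r. wedge_coeff j K J * (symb p j z * a K z)) \<phi>"
    by (intro dser_sum[symmetric] polybdd_sum pb) simp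
  also have "(\<lambda>z. \<Sum>j\<in>UNIV. \<Sum>K | card K = r. wedge_coeff j K J * (symb p j z * a K z))
      = wedge_sum r (\<lambda>j K z. symb p j z * a K z) J"
    by (simp add: wedge_sum_def fun_eq_iff)
  finally show "op_L p r u J \<phi> = dser (wedge_sum r (\<lambda>j K z. symb p j z * a K z) J) \<phi>" .
qed

lemma torus_distributionsD:
  assumes "u \<in> torus_distributions" "\<phi> \<in> torus_smooth"
  shows "u (\<lambda>x. c * \<phi> x) = c * u \<phi>"
  using assms by (simp add: torus_distributions_def)

text \<open>The character \<open>chr (- z)\<close> is an eigenfunction of each derivative, and by
  orthogonality only the frequency \<open>\<xi> = unlat w\<close> survives in
  \<open>pseudo_diff\<close>. Thus the multiplication by the symbol is visible for arbitrary
  distributions.\<close>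

lemma op_L_chr:
  fixes p :: "'n::{finite,linorder} \<Rightarrow> int^'m::finite \<Rightarrow> complex"
  assumes u: "\<And>K. card K = r \<Longrightarrow> u K \<in> torus_distributions" and z: "z \<in> intlat"
  shows "op_L p r u J (chr (- z)) = wedge_sum r (\<lambda>j K z. symb p j z * u K (chr (- z))) J z"
proof -
  obtain \<eta> w where zw: "z = (\<eta>, w)" by (cases z)
  have I: "\<eta> \<in> intlat" "w \<in> intlat" using z by (auto simp: zw intlat_prod)
  let ?N = "of_real ((2 * pi) ^ CARD('m)) :: complex"
  have smooth: "chr (- z) \<in> torus_smooth" using z by (simp add: chr_torus_smooth)
  have trm: "dist_pdv (axis j 1, 0) (u K) (chr (- z)) + \<i> * pseudo_diff (p j) (u K) (chr (- z))
      = symb p j z * u K (chr (- z))" if K: "card K = r" for j K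
  proof -
    note hom = torus_distributionsD[OF u[OF K]]
    have "u K (pdv (axis j 1, 0) (chr (- z))) = \<i> * of_real ((- z) \<bullet> (axis j 1, 0)) * u K (chr (- z))"
      unfolding pdv_chr by (rule hom[OF smooth])
    then have 1: "dist_pdv (axis j 1, 0) (u K) (chr (- z)) = \<i> * of_real (fst z $ j) * u K (chr (- z))"
      using smooth by (simp add: dist_pdv_def inner_axis_Pair)
    have "fourier_dist (u K) \<xi> (\<lambda>t. torus_integral (\<lambda>x. cis (x \<bullet> lat \<xi>) * chr (- z) (t, x)))
        = (if \<xi> = unlat w then u K (chr (- z)) else 0)" for \<xi>
    proof -
      have "torus_integral (\<lambda>x. cis (x \<bullet> lat \<xi>) * chr (- z) (t, x)) = (if w = lat \<xi> then ?N else 0) * chr (- \<eta>) t" for t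
      proof -
        have "torus_integral (\<lambda>x. cis (x \<bullet> lat \<xi>) * chr (- z) (t, x)) = torus_integral (\<lambda>x. chr (- \<eta>) t * (chr (lat \<xi>) x * chr (- w) x))"
          by (simp add: zw cis_lat chr_Pair mult_ac)
        also have "\<dots> = chr (- \<eta>) t * tcoef (chr (- w)) (lat \<xi>)"
          by (simp add: torus_integral_cmult tcoef_def)
        finally show ?thesis using I by (simp add: tcoef_chr)
      qed
      then have e: "(\<lambda>t. torus_integral (\<lambda>x. cis (x \<bullet> lat \<xi>) * chr (- z) (t, x))) = (\<lambda>t. (if w = lat \<xi> then ?N else 0) * chr (- \<eta>) t)"
        by blast
      have s: "(\<lambda>t. (if w = lat \<xi> then ?N else 0) * chr (- \<eta>) t) \<in> torus_smooth"
        using I by (intro torus_smooth_cmult chr_torus_smooth) simp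
      have l: "(\<lambda>(t, x). cis (- (x \<bullet> lat \<xi>)) * ((if w = lat \<xi> then ?N else 0) * chr (- \<eta>) t))
          = (\<lambda>y. (if w = lat \<xi> then ?N else 0) * chr (- z) y)"
        by (auto simp: zw cis_lat chr_Pair)
      have "w = lat \<xi> \<longleftrightarrow> \<xi> = unlat w" using I(2) by auto
      then show ?thesis unfolding e fourier_dist_def l hom[OF smooth] using s by auto
    qed
    then have "pseudo_diff (p j) (u K) (chr (- z)) = (\<Sum>\<^sub>\<infinity>\<xi>\<in>UNIV. p j \<xi> * (if \<xi> = unlat w then u K (chr (- z)) else 0))"
      unfolding pseudo_diff_def using smooth by simp
    also have "\<dots> = p j (unlat w) * u K (chr (- z))"
      by (rule infsumI, rule has_sum_finite_neutralI[where B="{unlat w}"]) auto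
    finally show ?thesis unfolding 1 by (simp add: symb_def zw algebra_simps)
  qed
  have "op_L p r u J (chr (- z)) = (\<Sum>j\<in>UNIV. \<Sum>K | card K = r. wedge_coeff j K J *
      (dist_pdv (axis j 1, 0) (u K) (chr (- z)) + \<i> * pseudo_diff (p j) (u K) (chr (- z))))"
    unfolding op_L_def wedge_sum_def by (simp only: sum.distrib distrib_left)
  then show ?thesis unfolding wedge_sum_def by (simp add: trm)
qed

lemma foldr_pdv_chr:
  assumes "set bs \<subseteq> Basis"
  shows "\<exists>\<kappa>. cmod \<kappa> \<le> (1 + norm w) ^ length bs \<and> foldr pdv bs (chr w) = (\<lambda>x. \<kappa> * chr w x)"
  using assms
proof (induction bs)
  case Nil
  show ?case by (intro exI[of _ 1]) auto
next
  case (Cons b bs)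
  then obtain \<kappa> where \<kappa>: "cmod \<kappa> \<le> (1 + norm w) ^ length bs" "foldr pdv bs (chr w) = (\<lambda>x. \<kappa> * chr w x)"
    by auto
  have "foldr pdv (b # bs) (chr w) = (\<lambda>x. (\<kappa> * (\<i> * of_real (w \<bullet> b))) * chr w x)"
  proof
    fix x
    have "pdv b (\<lambda>x. \<kappa> * chr w x) x = \<kappa> * (\<i> * of_real (w \<bullet> b) * chr w x)"
      by (rule pdv_eqI[OF has_derivative_mult_right[OF chr_has_derivative]])
    then show "foldr pdv (b # bs) (chr w) x = (\<kappa> * (\<i> * of_real (w \<bullet> b))) * chr w x"
      by (simp add: \<kappa>(2) mult.assoc)
  qed
  moreover have "\<bar>w \<bullet> b\<bar> \<le> 1 + norm w"
    using Basis_le_norm[of b w] Cons.prems by simp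
  then have "cmod (\<kappa> * (\<i> * of_real (w \<bullet> b))) \<le> (1 + norm w) ^ length bs * (1 + norm w)"
    unfolding norm_mult by (intro mult_mono \<kappa>) auto
  ultimately show ?case by (intro exI[of _ "\<kappa> * (\<i> * of_real (w \<bullet> b))"]) (simp add: mult.commute)
qed

text \<open>The continuity bound is applied to characters: their derivatives up to order
  \<open>k\<close> are at most \<open>(1 + norm z) ^ k\<close>.\<close>

lemma polybdd_distribution:
  fixes u :: "'a::euclidean_space functional"
  assumes "u \<in> torus_distributions"
  shows "polybdd (\<lambda>z. u (chr (- z)))"
proof -
  obtain C k where C: "\<And>\<phi>. \<phi> \<in> torus_smooth \<Longrightarrow> cmod (u \<phi>) \<le> C * snorm k \<phi>"
  proof -
    have "\<exists>C k. \<forall>\<phi>\<in>torus_smooth. cmod (u \<phi>) \<le> C * snorm k \<phi>"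
      using assms unfolding torus_distributions_def snorm_def by (elim CollectE conjE)
    then show thesis using that by blast
  qed
  let ?M = "{bs. set bs \<subseteq> (Basis::'a set) \<and> length bs \<le> k}"
  have "cmod (u (chr (- z))) \<le> (\<bar>C\<bar> * card ?M) * (1 + norm z) ^ k" if z: "z \<in> intlat" for z
  proof -
    have s: "chr (- z) \<in> torus_smooth" using z by (simp add: chr_torus_smooth)
    have "snorm k (chr (- z)) \<le> (\<Sum>bs\<in>?M. (1 + norm z) ^ k)"
      unfolding snorm_def
    proof (rule sum_mono)
      fix bs assume bs: "bs \<in> ?M"
      then obtain \<kappa> where \<kappa>: "cmod \<kappa> \<le> (1 + norm (- z)) ^ length bs" "foldr pdv bs (chr (- z)) = (\<lambda>x. \<kappa> * chr (- z) x)"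
        using foldr_pdv_chr by blast
      have "(1 + norm z) ^ length bs \<le> (1 + norm z) ^ k"
        using bs by (intro power_increasing) auto
      then show "(SUP x. cmod (foldr pdv bs (chr (- z)) x)) \<le> (1 + norm z) ^ k"
        using \<kappa> by (simp add: norm_mult)
    qed
    then have *: "snorm k (chr (- z)) \<le> card ?M * (1 + norm z) ^ k" by simp
    have "0 \<le> snorm k (chr (- z))"
      unfolding snorm_def by (intro sum_nonneg SUP_torus(2) torus_smooth_foldr_pdv s) simp
    then have "C * snorm k (chr (- z)) \<le> \<bar>C\<bar> * snorm k (chr (- z))" by (intro mult_right_mono) auto
    also have "\<dots> \<le> \<bar>C\<bar> * (card ?M * (1 + norm z) ^ k)" by (intro mult_left_mono *) auto
    finally show ?thesis using C[OF s] by (simp add: mult.assoc)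
  qed
  then show ?thesis unfolding polybdd_def by blast
qed

section \<open>Exterior multiplication and integral forms\<close>

text \<open>For \<open>j \<notin> K\<close>, the sign that brings \<open>dt\<^sub>j\<close> into its
  increasing position when it is multiplied onto \<open>dt\<^sub>K\<close>.\<close>

definition esign :: "'n::linorder \<Rightarrow> 'n set \<Rightarrow> complex" where
  "esign j K = (- 1) ^ card {k\<in>K. k < j}"

lemma norm_esign [simp]: "cmod (esign j K) = 1"
  by (simp add: esign_def norm_power)

lemma esign_sq [simp]: "esign j K * esign j K = 1"
  by (simp add: esign_def flip: power_add mult_2)

lemma esign_insert:
  fixes L :: "'n::{finite,linorder} set"
  assumes "k \<notin> L"
  shows "esign j (insert k L) = (if k < j then - esign j L else esign j L)"
proof -
  have "{i \<in> insert k L. i < j} = (if k < j then insert k {i\<in>L. i < j} else {i\<in>L. i < j})" by auto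
  then show ?thesis using assms by (simp add: esign_def)
qed

text \<open>Anticommutativity of \<open>dt\<^sub>j\<close> and \<open>dt\<^sub>k\<close>: exactly
  one of \<open>k < j\<close> and \<open>j < k\<close> holds, so exactly one of the two insertions
  changes a sign.\<close>

lemma esign_swap:
  fixes L :: "'n::{finite,linorder} set"
  assumes "j \<noteq> k" "j \<notin> L" "k \<notin> L"
  shows "esign j (insert k L) * esign k L = - (esign k (insert j L) * esign j L)"
  using assms by (auto simp: esign_insert mult.commute)

text \<open>A pair \<open>(j, K)\<close> contributes to \<open>J\<close> only for
  \<open>j \<in> J\<close> and \<open>K = J - {j}\<close>, so the double sum collapses to an
  expansion along the elements of \<open>J\<close>.\<close>

lemma wedge_sum_eq:
  fixes J :: "'n::{finite,linorder} set"
  shows "wedge_sum r a J z = (if card J = Suc r then \<Sum>j\<in>J. esign j (J - {j}) * a j (J - {j}) z else 0)"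
proof -
  have inner: "(\<Sum>K | card K = r. wedge_coeff j K J * a j K z)
      = (if j \<in> J \<and> card J = Suc r then esign j (J - {j}) * a j (J - {j}) z else 0)" for j
  proof -
    have "(j \<notin> K \<and> J = insert j K) \<longleftrightarrow> (j \<in> J \<and> K = J - {j})" for K by auto
    then have "wedge_coeff j K J * a j K z = (if K = J - {j} then (if j \<in> J then esign j (J - {j}) * a j (J - {j}) z else 0) else 0)" for K
      by (auto simp: wedge_coeff_def esign_def)
    moreover have "card (J - {j}) = r \<longleftrightarrow> card J = Suc r" if "j \<in> J"
      using card_Suc_Diff1[OF _ that] by auto
    ultimately show ?thesis by (simp add: sum.delta)
  qed
  have "wedge_sum r a J z = (\<Sum>j\<in>UNIV. if j \<in> J \<and> card J = Suc r then esign j (J - {j}) * a j (J - {j}) z else 0)"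
    unfolding wedge_sum_def inner ..
  also have "\<dots> = (if card J = Suc r then \<Sum>j\<in>J. esign j (J - {j}) * a j (J - {j}) z else 0)"
    by (simp add: sum.inter_restrict[symmetric, of UNIV, simplified] if_distrib cong: if_cong)
  finally show ?thesis .
qed

text \<open>This is \<open>s \<and> s = 0\<close>: the double sum over removed indices is
  antisymmetric under their exchange and hence equals its own negative.\<close>

lemma wedge_wedge:
  fixes a :: "'n::{finite,linorder} set \<Rightarrow> 'z \<Rightarrow> complex"
  shows "wedge_sum (Suc r) (\<lambda>j K z. s j z * wedge_sum r (\<lambda>j K z. s j z * a K z) K z) J z = 0"
proof (cases "card J = Suc (Suc r)")
  case True
  \<comment> \<open>Setting the diagonal to zero lets both indices range over all of
    \<open>J\<close>, so that the sums can be swapped.\<close>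
  define G where "G = (\<lambda>j k. if j = k then 0 else
    esign j (J - {j}) * (s j z * (esign k (J - {j} - {k}) * (s k z * a (J - {j} - {k}) z))))"
  have anti: "G j k = - G k j" if "j \<in> J" "k \<in> J" for j k
  proof (cases "j = k")
    case False
    define L where "L = J - {j} - {k}"
    have L: "J - {j} = insert k L" "J - {k} = insert j L" "J - {k} - {j} = L" "j \<notin> L" "k \<notin> L"
      using that False by (auto simp: L_def)
    have d: "insert k L - {k} = L" "insert j L - {j} = L" using L(4,5) by auto
    have "G j k = (esign j (insert k L) * esign k L) * (s j z * s k z * a L z)"
      using False unfolding G_def L(1) d by (simp add: mult_ac)
    also have "\<dots> = - ((esign k (insert j L) * esign j L) * (s j z * s k z * a L z))"
      unfolding esign_swap[OF False L(4,5)] by simp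
    also have "(esign k (insert j L) * esign j L) * (s j z * s k z * a L z) = G k j"
      using False unfolding G_def L(2) d by (simp add: mult_ac)
    finally show ?thesis .
  qed (simp add: G_def)
  have "wedge_sum (Suc r) (\<lambda>j K z. s j z * wedge_sum r (\<lambda>j K z. s j z * a K z) K z) J z
      = (\<Sum>j\<in>J. \<Sum>k\<in>J. G j k)"
  proof -
    have "esign j (J - {j}) * (s j z * wedge_sum r (\<lambda>j K z. s j z * a K z) (J - {j}) z) = (\<Sum>k\<in>J. G j k)"
      if j: "j \<in> J" for j
    proof -
      have "card (J - {j}) = Suc r" using True j by simp
      then have "esign j (J - {j}) * (s j z * wedge_sum r (\<lambda>j K z. s j z * a K z) (J - {j}) z)
          = (\<Sum>k\<in>J - {j}. G j k)"
        unfolding wedge_sum_eq[of r] by (simp add: sum_distrib_left) (intro sum.cong refl, auto simp: G_def)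
      also have "\<dots> = (\<Sum>k\<in>J. G j k)"
        by (rule sum.mono_neutral_left) (auto simp: G_def)
      finally show ?thesis .
    qed
    then show ?thesis using True unfolding wedge_sum_eq[of "Suc r"] by simp
  qed
  moreover have "(\<Sum>j\<in>J. \<Sum>k\<in>J. G j k) = - (\<Sum>j\<in>J. \<Sum>k\<in>J. G j k)"
  proof -
    have "(\<Sum>j\<in>J. \<Sum>k\<in>J. G j k) = (\<Sum>k\<in>J. \<Sum>j\<in>J. G j k)" by (rule sum.swap)
    also have "\<dots> = (\<Sum>k\<in>J. \<Sum>j\<in>J. - G k j)" by (intro sum.cong refl anti)
    finally show ?thesis by (simp add: sum_negf)
  qed
  ultimately show ?thesis by (metis eq_neg_iff_add_eq_0 mult_2 mult_eq_0_iff zero_neq_numeral)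
qed (simp add: wedge_sum_eq)

text \<open>With \<open>\<iota>\<close> the contraction by index \<open>i\<close>, this is the
  homotopy formula \<open>s\<^sub>i f = s \<and> \<iota> f + \<iota> (s \<and> f)\<close> in which
  the last term vanishes. If \<open>i \<in> J\<close>, only \<open>j = i\<close> contributes;
  otherwise the closedness relation at \<open>insert i J\<close> expresses the sum through
  \<open>f J\<close>.\<close>

lemma wedge_contraction:
  fixes f :: "'n::{finite,linorder} set \<Rightarrow> 'z \<Rightarrow> complex"
  assumes s: "s i z \<noteq> 0" and J: "card J = Suc r"
    and closed: "wedge_sum (Suc r) (\<lambda>j K z. s j z * f K z) (insert i J) z = 0"
    and a: "\<And>K. a K z = (if i \<in> K then 0 else esign i K * f (insert i K) z / s i z)"
  shows "wedge_sum r (\<lambda>j K z. s j z * a K z) J z = f J z"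
proof (cases "i \<in> J")
  case True
  have "wedge_sum r (\<lambda>j K z. s j z * a K z) J z = (\<Sum>j\<in>J. esign j (J - {j}) * (s j z * a (J - {j}) z))"
    using J by (simp add: wedge_sum_eq)
  also have "\<dots> = (\<Sum>j\<in>{i}. esign j (J - {j}) * (s j z * a (J - {j}) z))"
    by (rule sum.mono_neutral_right) (use True in \<open>auto simp: a\<close>)
  also have "\<dots> = (esign i (J - {i}) * esign i (J - {i})) * f (insert i (J - {i})) z"
    using s by (simp add: a del: esign_sq)
  finally show ?thesis using True by (simp add: insert_absorb)
next
  case False
  have t: "esign j (J - {j}) * (s j z * a (J - {j}) z)
      = - (esign i J / s i z) * (esign j (insert i J - {j}) * (s j z * f (insert i J - {j}) z))" if j: "j \<in> J" for j
  proof -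
    define L where "L = J - {j}"
    have L: "J = insert j L" "insert i J - {j} = insert i L" "j \<notin> L" "i \<notin> L" "j \<noteq> i"
      using j False by (auto simp: L_def)
    \<comment> \<open>\<open>esign_swap\<close> is multiplied by two further signs, whose squares
      are 1, to move one factor across on each side.\<close>
    have "esign i J * esign j (insert i L) = - (esign i L * esign j L)"
    proof -
      have "(esign i (insert j L) * esign j L) * (esign j L * esign j (insert i L))
          = - (esign j (insert i L) * esign i L) * (esign j L * esign j (insert i L))"
        using esign_swap[of i j L] L by simp
      then have "esign i (insert j L) * (esign j L * esign j L) * esign j (insert i L)
          = - (esign i L * esign j L) * (esign j (insert i L) * esign j (insert i L))"
        by (simp only: mult_ac mult_minus_left mult_minus_right)
      then show ?thesis using L(1) by simp
    qed
    then have e: "- (esign i J * esign j (insert i L)) = esign j L * esign i L" by simp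
    have "- (esign i J / s i z) * (esign j (insert i L) * (s j z * f (insert i L) z))
        = (- (esign i J * esign j (insert i L))) * (s j z * f (insert i L) z / s i z)"
      by simp
    also have "\<dots> = esign j L * (s j z * a L z)"
      unfolding e using L(4) by (simp add: a)
    finally show ?thesis unfolding L(2) L_def[symmetric] by simp
  qed
  have "card (insert i J) = Suc (Suc r)" using J False by simp
  then have "0 = (\<Sum>j\<in>insert i J. esign j (insert i J - {j}) * (s j z * f (insert i J - {j}) z))"
    using closed by (simp add: wedge_sum_eq)
  also have "\<dots> = esign i J * (s i z * f J z) + (\<Sum>j\<in>J. esign j (insert i J - {j}) * (s j z * f (insert i J - {j}) z))"
    using False by simp
  finally have sum: "(\<Sum>j\<in>J. esign j (insert i J - {j}) * (s j z * f (insert i J - {j}) z)) = - (esign i J * (s i z * f J z))"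
    by (simp add: eq_neg_iff_add_eq_0 add.commute)
  have "wedge_sum r (\<lambda>j K z. s j z * a K z) J z = (\<Sum>j\<in>J. esign j (J - {j}) * (s j z * a (J - {j}) z))"
    using J by (simp add: wedge_sum_eq)
  also have "\<dots> = - (esign i J / s i z) * (\<Sum>j\<in>J. esign j (insert i J - {j}) * (s j z * f (insert i J - {j}) z))"
    unfolding sum_distrib_left by (intro sum.cong refl t)
  also have "\<dots> = (esign i J * esign i J) * f J z"
    unfolding sum using s by (simp del: esign_sq)
  finally show ?thesis by simp
qed

section \<open>Periods of constant 1-forms and their primitives\<close>

lemma integral_formD:
  fixes c :: "'n::finite \<Rightarrow> complex"
  assumes "integral_form c"
  shows "c j \<in> \<int>"
proof -
  \<comment> \<open>The \<open>j\<close>-th coordinate circle, a closed loop in the torus along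
    which the form has period \<open>2 * pi * c j\<close>.\<close>
  define \<gamma> :: "real \<Rightarrow> real^'n" where "\<gamma> = (\<lambda>s. s *\<^sub>R ((2 * pi) *\<^sub>R axis j 1))"
  have der: "(\<gamma> has_vector_derivative (2 * pi) *\<^sub>R axis j 1) (at s)" for s
    unfolding \<gamma>_def by (auto intro!: derivative_eq_intros)
  have "\<gamma> C1_differentiable_on {0..1}"
    unfolding C1_differentiable_on_def using der by (intro exI[of _ "\<lambda>_. (2 * pi) *\<^sub>R axis j 1"]) auto
  then have "valid_path \<gamma>"
    unfolding valid_path_def by (rule C1_differentiable_imp_piecewise)
  moreover have "torus_eq (\<gamma> 1) y \<longleftrightarrow> torus_eq (\<gamma> 0) y" for y
  proof -
    have lat: "lat (z + axis j 1) = lat z + axis j 1" "lat (z - axis j 1) = lat z - axis j 1" for z :: "int^'n"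
      by (auto simp: lat_def vec_eq_iff axis_def)
    have "\<gamma> 0 = y + (2 * pi) *\<^sub>R lat z \<Longrightarrow> \<gamma> 1 = y + (2 * pi) *\<^sub>R lat (z + axis j 1)"
      "\<gamma> 1 = y + (2 * pi) *\<^sub>R lat z \<Longrightarrow> \<gamma> 0 = y + (2 * pi) *\<^sub>R lat (z - axis j 1)" for z
      by (simp_all add: \<gamma>_def lat algebra_simps)
    then show ?thesis unfolding torus_eq_def by blast
  qed
  ultimately have "cycle1 [(1, \<gamma>)]" by (simp add: cycle1_def)
  then have int: "chain_integral [(1, \<gamma>)] c / of_real (2 * pi) \<in> \<int>"
    using assms by (simp add: integral_form_def)
  have vd: "vector_derivative \<gamma> (at s within {0..1}) = (2 * pi) *\<^sub>R axis j 1" if "s \<in> {0..1}" for s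
    using that by (intro vector_derivative_at_within_ivl[OF der]) auto
  have "(\<Sum>i\<in>UNIV. c i * of_real (((2 * pi) *\<^sub>R axis j (1::real)) $ i)) = c j * of_real (2 * pi)"
    by (simp add: axis_def if_distrib cong: if_cong)
  then have "integral {0..1} (\<lambda>s. \<Sum>i\<in>UNIV. c i * of_real (vector_derivative \<gamma> (at s within {0..1}) $ i))
      = integral {0..1::real} (\<lambda>s. c j * of_real (2 * pi))"
    by (intro integral_cong) (simp only: vd)
  then have "chain_integral [(1, \<gamma>)] c = c j * of_real (2 * pi)"
    unfolding chain_integral_def by simp
  then show ?thesis using int by simp
qed

text \<open>On the covering space a constant form is the differential of a linear function. The
  fundamental theorem of calculus holds despite the finitely many break points of the path.\<close>

lemma path_integral_const:
  fixes c :: "'n::finite \<Rightarrow> complex" and \<gamma> :: "real \<Rightarrow> real^'n"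
  assumes "valid_path \<gamma>"
  shows "integral {0..1} (\<lambda>s. \<Sum>j\<in>UNIV. c j * of_real (vector_derivative \<gamma> (at s within {0..1}) $ j))
    = (\<Sum>j\<in>UNIV. c j * of_real (\<gamma> 1 $ j)) - (\<Sum>j\<in>UNIV. c j * of_real (\<gamma> 0 $ j))"
proof -
  let ?L = "\<lambda>v :: real^'n. \<Sum>j\<in>UNIV. c j * of_real (v $ j)"
  obtain S D where S: "continuous_on {0..1} \<gamma>" "finite S"
    and D: "\<And>x. x \<in> {0..1} - S \<Longrightarrow> (\<gamma> has_vector_derivative D x) (at x)"
    using assms unfolding valid_path_def piecewise_C1_differentiable_on_def C1_differentiable_on_def by blast
  have L: "bounded_linear ?L"
    by (intro bounded_linear_sum bounded_linear_mult_const bounded_linear_const_mult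
        bounded_linear_compose[OF bounded_linear_of_real] bounded_linear_vec_nth)
  have "((\<lambda>s. ?L (vector_derivative \<gamma> (at s within {0..1}))) has_integral (?L (\<gamma> 1) - ?L (\<gamma> 0))) {0..1}"
  proof (rule fundamental_theorem_of_calculus_strong[OF S(2)])
    fix x :: real assume x: "x \<in> {0..1} - S"
    then have "vector_derivative \<gamma> (at x within {0..1}) = D x"
      by (intro vector_derivative_at_within_ivl[OF D]) auto
    then show "((\<lambda>x. ?L (\<gamma> x)) has_vector_derivative ?L (vector_derivative \<gamma> (at x within {0..1}))) (at x)"
      using bounded_linear.has_vector_derivative[OF L D[OF x]] by simp
  next
    show "continuous_on {0..1} (\<lambda>x. ?L (\<gamma> x))"
      by (rule bounded_linear.continuous_on[OF L S(1)])
  qed simp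
  then show ?thesis by (rule integral_unique)
qed

lemma torus_eq_equiv:
  "torus_eq x x" "torus_eq x y \<Longrightarrow> torus_eq y x" "torus_eq x y \<Longrightarrow> torus_eq y w \<Longrightarrow> torus_eq x w"
proof -
  have lat: "lat 0 = (0 :: real^'m)" "lat (- z) = - lat z" "lat (z + z') = lat z + lat z'" for z z' :: "int^'m"
    by (auto simp: lat_def vec_eq_iff)
  show "torus_eq x x" unfolding torus_eq_def by (rule exI[of _ 0]) (simp add: lat)
  show "torus_eq y x" if "torus_eq x y"
  proof -
    obtain z where "x = y + (2 * pi) *\<^sub>R lat z" using \<open>torus_eq x y\<close> unfolding torus_eq_def by blast
    then have "y = x + (2 * pi) *\<^sub>R lat (- z)" by (simp add: lat)
    then show ?thesis unfolding torus_eq_def by blast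
  qed
  show "torus_eq x w" if xy: "torus_eq x y" and yw: "torus_eq y w"
  proof -
    obtain z z' where "x = y + (2 * pi) *\<^sub>R lat z" "y = w + (2 * pi) *\<^sub>R lat z'"
      using xy yw unfolding torus_eq_def by blast
    then have "x = w + (2 * pi) *\<^sub>R lat (z + z')" by (simp add: lat scaleR_add_right)
    then show ?thesis unfolding torus_eq_def by blast
  qed
qed

text \<open>The linear primitive \<open>L\<close> takes values that, modulo \<open>2 * pi\<close>
  times the integers, depend only on the torus point. Replacing every endpoint by a fixed
  representative changes the integral by such a multiple, and what remains is the boundary of the
  cycle, which is zero.\<close>

lemma integral_formI:
  fixes k :: "'n::finite \<Rightarrow> int"
  assumes c: "\<And>j. c j = of_int (k j)"
  shows "integral_form c"
  unfolding integral_form_def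
proof (intro conjI allI impI)
  show "c j \<in> \<real>" for j by (simp add: c)
next
  fix \<sigma> :: "'n chain1" assume \<sigma>: "cycle1 \<sigma>"
  define L where "L = (\<lambda>v :: real^'n. \<Sum>j\<in>UNIV. c j * of_real (v $ j))"
  \<comment> \<open>One representative for each point of the torus; \<open>rp_eq\<close> makes it
    independent of the lift.\<close>
  define rp :: "real^'n \<Rightarrow> real^'n" where "rp = (\<lambda>x. SOME y. torus_eq x y)"
  have rp: "torus_eq x (rp x)" for x
    unfolding rp_def using torus_eq_equiv(1) by (rule someI)
  have rp_eq: "rp x = rp y" if "torus_eq x y" for x y
  proof -
    have "torus_eq x = torus_eq y" using that torus_eq_equiv(2,3) by blast
    then show ?thesis by (simp add: rp_def)
  qed
  have Lrp: "\<exists>n::int. L x = of_real (2 * pi) * of_int n + L (rp x)" for x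
  proof -
    obtain z where "x = rp x + (2 * pi) *\<^sub>R lat z" using rp unfolding torus_eq_def by blast
    then have "x $ j = (rp x + (2 * pi) *\<^sub>R lat z) $ j" for j by (rule arg_cong)
    then have x: "x $ j = rp x $ j + 2 * pi * of_int (z $ j)" for j by (simp add: lat_def)
    have "L x = (\<Sum>j\<in>UNIV. of_real (2 * pi) * of_int (k j * z $ j) + c j * of_real (rp x $ j))"
      unfolding L_def by (intro sum.cong refl) (subst x, simp add: c algebra_simps)
    then show ?thesis
      by (intro exI[of _ "\<Sum>j\<in>UNIV. k j * z $ j"]) (simp add: L_def sum.distrib sum_distrib_left)
  qed
  \<comment> \<open>The representatives of the finitely many endpoints, so that the boundary pairs
    with \<open>L\<close> in a finite sum.\<close>
  define Y where "Y = (\<Union>(k, \<gamma>)\<in>set \<sigma>. {rp (\<gamma> 0), rp (\<gamma> 1)})"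
  have finY: "finite Y" by (auto simp: Y_def)
  have idem: "rp (rp x) = rp x" for x by (rule rp_eq[OF rp, symmetric])
  have Yrp: "rp y = y" if "y \<in> Y" for y
    using that unfolding Y_def by (auto simp: idem)
  have LY: "L (rp x) = (\<Sum>y\<in>Y. of_bool (torus_eq x y) * L y)" if "rp x \<in> Y" for x
  proof -
    have "torus_eq x y \<longleftrightarrow> y = rp x" if "y \<in> Y" for y
      using Yrp[OF that] rp rp_eq by metis
    then have "(\<Sum>y\<in>Y. of_bool (torus_eq x y) * L y) = (\<Sum>y\<in>Y. if y = rp x then L (rp x) else 0)"
      by (intro sum.cong refl) auto
    then show ?thesis using finY that by simp
  qed
  \<comment> \<open>A part of a cycle need not be closed. The induction therefore carries the
    boundary of \<open>\<tau>\<close>, paired with \<open>L\<close> over the fixed set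
    \<open>Y\<close>; for \<open>\<tau> = \<sigma>\<close> all its weights are zero.\<close>
  have "\<exists>n::int. chain_integral \<tau> c = of_real (2 * pi) * of_int n + (\<Sum>y\<in>Y. of_int
      (\<Sum>(k, \<gamma>)\<leftarrow>\<tau>. k * (of_bool (torus_eq (\<gamma> 1) y) - of_bool (torus_eq (\<gamma> 0) y))) * L y)"
    if "set \<tau> \<subseteq> set \<sigma>" for \<tau>
    using that
  proof (induction \<tau>)
    case Nil
    show ?case by (intro exI[of _ 0]) (simp add: chain_integral_def)
  next
    case (Cons e \<tau>)
    obtain q \<gamma> where e: "e = (q, \<gamma>)" by (cases e)
    obtain n :: int where n: "chain_integral \<tau> c = of_real (2 * pi) * of_int n + (\<Sum>y\<in>Y. of_int
      (\<Sum>(k, \<gamma>)\<leftarrow>\<tau>. k * (of_bool (torus_eq (\<gamma> 1) y) - of_bool (torus_eq (\<gamma> 0) y))) * L y)"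
      using Cons by auto
    have in\<sigma>: "(q, \<gamma>) \<in> set \<sigma>" using Cons.prems e by simp
    then have vp: "valid_path \<gamma>" using \<sigma> unfolding cycle1_def by blast
    have Y: "rp (\<gamma> 0) \<in> Y" "rp (\<gamma> 1) \<in> Y" using in\<sigma> unfolding Y_def by blast+
    obtain n0 :: int where n0: "L (\<gamma> 0) = of_real (2 * pi) * of_int n0 + L (rp (\<gamma> 0))"
      using Lrp[of "\<gamma> 0"] by blast
    obtain n1 :: int where n1: "L (\<gamma> 1) = of_real (2 * pi) * of_int n1 + L (rp (\<gamma> 1))"
      using Lrp[of "\<gamma> 1"] by blast
    have "chain_integral (e # \<tau>) c = of_int q * (L (\<gamma> 1) - L (\<gamma> 0)) + chain_integral \<tau> c"
      unfolding chain_integral_def e L_def using path_integral_const[OF vp] by simp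
    also have "\<dots> = of_real (2 * pi) * of_int (q * (n1 - n0) + n)
       + (of_int q * (L (rp (\<gamma> 1)) - L (rp (\<gamma> 0))) + (\<Sum>y\<in>Y. of_int
      (\<Sum>(k, \<gamma>)\<leftarrow>\<tau>. k * (of_bool (torus_eq (\<gamma> 1) y) - of_bool (torus_eq (\<gamma> 0) y))) * L y))"
      unfolding n n0 n1 by (simp add: algebra_simps)
    also have "of_int q * (L (rp (\<gamma> 1)) - L (rp (\<gamma> 0))) + (\<Sum>y\<in>Y. of_int
      (\<Sum>(k, \<gamma>)\<leftarrow>\<tau>. k * (of_bool (torus_eq (\<gamma> 1) y) - of_bool (torus_eq (\<gamma> 0) y))) * L y)
      = (\<Sum>y\<in>Y. of_int (\<Sum>(k, \<gamma>)\<leftarrow>e # \<tau>. k * (of_bool (torus_eq (\<gamma> 1) y) - of_bool (torus_eq (\<gamma> 0) y))) * L y)"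
    proof -
      have "of_int q * (L (rp (\<gamma> 1)) - L (rp (\<gamma> 0)))
          = (\<Sum>y\<in>Y. of_int q * (of_bool (torus_eq (\<gamma> 1) y) * L y - of_bool (torus_eq (\<gamma> 0) y) * L y))"
        unfolding LY[OF Y(1)] LY[OF Y(2)] by (simp only: sum_subtractf sum_distrib_left right_diff_distrib)
      then show ?thesis
        unfolding e by (simp only: sum.distrib[symmetric]) (intro sum.cong refl, simp add: algebra_simps)
    qed
    finally show ?case by blast
  qed
  from this[of \<sigma>] obtain n :: int where "chain_integral \<sigma> c = of_real (2 * pi) * of_int n"
    using \<sigma> unfolding cycle1_def by auto
  then show "chain_integral \<sigma> c / of_real (2 * pi) \<in> \<int>" by simp
qed

lemma smooth_inner:
  fixes w :: "'a::euclidean_space"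
  shows "smooth (\<lambda>t. w \<bullet> t)"
proof -
  have "foldr pdv bs (\<lambda>t. w \<bullet> t) = (\<lambda>t. w \<bullet> t) \<or> (\<exists>\<kappa>. foldr pdv bs (\<lambda>t. w \<bullet> t) = (\<lambda>_. \<kappa>))" for bs
  proof (induction bs)
    case (Cons b bs)
    have "pdv b (\<lambda>t. w \<bullet> t) = (\<lambda>_. w \<bullet> b)"
      by (rule ext, rule pdv_eqI) (auto intro!: derivative_eq_intros)
    moreover have "pdv b (\<lambda>_::'a. \<kappa>::real) = (\<lambda>_. 0)" for \<kappa>
      by (rule ext, rule pdv_eqI) (auto intro!: derivative_eq_intros)
    ultimately show ?case using Cons by auto
  qed simp
  moreover have "(\<lambda>t. w \<bullet> t) differentiable (at x)" for x
    using has_derivative_inner_right[OF has_derivative_ident] unfolding differentiable_def by blast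
  ultimately have "foldr pdv bs (\<lambda>t. w \<bullet> t) differentiable (at x)" for bs x
    by (metis differentiable_const)
  then show ?thesis by (simp add: smooth_def)
qed

lemma real_primitive_inner:
  fixes k :: "int^'n::finite"
  assumes "\<And>j. c j = of_int (k $ j)"
  shows "real_primitive c (\<lambda>t. lat k \<bullet> t)"
proof -
  have "complex_of_real (lat k \<bullet> h) = (\<Sum>j\<in>UNIV. c j * of_real (h $ j))" for h
    by (simp add: inner_vec_def lat_def assms)
  moreover have "((\<lambda>t. complex_of_real (lat k \<bullet> t)) has_derivative (\<lambda>h. complex_of_real (lat k \<bullet> h))) (at t)" for t
    by (intro bounded_linear_of_real[THEN bounded_linear.has_derivative]
        has_derivative_inner_right has_derivative_ident)
  ultimately show ?thesis by (simp add: real_primitive_def smooth_inner)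
qed

section \<open>Global solvability\<close>

definition symb_max :: "('n::finite \<Rightarrow> int^'m::finite \<Rightarrow> complex) \<Rightarrow> (real^'n) \<times> (real^'m) \<Rightarrow> real" where
  "symb_max p z = (MAX j. cmod (symb p j z))"

lemma symb_le_max: "cmod (symb p j z) \<le> symb_max p z"
  unfolding symb_max_def by (intro Max_ge) auto

lemma symb_max_attained: "\<exists>j. cmod (symb p j z) = symb_max p z"
proof -
  have "symb_max p z \<in> range (\<lambda>j. cmod (symb p j z))"
    unfolding symb_max_def by (intro Max_in) auto
  then show ?thesis by auto
qed

lemma symb_max_nonneg: "symb_max p z \<ge> 0"
  using symb_max_attained[of p z] norm_ge_zero by metis

lemma lat_nth: "lat \<eta> $ j = of_int (\<eta> $ j)"
  by (simp add: lat_def)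

lemma symb_lat: "symb p j (lat \<eta>, lat \<xi>) = symbol_L p \<eta> \<xi> $ j"
  by (simp add: symb_def symbol_L_def lat_nth)

lemma symb_max_lat: "symb_max p (lat \<eta>, lat \<xi>) = symbol_norm p \<eta> \<xi>"
  unfolding symb_max_def symbol_norm_def symb_lat by (simp add: symbol_L_def norm_mult)

lemma symb_max_pos_iff: "symbol_L p \<eta> \<xi> \<noteq> 0 \<longleftrightarrow> symb_max p (lat \<eta>, lat \<xi>) > 0"
proof
  assume "symbol_L p \<eta> \<xi> \<noteq> 0"
  then obtain j where "symb p j (lat \<eta>, lat \<xi>) \<noteq> 0" unfolding symb_lat by (auto simp: vec_eq_iff)
  then show "symb_max p (lat \<eta>, lat \<xi>) > 0"
    using symb_le_max[of p j "(lat \<eta>, lat \<xi>)"] by (smt (verit) zero_less_norm_iff)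
next
  assume "symb_max p (lat \<eta>, lat \<xi>) > 0"
  then obtain j where "symb p j (lat \<eta>, lat \<xi>) \<noteq> 0"
    using symb_max_attained[of p "(lat \<eta>, lat \<xi>)"] by force
  then show "symbol_L p \<eta> \<xi> \<noteq> 0" unfolding symb_lat by auto
qed

lemma intlat_latE:
  fixes z :: "(real^'n::finite) \<times> (real^'m::finite)"
  assumes "z \<in> intlat"
  obtains \<eta> \<xi> where "z = (lat \<eta>, lat \<xi>)"
  using assms by (cases z) (auto simp: intlat_prod intlat_vec)

lemma torus_integral_sum:
  assumes "\<And>i. i \<in> I \<Longrightarrow> continuous_on UNIV (f i)"
  shows "torus_integral (\<lambda>x. \<Sum>i\<in>I. f i x) = (\<Sum>i\<in>I. torus_integral (f i))"
  using assms
proof (induction I rule: infinite_finite_induct)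
  case (insert i I)
  have "torus_integral (\<lambda>x. f i x + (\<Sum>i\<in>I. f i x)) = torus_integral (f i) + torus_integral (\<lambda>x. \<Sum>i\<in>I. f i x)"
    using insert.prems by (intro torus_integral_add continuous_intros) auto
  then show ?case using insert by simp
qed (simp_all add: torus_integral_def)

text \<open>Every coefficient of an exact form is a finite combination of partial derivatives of
  periodic functions, and these integrate to zero.\<close>

lemma torus_integral_exact:
  fixes g :: "'n::{finite,linorder} set \<Rightarrow> real^'n::{finite,linorder} \<Rightarrow> complex"
  assumes "exact_form k g"
  shows "torus_integral (g K) = 0"
proof -
  obtain s v where v: "v \<in> smooth_forms s" and g: "g = ext_deriv s v"
    using assms unfolding exact_form_def by blast
  have smooth: "v L \<in> torus_smooth" if "card L = s" for L
    using v that by (auto simp: smooth_forms_def)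
  have b: "axis j (1::real) \<in> Basis" for j :: 'n by (auto simp: Basis_vec_def)
  have c: "continuous_on UNIV (pdv (axis j 1) (v L))" if "card L = s" for j L
    by (rule torus_smoothD(3)[OF torus_smooth_pdv[OF smooth[OF that] b]])
  have "torus_integral (pdv (axis j 1) (v L)) = 0" if "card L = s" for j L
    by (rule torus_integral_pdv)
      (use smooth[OF that] in \<open>auto simp: b c that torus_smooth_def smooth_differentiable\<close>)
  then show ?thesis
    unfolding g ext_deriv_def wedge_sum_def
    by (subst torus_integral_sum, force intro!: continuous_intros c)+
      (simp add: torus_integral_cmult)
qed

text \<open>By Fubini the coefficient at \<open>(\<eta>, \<xi>)\<close> is, up to a constant, the
  \<open>\<eta>\<close>-th coefficient in \<open>t\<close> of the partial coefficient at
  \<open>\<xi>\<close>.\<close>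

lemma fcoef_eq_0:
  fixes f :: "(real^'n::{finite,linorder}) \<times> (real^'m::finite) \<Rightarrow> complex"
  assumes f: "f \<in> torus_smooth"
    and 0: "torus_integral (\<lambda>t. fourier_fun f \<xi> t * cis (- (lat \<eta> \<bullet> t))) = 0"
  shows "fcoef f (lat \<eta>, lat \<xi>) = 0"
proof -
  let ?N = "of_real ((2 * pi) ^ CARD('m)) :: complex"
  have "tcoef f (- (lat \<eta>, lat \<xi>)) = torus_integral (\<lambda>t. torus_integral (\<lambda>x. chr (- (lat \<eta>, lat \<xi>)) (t, x) * f (t, x)))"
    unfolding tcoef_def by (intro torus_integral_Pair continuous_intros torus_smoothD(3)[OF f])
  also have "\<dots> = torus_integral (\<lambda>t. ?N * (fourier_fun f \<xi> t * cis (- (lat \<eta> \<bullet> t))))"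
  proof (intro arg_cong[where f=torus_integral] ext)
    fix t
    have "torus_integral (\<lambda>x. chr (- (lat \<eta>, lat \<xi>)) (t, x) * f (t, x))
        = torus_integral (\<lambda>x. chr (- lat \<eta>) t * (chr (- lat \<xi>) x * f (t, x)))"
      by (simp add: chr_Pair mult.assoc)
    also have "\<dots> = chr (- lat \<eta>) t * torus_integral (\<lambda>x. chr (- lat \<xi>) x * f (t, x))"
      by (rule torus_integral_cmult)
    also have "\<dots> = ?N * (fourier_fun f \<xi> t * cis (- (lat \<eta> \<bullet> t)))"
      unfolding fourier_fun_def cis_lat by (simp add: chr_def)
    finally show "torus_integral (\<lambda>x. chr (- (lat \<eta>, lat \<xi>)) (t, x) * f (t, x))
        = ?N * (fourier_fun f \<xi> t * cis (- (lat \<eta> \<bullet> t)))" .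
  qed
  also have "\<dots> = 0" unfolding torus_integral_cmult 0 by simp
  finally show ?thesis by (simp add: fcoef_def)
qed

section \<open>Sufficiency of the Diophantine bound\<close>

lemma polybdd_norm: "polybdd c \<Longrightarrow> polybdd (\<lambda>z. of_real (cmod (c z)))"
  by (rule polybdd_mono) auto

lemma globally_solvable_if:
  fixes p :: "'n::{finite,linorder} \<Rightarrow> int^'m::finite \<Rightarrow> complex"
  assumes p: "\<And>j. polybdd (\<lambda>z :: (real^'n::{finite,linorder}) \<times> (real^'m). p j (unlat (snd z)))"
    and C: "C > 0" and lam: "lam > 0"
    and dioph: "\<And>\<eta> \<xi>. (\<eta>, \<xi>) \<noteq> (0, 0) \<Longrightarrow> symbol_L p \<eta> \<xi> \<noteq> 0 \<Longrightarrow>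
       symbol_norm p \<eta> \<xi> \<ge> C * norm (lat \<eta>, lat \<xi>) powr (- lam)"
  shows "globally_solvable p r"
  unfolding globally_solvable_def
proof
  fix f assume f: "f \<in> compatible_forms p r"
  then have sm: "card K = Suc r \<Longrightarrow> f K \<in> torus_smooth" "card K \<noteq> Suc r \<Longrightarrow> f K = (\<lambda>_. 0)" for K
    by (auto simp: compatible_forms_def smooth_forms_def)
  have smooth: "f K \<in> torus_smooth" for K
    using sm[of K] by (cases "card K = Suc r") auto
  define c where "c = (\<lambda>K. fcoef (f K))"
  have rc: "rapid (c K)" for K unfolding c_def by (rule rapid_fcoef[OF smooth])
  have dist: "dist_of_fun (f K) = dser (c K)" for K
    using dist_of_fun_fser[OF rc[of K]] by (simp add: c_def fser_fcoef[OF smooth])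
  have c0: "c K z = 0" if "card K \<noteq> Suc r" for K z
    by (simp add: c_def fcoef_def tcoef_def sm(2)[OF that] torus_integral_def)
  have closed: "wedge_sum (Suc r) (\<lambda>j K z. symb p j z * c K z) J z = 0" if z: "z \<in> intlat" for J z
  proof -
    have "op_L p (Suc r) (\<lambda>K. dist_of_fun (f K)) = (\<lambda>_ _. 0)"
      using f by (simp add: compatible_forms_def)
    then have "op_L p (Suc r) (\<lambda>K. dist_of_fun (f K)) J (chr (- z)) = 0" by metis
    moreover have "op_L p (Suc r) (\<lambda>K. dist_of_fun (f K)) J = dser (wedge_sum (Suc r) (\<lambda>j K z. symb p j z * c K z) J)"
      by (intro op_L_dser p rapid_polybdd rc dist)
    ultimately show ?thesis by (simp add: dser_chr[OF z])
  qed
  \<comment> \<open>Here \<open>p j \<xi>\<close> equals \<open>- \<eta> $ j\<close>, so a primitive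
    is \<open>- lat \<eta> \<bullet> t\<close>. The exponential in the compatibility condition is
    then exactly the character that picks out the \<open>\<eta>\<close>-th coefficient, and
    exactness makes its integral zero.\<close>
  have zero: "c K z = 0" if z: "z \<in> intlat" and q: "symb_max p z = 0" for K z
  proof -
    obtain \<eta> \<xi> where zl: "z = (lat \<eta>, lat \<xi>)" using z by (rule intlat_latE)
    have "cmod (symb p j z) \<le> 0" for j using symb_le_max[of p j z] q by simp
    then have pj: "p j \<xi> = of_int ((- \<eta>) $ j)" for j
      by (simp add: zl symb_lat symbol_L_def add_eq_0_iff)
    have "integral_form (\<lambda>j. p j \<xi>)" by (rule integral_formI[OF pj])
    moreover have "real_primitive (\<lambda>j. p j \<xi>) (\<lambda>t. lat (- \<eta>) \<bullet> t)" by (rule real_primitive_inner[OF pj])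
    ultimately have "exact_form (Suc r) (\<lambda>K t. fourier_fun (f K) \<xi> t * cis (lat (- \<eta>) \<bullet> t))"
      using f unfolding compatible_forms_def by blast
    then have "torus_integral (\<lambda>t. fourier_fun (f K) \<xi> t * cis (lat (- \<eta>) \<bullet> t)) = 0"
      by (rule torus_integral_exact)
    moreover have "lat (- \<eta>) = - lat \<eta>" by (simp add: lat_def vec_eq_iff)
    ultimately show ?thesis
      unfolding c_def zl by (intro fcoef_eq_0 smooth) simp
  qed
  define i where "i = (\<lambda>z. SOME j. cmod (symb p j z) = symb_max p z)"
  have i: "cmod (symb p (i z) z) = symb_max p z" for z
    unfolding i_def by (rule someI_ex[OF symb_max_attained])
  \<comment> \<open>At zeros of the symbol, division by zero yields \<open>a K z = 0\<close>; this
    is a valid choice since the coefficient of \<open>f\<close> vanishes there.\<close>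
  define a where "a = (\<lambda>K z. if i z \<in> K then 0 else esign (i z) K * c (insert (i z) K) z / symb p (i z) z)"
  define Q where "Q = (\<lambda>z. 1 / symb_max p z)"
  have pQ: "polybdd (\<lambda>z. of_real (Q z))"
    unfolding polybdd_def
  proof (intro exI ballI)
    fix z :: "(real^'n::{finite,linorder}) \<times> (real^'m)" assume z: "z \<in> intlat"
    let ?k = "nat \<lceil>lam\<rceil>"
    have Q: "Q z \<ge> 0" for z by (simp add: Q_def symb_max_nonneg)
    have ge1: "1 \<le> (1 + norm z) ^ ?k" by (rule one_le_power) simp
    \<comment> \<open>The bound by \<open>C\<close> says nothing at the origin, so
      \<open>Q 0\<close> is added to the constant. Where \<open>symb_max\<close> is zero,
      \<open>Q z\<close> is zero by convention.\<close>
    have "Q z \<le> (1 / C + Q 0) * (1 + norm z) ^ ?k"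
    proof (cases "z = 0 \<or> symb_max p z = 0")
      case True
      then have "Q z \<le> 1 / C + Q 0" using C Q[of 0] by (auto simp: Q_def)
      also have "\<dots> \<le> (1 / C + Q 0) * (1 + norm z) ^ ?k"
        using mult_left_mono[OF ge1, of "1 / C + Q 0"] C Q[of 0] by simp
      finally show ?thesis .
    next
      case False
      obtain \<eta> \<xi> where zl: "z = (lat \<eta>, lat \<xi>)" using z by (rule intlat_latE)
      have q: "symb_max p z > 0" using False symb_max_nonneg[of p z] by simp
      have n1: "norm z \<ge> 1" using intlat_norm_ge_1[OF z] False by simp
      have "symb_max p z \<ge> C * norm z powr (- lam)"
        using dioph[of \<eta> \<xi>] q False unfolding zl symb_max_lat
        by (auto simp: symb_max_pos_iff symb_max_lat zero_prod_def)
      moreover have "norm z powr (- lam) > 0" unfolding powr_gt_zero using n1 by linarith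
      ultimately have "Q z \<le> 1 / (C * norm z powr (- lam))"
        unfolding Q_def using C by (intro divide_left_mono) (auto simp: q)
      also have "\<dots> = (1 / C) * norm z powr lam"
        by (simp add: powr_minus field_simps)
      also have "\<dots> \<le> (1 / C) * (1 + norm z) ^ ?k"
      proof (rule mult_left_mono)
        have "norm z powr lam \<le> norm z powr real ?k"
          using n1 by (intro powr_mono) linarith+
        also have "\<dots> = norm z ^ ?k"
          using n1 by (intro powr_realpow) linarith
        also have "\<dots> \<le> (1 + norm z) ^ ?k" by (intro power_mono) auto
        finally show "norm z powr lam \<le> (1 + norm z) ^ ?k" .
      qed (use C in simp)
      also have "\<dots> \<le> (1 / C + Q 0) * (1 + norm z) ^ ?k"
        using Q[of 0] by (intro mult_right_mono) auto
      finally show ?thesis .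
    qed
    then show "cmod (of_real (Q z)) \<le> (1 / C + Q 0) * (1 + norm z) ^ ?k" using Q[of z] by simp
  qed
  have pa: "polybdd (a K)" for K
  proof -
    \<comment> \<open>The index set \<open>insert (i z) K\<close> varies with \<open>z\<close>;
      summing over all \<open>L\<close> gives one majorant for every choice.\<close>
    have "polybdd (\<lambda>z. (\<Sum>L\<in>UNIV. of_real (cmod (c L z))) * of_real (Q z))"
      by (intro polybdd_mult polybdd_sum polybdd_norm rapid_polybdd rc pQ)
    then show ?thesis
    proof (rule polybdd_mono)
      fix z
      have "cmod (a K z) \<le> cmod (c (insert (i z) K) z) * Q z"
        using i[of z] symb_max_nonneg[of p z] by (simp add: a_def Q_def norm_mult norm_divide)
      also have "\<dots> \<le> (\<Sum>L\<in>UNIV. cmod (c L z)) * Q z"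
        using member_le_sum[of "insert (i z) K" UNIV "\<lambda>L. cmod (c L z)"]
        by (intro mult_right_mono) (auto simp: Q_def symb_max_nonneg)
      also have "\<dots> = cmod ((\<Sum>L\<in>UNIV. of_real (cmod (c L z))) * of_real (Q z))"
      proof -
        have "(\<Sum>L\<in>UNIV. complex_of_real (cmod (c L z))) * of_real (Q z)
            = of_real ((\<Sum>L\<in>UNIV. cmod (c L z)) * Q z)" by simp
        moreover have "0 \<le> (\<Sum>L\<in>UNIV. cmod (c L z)) * Q z"
          by (intro mult_nonneg_nonneg sum_nonneg) (simp_all add: Q_def symb_max_nonneg)
        ultimately show ?thesis by (simp only: norm_of_real abs_of_nonneg)
      qed
      finally show "cmod (a K z) \<le> cmod ((\<Sum>L\<in>UNIV. of_real (cmod (c L z))) * of_real (Q z))" .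
    qed
  qed
  define u where "u = (\<lambda>K. if card K = r then dser (a K) else (\<lambda>_. 0))"
  have "u \<in> dist_forms r"
    by (auto simp: dist_forms_def u_def dser_distribution pa)
  moreover have "op_L p r u = (\<lambda>K. dist_of_fun (f K))"
  proof
    fix J
    have "op_L p r u J = dser (wedge_sum r (\<lambda>j K z. symb p j z * a K z) J)"
      by (intro op_L_dser p pa) (simp add: u_def)
    also have "\<dots> = dser (c J)"
    proof (rule dser_cong)
      fix z :: "(real^'n::{finite,linorder}) \<times> (real^'m)" assume z: "z \<in> intlat"
      show "wedge_sum r (\<lambda>j K z. symb p j z * a K z) J z = c J z"
      proof (cases "card J = Suc r")
        case True
        show ?thesis
        proof (cases "symb_max p z = 0")
          case q0: True
          then have "a K z = 0" for K using i[of z] by (simp add: a_def)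
          then show ?thesis using zero[OF z q0] by (simp add: wedge_sum_def)
        next
          case False
          then have "symb p (i z) z \<noteq> 0" using i[of z] by auto
          then show ?thesis
            by (rule wedge_contraction[OF _ True closed[OF z]]) (simp add: a_def)
        qed
      qed (simp add: wedge_sum_eq c0)
    qed
    finally show "op_L p r u J = dist_of_fun (f J)" by (simp add: dist)
  qed
  ultimately show "\<exists>u\<in>dist_forms r. op_L p r u = (\<lambda>K. dist_of_fun (f K))" by blast
qed

section \<open>Necessity of the Diophantine bound\<close>

lemma symb_max_integral:
  fixes p :: "'n::finite \<Rightarrow> int^'m::finite \<Rightarrow> complex"
  assumes "integral_form (\<lambda>j. p j \<xi>)" "\<eta> \<in> intlat" "symb_max p (\<eta>, lat \<xi>) < 1"
  shows "symb_max p (\<eta>, lat \<xi>) = 0"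
proof -
  obtain j where j: "cmod (symb p j (\<eta>, lat \<xi>)) = symb_max p (\<eta>, lat \<xi>)"
    using symb_max_attained by metis
  obtain k where k: "p j \<xi> = of_int k"
    using integral_formD[OF assms(1), of j] by (auto elim: Ints_cases)
  obtain \<eta>' where \<eta>': "\<eta> = lat \<eta>'" using assms(2) by (auto simp: intlat_vec)
  have "cmod (symb p j (\<eta>, lat \<xi>)) = cmod (of_int (\<eta>' $ j + k))"
    by (simp add: \<eta>' symb_lat symbol_L_def k norm_mult)
  also have "\<dots> = real_of_int \<bar>\<eta>' $ j + k\<bar>" by (simp only: norm_of_int)
  finally have e: "symb_max p (\<eta>, lat \<xi>) = real_of_int \<bar>\<eta>' $ j + k\<bar>" using j by simp
  then have "\<bar>\<eta>' $ j + k\<bar> < 1" using assms(3) by (simp only: of_int_less_1_iff)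
  then have "\<bar>\<eta>' $ j + k\<bar> = 0" by linarith
  then show ?thesis using e by (simp only: of_int_0)
qed

lemma globally_solvable_only_if:
  fixes p :: "'n::{finite,linorder} \<Rightarrow> int^'m::finite \<Rightarrow> complex"
  assumes p: "\<And>j. polybdd (\<lambda>z :: (real^'n::{finite,linorder}) \<times> (real^'m). p j (unlat (snd z)))"
    and r: "r < CARD('n)" and solvable: "globally_solvable p r"
  shows "\<exists>C>0. \<exists>lam>0. \<forall>\<eta> \<xi>. (\<eta>, \<xi>) \<noteq> (0, 0) \<and> symbol_L p \<eta> \<xi> \<noteq> 0 \<longrightarrow>
       symbol_norm p \<eta> \<xi> \<ge> C * norm (lat \<eta>, lat \<xi>) powr (- lam)"
proof (rule ccontr)
  assume neg: "\<not> ?thesis"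
  let ?q = "symb_max p"
  \<comment> \<open>\<open>1 + norm z \<ge> 2\<close> off the origin, so one bound makes the symbol decay both in \<open>z\<close> and in \<open>l\<close>.\<close>
  have "\<exists>z. z \<in> intlat \<and> norm z \<ge> 1 \<and> ?q z > 0 \<and> sqrt (?q z) * (1 + norm z) ^ Suc l \<le> 1" for l
  proof -
    \<comment> \<open>The bound is violated for the constant \<open>(1/2) ^ e\<close> and the
      exponent \<open>e\<close>. Since \<open>2 * norm z \<ge> 1 + norm z\<close>, the symbol is
      below \<open>(1 + norm z)\<close> to the power \<open>- e\<close>, and the square root halves
      \<open>e\<close> to \<open>Suc l\<close>.\<close>
    define e where "e = 2 * Suc l"
    have "(1/2::real) ^ e > 0" "real e > 0" by (simp_all add: e_def)
    then obtain \<eta> \<xi> where z0: "(\<eta>, \<xi>) \<noteq> (0, 0)" and s: "symbol_L p \<eta> \<xi> \<noteq> 0"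
      and less: "symbol_norm p \<eta> \<xi> < (1/2) ^ e * norm (lat \<eta>, lat \<xi>) powr (- real e)"
      using neg by (meson not_le)
    let ?z = "(lat \<eta>, lat \<xi>)"
    have z: "?z \<in> intlat" by (simp add: intlat_prod)
    have "?z \<noteq> 0" using z0 by (auto simp: zero_prod_def)
    then have n1: "norm ?z \<ge> 1" by (rule intlat_norm_ge_1[OF z])
    have "?q ?z < (1/2) ^ e * norm ?z powr (- real e)" using less by (simp add: symb_max_lat)
    also have "norm ?z powr (- real e) = inverse (norm ?z ^ e)"
    proof -
      have "norm ?z > 0" using n1 by linarith
      then show ?thesis by (simp only: powr_minus powr_realpow)
    qed
    also have "(1/2) ^ e * inverse (norm ?z ^ e) = inverse ((2 * norm ?z) ^ e)"
      by (simp add: power_mult_distrib field_simps)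
    also have "\<dots> \<le> inverse ((1 + norm ?z) ^ e)"
      using n1 by (intro le_imp_inverse_le power_mono) (auto intro!: zero_less_power)
    also have "\<dots> = (inverse ((1 + norm ?z) ^ Suc l))\<^sup>2"
      by (simp only: e_def power_inverse power_mult[symmetric] mult.commute)
    finally have "sqrt (?q ?z) \<le> inverse ((1 + norm ?z) ^ Suc l)"
      using n1 by (intro real_le_lsqrt) (auto simp: symb_max_nonneg)
    moreover have "(1 + norm ?z) ^ Suc l > 0" using n1 by (intro zero_less_power) simp
    ultimately have "sqrt (?q ?z) * (1 + norm ?z) ^ Suc l \<le> 1"
      by (simp add: inverse_eq_divide pos_le_divide_eq)
    moreover have "?q ?z > 0" using s by (simp add: symb_max_pos_iff)
    ultimately show ?thesis using z n1 by blast
  qed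
  then obtain Z where Z: "\<And>l. Z l \<in> intlat" "\<And>l. norm (Z l) \<ge> 1" "\<And>l. ?q (Z l) > 0"
    "\<And>l. sqrt (?q (Z l)) * (1 + norm (Z l)) ^ Suc l \<le> 1" by metis
  \<comment> \<open>Coefficients are placed on the set of values, so repetitions in the sequence
    \<open>Z\<close> do no harm.\<close>
  define S where "S = range Z"
  have Sq: "?q z > 0" if "z \<in> S" for z using that Z(3) by (auto simp: S_def)
  have Sq1: "?q z < 1" if zS: "z \<in> S" for z
  proof -
    obtain l where l: "z = Z l" using zS by (auto simp: S_def)
    have "(2::real) ^ 1 \<le> (1 + norm z) ^ 1" using Z(2)[of l] by (simp add: l)
    also have "\<dots> \<le> (1 + norm z) ^ Suc l" by (rule power_increasing) auto
    finally have "sqrt (?q z) * 2 \<le> sqrt (?q z) * (1 + norm z) ^ Suc l"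
      by (intro mult_left_mono) (auto simp: symb_max_nonneg)
    also have "\<dots> \<le> 1" unfolding l by (rule Z(4))
    finally have "sqrt (?q z) < 1" by linarith
    then show ?thesis by simp
  qed
  define i where "i = (\<lambda>z. SOME j. cmod (symb p j z) = ?q z)"
  have i: "cmod (symb p (i z) z) = ?q z" for z
    unfolding i_def by (rule someI_ex[OF symb_max_attained])
  \<comment> \<open>Since \<open>r < CARD('n)\<close>, at least \<open>r\<close> indices remain
    after \<open>i z\<close> is removed.\<close>
  have "\<exists>K. card K = r \<and> i z \<notin> K" for z
  proof -
    have "r \<le> card (UNIV - {i z})" using r by simp
    then obtain K where "K \<subseteq> UNIV - {i z}" "card K = r" by (meson obtain_subset_with_card_n)
    then show ?thesis by blast
  qed
  then obtain K0 where K0: "\<And>z. card (K0 z) = r" "\<And>z. i z \<notin> K0 z" by metis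
  \<comment> \<open>A formal solution, too large to define a distribution. As \<open>c\<close> is
    its product with the symbol, closedness of the data is \<open>wedge_wedge\<close>.\<close>
  define a :: "'n set \<Rightarrow> (real^'n::{finite,linorder}) \<times> (real^'m) \<Rightarrow> complex" where
    "a = (\<lambda>K z. if z \<in> S \<and> K = K0 z then of_real (1 / sqrt (?q z)) else 0)"
  define c where "c = (\<lambda>J z. wedge_sum r (\<lambda>j K z. symb p j z * a K z) J z)"
  \<comment> \<open>Used twice: applied to \<open>a\<close> it shows that the data are small,
    applied to an actual solution it yields the contradiction.\<close>
  have wedge_bound: "cmod (wedge_sum r (\<lambda>j K z. symb p j z * b K z) J z) \<le> CARD('n) * (?q z * B)"
    if b: "\<And>K. card K = r \<Longrightarrow> cmod (b K z) \<le> B" for b J z and B :: real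
  proof (cases "card J = Suc r")
    case True
    have B: "0 \<le> B" using b[OF K0(1)] norm_ge_zero order_trans by blast
    have "wedge_sum r (\<lambda>j K z. symb p j z * b K z) J z
        = (\<Sum>j\<in>J. esign j (J - {j}) * (symb p j z * b (J - {j}) z))"
      using True by (simp add: wedge_sum_eq)
    also have "cmod \<dots> \<le> (\<Sum>j\<in>J. ?q z * B)"
    proof (rule sum_norm_le)
      fix j assume "j \<in> J"
      then have "card (J - {j}) = r" using True by simp
      then have "cmod (symb p j z) * cmod (b (J - {j}) z) \<le> ?q z * B"
        by (intro mult_mono symb_le_max b symb_max_nonneg norm_ge_zero)
      then show "cmod (esign j (J - {j}) * (symb p j z * b (J - {j}) z)) \<le> ?q z * B"
        by (simp add: norm_mult)
    qed
    also have "\<dots> = card J * (?q z * B)" by simp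
    also have "\<dots> \<le> CARD('n) * (?q z * B)"
      using B by (intro mult_right_mono) (auto simp: symb_max_nonneg card_mono)
    finally show ?thesis .
  next
    case False
    have "0 \<le> B" using b[OF K0(1)] norm_ge_zero order_trans by blast
    then show ?thesis using False by (simp add: wedge_sum_eq symb_max_nonneg)
  qed
  have c_bound: "cmod (c J z) \<le> CARD('n) * sqrt (?q z)" if "z \<in> S" for J z
  proof -
    have "cmod (a K z) \<le> 1 / sqrt (?q z)" for K
      using Sq[OF that] by (auto simp: a_def norm_divide)
    then have "cmod (c J z) \<le> CARD('n) * (?q z * (1 / sqrt (?q z)))"
      unfolding c_def by (rule wedge_bound)
    also have "?q z * (1 / sqrt (?q z)) = sqrt (?q z)"
      using Sq[OF that] by (simp add: real_div_sqrt)
    finally show ?thesis .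
  qed
  have c_outside: "c J z = 0" if "z \<notin> S" for J z
    using that by (simp add: c_def a_def wedge_sum_def)
  have rc: "rapid (c J)" for J
    unfolding rapid_def
  proof
    fix k
    \<comment> \<open>For weight \<open>k\<close>, the points \<open>Z l\<close> with
      \<open>l \<ge> k\<close> are controlled by the choice of \<open>Z\<close>; the finitely many
      others contribute at most their sum.\<close>
    define F where "F = Z ` {..<k}"
    let ?g = "\<lambda>z. cmod (c J z) * (1 + norm z) ^ k"
    have g0: "?g z \<ge> 0" for z by simp
    have "?g z \<le> CARD('n) + sum ?g F" for z
    proof (cases "z \<in> S")
      case True
      then obtain l where l: "z = Z l" by (auto simp: S_def)
      show ?thesis
      proof (cases "l < k")
        case True
        then have "?g z \<le> sum ?g F"
          by (intro member_le_sum) (auto simp: F_def l)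
        then show ?thesis by simp
      next
        case False
        have "?g z \<le> (CARD('n) * sqrt (?q z)) * (1 + norm z) ^ Suc l"
          using False by (intro mult_mono c_bound True power_increasing) (auto simp: symb_max_nonneg)
        also have "\<dots> \<le> real CARD('n) * 1"
          unfolding mult.assoc l by (intro mult_left_mono Z(4)) simp
        finally show ?thesis using sum_nonneg[of F ?g] g0 by simp
      qed
    next
      case False
      then show ?thesis using sum_nonneg[of F ?g] g0 by (simp add: c_outside)
    qed
    then show "\<exists>C. \<forall>z\<in>intlat. ?g z \<le> C" by blast
  qed
  define f where "f = (\<lambda>J. fser (c J))"
  have dist: "dist_of_fun (f K) = dser (c K)" for K
    unfolding f_def by (rule dist_of_fun_fser[OF rc])
  have "f \<in> compatible_forms p r"
    unfolding compatible_forms_def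
  proof (intro CollectI conjI allI impI)
    have "c J = (\<lambda>_. 0)" if "card J \<noteq> Suc r" for J
      using that by (simp add: c_def wedge_sum_eq)
    then show "f \<in> smooth_forms (Suc r)"
      by (simp add: smooth_forms_def f_def fser_torus_smooth rc)
    have "op_L p (Suc r) (\<lambda>K. dist_of_fun (f K)) J = (\<lambda>_. 0)" for J
    proof -
      have "op_L p (Suc r) (\<lambda>K. dist_of_fun (f K)) J = dser (wedge_sum (Suc r) (\<lambda>j K z. symb p j z * c K z) J)"
        by (intro op_L_dser p rapid_polybdd rc dist)
      also have "wedge_sum (Suc r) (\<lambda>j K z. symb p j z * c K z) J = (\<lambda>_. 0)"
        unfolding c_def by (intro ext wedge_wedge)
      finally show ?thesis by simp
    qed
    then show "op_L p (Suc r) (\<lambda>K. dist_of_fun (f K)) = (\<lambda>_ _. 0)" by blast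
  next
    \<comment> \<open>No point of \<open>S\<close> lies over such a \<open>\<xi>\<close>, so the
      partial coefficient is identically zero, which is exact with primitive zero.\<close>
    fix \<xi> \<psi> assume int: "integral_form (\<lambda>j. p j \<xi>)"
    have "c J (\<eta>, lat \<xi>) = 0" if "\<eta> \<in> intlat" for J \<eta>
    proof (rule c_outside, rule notI)
      assume "(\<eta>, lat \<xi>) \<in> S"
      from Sq[OF this] Sq1[OF this] symb_max_integral[of p, OF int that] show False by linarith
    qed
    then have "fser (\<lambda>\<eta>. c J (\<eta>, - (- lat \<xi>))) t = 0" for J t
      by (simp add: fser_def cong: infsum_cong)
    then have "fourier_fun (f J) \<xi> t = 0" for J t
      using fser_section[OF rc, of "- lat \<xi>" J t] by (simp add: fourier_fun_def cis_lat f_def)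
    moreover have "exact_form (Suc r) (\<lambda>(_ :: 'n set) (_ :: real^'n::{finite,linorder}). 0)"
    proof -
      have "pdv v (\<lambda>_. 0 :: complex) = (\<lambda>_. 0)" for v :: "real^'n::{finite,linorder}"
        by (intro ext pdv_eqI) simp
      then have "(\<lambda>(_ :: 'n set) _. 0) = ext_deriv r (\<lambda>_ (_ :: real^'n::{finite,linorder}). 0)"
        by (simp add: ext_deriv_def wedge_sum_def fun_eq_iff)
      moreover have "(\<lambda>(_ :: 'n set) (_ :: real^'n::{finite,linorder}). 0) \<in> smooth_forms r"
        by (simp add: smooth_forms_def)
      ultimately show ?thesis unfolding exact_form_def by (intro exI conjI) auto
    qed
    ultimately show "exact_form (Suc r) (\<lambda>K t. fourier_fun (f K) \<xi> t * cis (\<psi> t))" by simp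
  qed
  then obtain u where u: "u \<in> dist_forms r" and sol: "op_L p r u = (\<lambda>K. dist_of_fun (f K))"
    using solvable unfolding globally_solvable_def by blast
  have ud: "u K \<in> torus_distributions" if "card K = r" for K
    using u that by (simp add: dist_forms_def)
  \<comment> \<open>Summing the moduli over \<open>K\<close> gives one constant and one exponent for
    all components of the solution.\<close>
  have "polybdd (\<lambda>z. \<Sum>K | card K = r. of_real (cmod (u K (chr (- z)))))"
    by (intro polybdd_sum polybdd_norm polybdd_distribution ud) simp
  then obtain A k where A: "A \<ge> 0" "\<And>z. z \<in> intlat \<Longrightarrow>
      cmod (\<Sum>K | card K = r. of_real (cmod (u K (chr (- z))))) \<le> A * (1 + norm z) ^ k"
    using polybdd_bound by blast
  have uA: "cmod (u K (chr (- z))) \<le> A * (1 + norm z) ^ k" if "card K = r" "z \<in> intlat" for K z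
  proof -
    have "cmod (u K (chr (- z))) \<le> (\<Sum>K | card K = r. cmod (u K (chr (- z))))"
      using that(1) by (intro member_le_sum) auto
    also have "\<dots> = cmod (\<Sum>K | card K = r. of_real (cmod (u K (chr (- z)))))"
      by (simp add: sum_nonneg flip: of_real_sum)
    also have "\<dots> \<le> A * (1 + norm z) ^ k" by (rule A(2)[OF that(2)])
    finally show ?thesis .
  qed
  \<comment> \<open>The index \<open>k + k'\<close> is used below: \<open>k\<close> factors
    \<open>1 + norm z\<close> cancel the growth of \<open>u\<close>, and the remaining ones are at
    least 2 each, which outweighs \<open>CARD('n) * A\<close>.\<close>
  obtain k' :: nat where k': "CARD('n) * A < 2 ^ k'"
    using real_arch_pow[of 2 "CARD('n) * A"] by auto
  define z where "z = Z (k + k')"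
  have z: "z \<in> intlat" "norm z \<ge> 1" "z \<in> S" by (simp_all add: z_def Z S_def)
  \<comment> \<open>In this component every term other than \<open>j = i z\<close> contains
    \<open>a\<close> at a set different from \<open>K0 z\<close>, so nothing can cancel the largest
    component of the symbol.\<close>
  define J where "J = insert (i z) (K0 z)"
  have cardJ: "card J = Suc r" using K0 by (simp add: J_def)
  let ?V = "(2 * pi) ^ DIM((real^'n::{finite,linorder}) \<times> (real^'m)) :: real"
  have V1: "?V \<ge> 1" using pi_ge_two by (intro one_le_power) simp
  have sq: "sqrt (?q z) > 0" using Sq[OF z(3)] by simp
  have "c J z = (\<Sum>j\<in>J. esign j (J - {j}) * (symb p j z * a (J - {j}) z))"
    using cardJ by (simp add: c_def wedge_sum_eq)
  also have "\<dots> = (\<Sum>j\<in>{i z}. esign j (J - {j}) * (symb p j z * a (J - {j}) z))"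
  proof (rule sum.mono_neutral_right)
    show "\<forall>j\<in>J - {i z}. esign j (J - {j}) * (symb p j z * a (J - {j}) z) = 0"
      using K0(2)[of z] by (auto simp: a_def J_def)
  qed (auto simp: J_def)
  also have "\<dots> = esign (i z) (K0 z) * (symb p (i z) z * of_real (1 / sqrt (?q z)))"
    using K0(2)[of z] z(3) by (simp add: J_def a_def)
  finally have "cmod (c J z) = ?q z / sqrt (?q z)"
    using sq by (simp add: norm_mult norm_divide i)
  also have "\<dots> = sqrt (?q z)" by (simp add: real_div_sqrt symb_max_nonneg)
  finally have cJ: "cmod (c J z) = sqrt (?q z)" .
  have "of_real ?V * c J z = dist_of_fun (f J) (chr (- z))"
    by (simp only: dist dser_chr[OF z(1)])
  also have "\<dots> = op_L p r u J (chr (- z))" by (simp only: sol)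
  also have "\<dots> = wedge_sum r (\<lambda>j K z. symb p j z * u K (chr (- z))) J z"
    by (rule op_L_chr[OF ud z(1)])
  finally have "?V * sqrt (?q z) = cmod (wedge_sum r (\<lambda>j K z. symb p j z * u K (chr (- z))) J z)"
    using cJ abs_of_nonneg[OF order_trans[OF zero_le_one V1]] by (metis norm_mult norm_of_real)
  also have "\<dots> \<le> CARD('n) * (?q z * (A * (1 + norm z) ^ k))"
    by (rule wedge_bound) (simp add: uA z(1))
  finally have 1: "?V * sqrt (?q z) \<le> CARD('n) * (?q z * (A * (1 + norm z) ^ k))" .
  \<comment> \<open>One factor \<open>sqrt (?q z)\<close> is split off to be cancelled against the
    left side; the other still decays faster than \<open>(1 + norm z) ^ k\<close> grows.\<close>
  also have "CARD('n) * (?q z * (A * (1 + norm z) ^ k))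
      = (CARD('n) * A * (sqrt (?q z) * (1 + norm z) ^ k)) * sqrt (?q z)"
  proof -
    have sq2: "sqrt (?q z) * sqrt (?q z) = ?q z" by (simp add: symb_max_nonneg)
    have "CARD('n) * (?q z * (A * (1 + norm z) ^ k))
        = CARD('n) * ((sqrt (?q z) * sqrt (?q z)) * (A * (1 + norm z) ^ k))"
      by (simp only: sq2)
    then show ?thesis by (simp only: mult_ac)
  qed
  finally have "?V \<le> CARD('n) * A * (sqrt (?q z) * (1 + norm z) ^ k)"
    by (rule mult_right_le_imp_le[OF _ sq])
  then have 2: "1 \<le> CARD('n) * A * (sqrt (?q z) * (1 + norm z) ^ k)" using V1 by linarith
  have "2 ^ k' * (sqrt (?q z) * (1 + norm z) ^ k) \<le> (1 + norm z) ^ Suc k' * (sqrt (?q z) * (1 + norm z) ^ k)"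
  proof (rule mult_right_mono)
    have "(2::real) ^ k' \<le> (1 + norm z) ^ k'" using z(2) by (intro power_mono) auto
    also have "\<dots> \<le> (1 + norm z) ^ Suc k'" by (rule power_increasing) auto
    finally show "(2::real) ^ k' \<le> (1 + norm z) ^ Suc k'" .
  qed (use sq in auto)
  also have "\<dots> = sqrt (?q z) * (1 + norm z) ^ Suc (k + k')"
    by (simp add: power_add mult_ac)
  also have "\<dots> \<le> 1" unfolding z_def by (rule Z(4))
  finally have 3: "2 ^ k' * (sqrt (?q z) * (1 + norm z) ^ k) \<le> 1" .
  have "sqrt (?q z) * (1 + norm z) ^ k > 0"
    using sq z(2) by (intro mult_pos_pos zero_less_power) auto
  then have "CARD('n) * A * (sqrt (?q z) * (1 + norm z) ^ k) < 2 ^ k' * (sqrt (?q z) * (1 + norm z) ^ k)"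
    using k' by (intro mult_strict_right_mono) auto
  with 2 3 show False by linarith
qed

theorem theorem3p1:
  fixes p :: "'n::{finite,linorder} \<Rightarrow> int^'m::{finite,linorder} \<Rightarrow> complex"
    and m :: "'n \<Rightarrow> real"
    and r :: nat
  assumes "\<And>j. toroidal_symbol (m j) (p j)"
    and "r < CARD('n)"
  shows "globally_solvable p r \<longleftrightarrow>
    (\<exists>C>0. \<exists>lam>0. \<forall>\<eta> \<xi>. (\<eta>, \<xi>) \<noteq> (0, 0) \<and> symbol_L p \<eta> \<xi> \<noteq> 0 \<longrightarrow>
       symbol_norm p \<eta> \<xi> \<ge> C * norm (lat \<eta>, lat \<xi>) powr (- lam))"
proof -
  have p: "polybdd (\<lambda>z :: (real^'n::{finite,linorder}) \<times> (real^'m::{finite,linorder}). p j (unlat (snd z)))" for j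
    by (rule polybdd_symbol[OF assms(1)])
  show ?thesis (is "_ \<longleftrightarrow> ?D")
  proof
    assume "globally_solvable p r"
    then show ?D by (rule globally_solvable_only_if[OF p assms(2)])
  next
    assume ?D
    then obtain C lam where "C > 0" "lam > 0"
      and "\<And>\<eta> \<xi>. (\<eta>, \<xi>) \<noteq> (0, 0) \<Longrightarrow> symbol_L p \<eta> \<xi> \<noteq> 0 \<Longrightarrow>
        symbol_norm p \<eta> \<xi> \<ge> C * norm (lat \<eta>, lat \<xi>) powr (- lam)"
      by blast
    then show "globally_solvable p r" by (rule globally_solvable_if[OF p])
  qed
qed

end
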